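(* Assume that the data $(H,f,g,m_0)$ satisfy Assumptions (M), (H), (F* ), (G), (SE) listed in the context (where (F* ) does not include any polynomial upper growth bound $|mf_{mm}|\le C_0f_m$ on $f_m$), and that \[ D^2_{xp}H\equiv0,\qquad D^2_{xm}f\equiv0,\qquad\text{and}\qquad \limsup_{x\in\mathbb{T}^d,\,w\to\infty}|h_w(x,w)|<\infty . \] Let $(u,m)\in C^3(\overline{Q_T})\times C^2(\overline{Q_T})$ be a solution to the mean field games system (MFG). Then there exist constants $L,L_1,K,K_1$, with \[ L=L\left(L_1,\,|g_1f_0^{-1}(L_1)|,\,|g_0f_1^{-1}(-L_1)|,\,g_0^{-1}g_1f_0^{-1}(L_1),\,\frac{1}{g_1^{-1}g_0f_1^{-1}(-L_1)}\right),\qquad L_1=L_1(C_0,T), \] \[ K=K(K_1,\beta_{K_1}),\qquad K_1=K_1\left(L,\frac1T,\frac1{1-\tau},f_0\left(\frac1L\right)^-\right), \] such that \[ \|u\|_{C^0(\overline{Q_T})}+\|m(\cdot,T)\|_{C^0(\mathbb{T}^d)}+\left\|\frac1{m(\cdot,T)}\right\|_{C^0(\mathbb{T}^d)}\le L\qquad\text{and}\qquad\|Du\|_{C^0(\overline{Q_T})}\le K. \]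
   Context: Setting. $d\ge 1$ is an integer, $T>0$, $\mathbb{T}^d=\mathbb{R}^d/\mathbb{Z}^d$, $Q_T=\mathbb{T}^d\times(0,T)$. The data are $H:\mathbb{T}^d\times\mathbb{R}^d\to\mathbb{R}$, $f,g:\mathbb{T}^d\times[0,\infty)\to[-\infty,\infty)$, and $m_0:\mathbb{T}^d\to\mathbb{R}$. The system (MFG) is \[-u_t+H(x,D_xu)=f(x,m),\quad m_t-\mathrm{div}(mD_pH(x,D_xu))=0\ \text{ in }Q_T,\qquad m(\cdot,0)=m_0,\ u(\cdot,T)=g(\cdot,m(\cdot,T))\ \text{ on }\mathbb{T}^d.\] $Du=(D_xu,u_t)$ is the full space-time gradient; $a^-$ is the negative part of $a$. Assumptions. $C_0>0$ and $0\le\tau<1$ are fixed constants. For each $x$, $f^{-1}(x,\cdot)$ is the inverse function of $f(x,\cdot)$; $\chi(x,w)=f^{-1}(x,w)\,f_m(x,f^{-1}(x,w))$ and $h=\sqrt\chi$. (M) $m_0\in C^4(\mathbb{T}^d)$, $m_0>0$, $\int_{\mathbb{T}^d}m_0=1$. (H) $H$, $D_pH$, $D^2_{pp}H$ are four times continuously differentiable and, for all $(x,p)$: $\frac1{C_0}I\le D^2_{pp}H\le C_0I$; $D_pH\cdot p\ge 2H-C_0$; $|D^3_{ppp}H|\le C_0(1+|p|)^{-1}$; $|D^3_{xxp}H|\le C_0(1+|p|)^{\tau}$; $|D^3_{xpp}H|\le C_0(1+|p|)^{\tau-1}$. (F* ) $f$ is continuous on $\mathbb{T}^d\times[0,\infty)$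 (with values in $[-\infty,\infty)$), four times continuously differentiable on $\mathbb{T}^d\times(0,\infty)$, strictly increasing in $m$ with $f_m>0$; $\liminf_{x\in\mathbb{T}^d,\,m\to\infty}mf_m(x,m)>0$; $|m(D_xf)_m|\le C_0|D_xf|$; and $|D_xf|,|D^2_{xx}f|\le C_0(1+|f|^{\tau/2}+|mf_m|^{(1+\tau)/2})$. (G) $g$ is continuous on $\mathbb{T}^d\times[0,\infty)$, four times continuously differentiable on $\mathbb{T}^d\times(0,\infty)$, strictly increasing in $m$ with $g_m>0$, and for each $x$, $\lim_{m\to\infty}g(x,m)=\sup g$ and $g(x,0)=\inf g$ (sup and inf over $\mathbb{T}^d\times[0,\infty)$). (SE) $f(x,0)=-\infty$ for all $x\in\mathbb{T}^d$. Convention on $C_0$: $C_0$ is taken large enough that also $\frac1{C_0}|p|^2-C_0\le H\le C_0|p|^2+C_0$, $|D_pH|\le C_0(1+|p|)$, $|D_xH|,|D^2_{xx}H|\le C_0(1+|p|^{1+\tau})$, $|D^2_{xp}H|\le C_0(1+|p|)^\tau$, and $\|\chi(\cdot,0)\|_{C^0(\mathbb{T}^d)}+\|m_0\|_{C^1(\mathbb{T}^d)}+\|f\|_{C^2(\mathbb{T}^d\times[\min m_0,\max m_0])}\le C_0$. Notation. $f_0(m)=\min_{\mathbb{T}^d}f(\cdot,m)$, $f_1(m)=\max_{\mathbb{T}^d}f(\cdot,m)$, $g_0(m)=\min_{\mathbb{T}^d}g(\cdot,m)$, $g_1(m)=\max_{\mathbb{T}^d}g(\cdot,m)$ for $m>0$;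 these are continuous and strictly increasing, and juxtaposition such as $g_1f_0^{-1}(c)$ denotes composition $g_1(f_0^{-1}(c))$. For $K>0$, \[\beta_K=\|f\|_{C^1(\mathbb{T}^d\times[\frac1K,K])}+\|D_xg\|_{C^1(\mathbb{T}^d\times[\frac1K,K])}+\left\|\tfrac1\chi\right\|_{C^0(\mathbb{T}^d\times[-K,\infty))}+\|h_w\|_{C^0(\mathbb{T}^d\times[-K,\infty))}.\] Writing $C=C(K_1,\dots,K_M)$ means that $C$ is a positive constant depending (only, with $d$ fixed) monotonically on the nonnegative quantities $K_1,\dots,K_M$. *)

theory Defs
  imports "HOL-Analysis.Analysis"
begin

text \<open>
  The dimension is \<open>d = CARD('d)\<close>.  A function on the torus is a function on \<open>real ^ 'd\<close> that is
  invariant under integer translations, so suprema, infima and limits over the torus are taken over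
  the whole of \<open>real ^ 'd\<close>.
\<close>

definition torus_fun :: "(real ^ 'd \<Rightarrow> 'b) \<Rightarrow> bool" where
  "torus_fun F \<longleftrightarrow> (\<forall>x v. (\<forall>i. v $ i \<in> \<int>) \<longrightarrow> F (x + v) = F x)"

text \<open>
  Used only for sets on which derivatives within the set are unique: open sets, and the closed slab
  \<open>UNIV \<times> {0..T}\<close>, where it says that the derivatives up to order \<open>k\<close> extend continuously up to the
  boundary.
\<close>

primrec Ck_on :: "nat \<Rightarrow> 'a::euclidean_space set \<Rightarrow> ('a \<Rightarrow> 'b::real_normed_vector) \<Rightarrow> bool" where
  "Ck_on 0 S F \<longleftrightarrow> continuous_on S F"
| "Ck_on (Suc k) S F \<longleftrightarrow>
     (\<exists>F'. (\<forall>z\<in>S. (F has_derivative F' z) (at z within S)) \<and>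
           (\<forall>b\<in>Basis. Ck_on k S (\<lambda>z. F' z b)))"

text \<open>
  Iterating \<open>grad\<close> gives Hessians and third-order tensors.  The norms of the types \<open>'b ^ 'd\<close> and
  \<open>'b \<times> 'c\<close> are Euclidean, so all tensors carry their Euclidean (Frobenius) norm.
\<close>

definition grad :: "(real ^ 'd \<Rightarrow> 'b::real_normed_vector) \<Rightarrow> real ^ 'd \<Rightarrow> 'b ^ 'd" where
  "grad F x = (\<chi> i. frechet_derivative F (at x) (axis i 1))"

definition divergence :: "(real ^ 'd \<Rightarrow> real ^ 'd) \<Rightarrow> real ^ 'd \<Rightarrow> real" where
  "divergence V x = (\<Sum>i\<in>UNIV. grad V x $ i $ i)"

definition D_x :: "(real ^ 'd \<Rightarrow> 'c \<Rightarrow> 'b::real_normed_vector) \<Rightarrow> real ^ 'd \<Rightarrow> 'c \<Rightarrow> 'b ^ 'd" where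
  "D_x F x c = grad (\<lambda>y. F y c) x"

definition D_p :: "('a \<Rightarrow> real ^ 'd \<Rightarrow> 'b::real_normed_vector) \<Rightarrow> 'a \<Rightarrow> real ^ 'd \<Rightarrow> 'b ^ 'd" where
  "D_p F a p = grad (F a) p"

text \<open>Derivative in a scalar second variable (\<open>m\<close> or \<open>w\<close>).\<close>

definition D_m :: "('a \<Rightarrow> real \<Rightarrow> 'b::real_normed_vector) \<Rightarrow> 'a \<Rightarrow> real \<Rightarrow> 'b" where
  "D_m F a s = vector_derivative (F a) (at s)"

definition D_xm :: "(real ^ 'd \<Rightarrow> real \<Rightarrow> 'b::real_normed_vector) \<Rightarrow> real ^ 'd \<Rightarrow> real \<Rightarrow> ('b ^ 'd) \<times> 'b" where
  "D_xm F x s = (D_x F x s, D_m F x s)"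

text \<open>Time derivative on \<open>{0..T}\<close>, one-sided at the end points.\<close>

definition D_t :: "real \<Rightarrow> ('a \<Rightarrow> real \<Rightarrow> real) \<Rightarrow> 'a \<Rightarrow> real \<Rightarrow> real" where
  "D_t T v a t = vector_derivative (v a) (at t within {0..T})"

text \<open>The values in \<open>ennreal\<close> make unbounded functions have norm \<open>\<infinity>\<close>.\<close>

definition C0_norm :: "'a set \<Rightarrow> ('a \<Rightarrow> 'b::real_normed_vector) \<Rightarrow> ennreal" where
  "C0_norm S F = (SUP z\<in>S. ennreal (norm (F z)))"

definition C1_norm :: "((real ^ 'd) \<times> real) set \<Rightarrow> (real ^ 'd \<Rightarrow> real \<Rightarrow> 'b::real_normed_vector) \<Rightarrow> ennreal" where
  "C1_norm S F = C0_norm S (\<lambda>(x, s). F x s) + C0_norm S (\<lambda>(x, s). D_xm F x s)"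

definition C2_norm :: "((real ^ 'd) \<times> real) set \<Rightarrow> (real ^ 'd \<Rightarrow> real \<Rightarrow> 'b::real_normed_vector) \<Rightarrow> ennreal" where
  "C2_norm S F = C1_norm S F + C0_norm S (\<lambda>(x, s). D_xm (D_xm F) x s)"

text \<open>Real powers of \<open>a \<ge> 0\<close> with the convention \<open>0\<^sup>0 = 1\<close>, whereas \<open>0 powr 0 = 0\<close>.\<close>

definition rpow :: "real \<Rightarrow> real \<Rightarrow> real" where
  "rpow a s = (if s = 0 then 1 else a powr s)"

text \<open>
  The couplings \<open>f, g\<close> take values in \<open>[-\<infinity>, \<infinity>)\<close>, modelled by \<open>ereal\<close>; arguments \<open>m < 0\<close> are
  irrelevant.  For \<open>m > 0\<close> the values are finite, and derivatives are those of \<open>rv f\<close>.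
\<close>

definition rv :: "('a \<Rightarrow> real \<Rightarrow> ereal) \<Rightarrow> 'a \<Rightarrow> real \<Rightarrow> real" where
  "rv f x s = real_of_ereal (f x s)"

text \<open>
  Inverse in the second variable.  If \<open>f(x,0) = -\<infinity>\<close> and \<open>f(x,s) \<rightarrow> \<infinity>\<close> as \<open>s \<rightarrow> \<infinity>\<close>, it is defined and
  positive for every real \<open>w\<close>.
\<close>

definition f_inv :: "('a \<Rightarrow> real \<Rightarrow> ereal) \<Rightarrow> 'a \<Rightarrow> real \<Rightarrow> real" where
  "f_inv f x w = the_inv_into {0..} (f x) (ereal w)"

definition chi_f :: "('a \<Rightarrow> real \<Rightarrow> ereal) \<Rightarrow> 'a \<Rightarrow> real \<Rightarrow> real" where
  "chi_f f x w = f_inv f x w * D_m (rv f) x (f_inv f x w)"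

definition h_f :: "('a \<Rightarrow> real \<Rightarrow> ereal) \<Rightarrow> 'a \<Rightarrow> real \<Rightarrow> real" where
  "h_f f x w = sqrt (chi_f f x w)"

text \<open>
  \<open>f\<^sub>0, g\<^sub>0\<close> are \<open>min_over f\<close>, \<open>min_over g\<close>, and \<open>f\<^sub>1, g\<^sub>1\<close> are \<open>max_over f\<close>, \<open>max_over g\<close>.
  For \<open>s > 0\<close> the infimum and supremum are attained, by continuity and periodicity.
\<close>

definition min_over :: "(real ^ 'd \<Rightarrow> real \<Rightarrow> ereal) \<Rightarrow> real \<Rightarrow> real" where
  "min_over f s = (INF x. rv f x s)"

definition max_over :: "(real ^ 'd \<Rightarrow> real \<Rightarrow> ereal) \<Rightarrow> real \<Rightarrow> real" where
  "max_over f s = (SUP x. rv f x s)"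

abbreviation pos_inv :: "(real \<Rightarrow> real) \<Rightarrow> real \<Rightarrow> real" where
  "pos_inv \<phi> \<equiv> the_inv_into {0<..} \<phi>"

text \<open>
  Under the assumptions below (including the bound on \<open>limsup |h\<^sub>w|\<close>) this is finite for every \<open>K > 0\<close>,
  so that \<open>enn2real (beta f g K)\<close> is its value.
\<close>

definition beta :: "(real ^ 'd \<Rightarrow> real \<Rightarrow> ereal) \<Rightarrow> (real ^ 'd \<Rightarrow> real \<Rightarrow> ereal) \<Rightarrow> real \<Rightarrow> ennreal" where
  "beta f g K =
     C1_norm (UNIV \<times> {1 / K..K}) (rv f) + C1_norm (UNIV \<times> {1 / K..K}) (D_x (rv g)) +
     C0_norm (UNIV \<times> {- K..}) (\<lambda>(x, w). 1 / chi_f f x w) +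
     C0_norm (UNIV \<times> {- K..}) (\<lambda>(x, w). D_m (h_f f) x w)"

definition assumption_M :: "(real ^ 'd \<Rightarrow> real) \<Rightarrow> bool" where
  "assumption_M m\<^sub>0 \<longleftrightarrow>
     torus_fun m\<^sub>0 \<and> Ck_on 4 UNIV m\<^sub>0 \<and> (\<forall>x. m\<^sub>0 x > 0) \<and> integral (cbox 0 One) m\<^sub>0 = 1"

definition assumption_H :: "real \<Rightarrow> real \<Rightarrow> (real ^ 'd \<Rightarrow> real ^ 'd \<Rightarrow> real) \<Rightarrow> bool" where
  "assumption_H C\<^sub>0 \<tau> H \<longleftrightarrow>
     torus_fun H \<and>
     Ck_on 4 UNIV (\<lambda>(x, p). H x p) \<and>
     Ck_on 4 UNIV (\<lambda>(x, p). D_p H x p) \<and>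
     Ck_on 4 UNIV (\<lambda>(x, p). D_p (D_p H) x p) \<and>
     (\<forall>x p.
        (\<forall>\<xi>. 1 / C\<^sub>0 * (norm \<xi>)\<^sup>2 \<le> \<xi> \<bullet> (D_p (D_p H) x p *v \<xi>) \<and>
             \<xi> \<bullet> (D_p (D_p H) x p *v \<xi>) \<le> C\<^sub>0 * (norm \<xi>)\<^sup>2) \<and>
        D_p H x p \<bullet> p \<ge> 2 * H x p - C\<^sub>0 \<and>
        norm (D_p (D_p (D_p H)) x p) \<le> C\<^sub>0 / (1 + norm p) \<and>
        norm (D_x (D_x (D_p H)) x p) \<le> C\<^sub>0 * (1 + norm p) powr \<tau> \<and>
        norm (D_x (D_p (D_p H)) x p) \<le> C\<^sub>0 * (1 + norm p) powr (\<tau> - 1))"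

text \<open>Regularity and monotonicity common to \<open>f\<close> and \<open>g\<close>.\<close>

definition coupling :: "(real ^ 'd \<Rightarrow> real \<Rightarrow> ereal) \<Rightarrow> bool" where
  "coupling f \<longleftrightarrow>
     (\<forall>s\<ge>0. torus_fun (\<lambda>x. f x s)) \<and>
     (\<forall>x. \<forall>s\<ge>0. f x s \<noteq> \<infinity>) \<and>
     (\<forall>x. \<forall>s>0. f x s \<noteq> - \<infinity>) \<and>
     continuous_on (UNIV \<times> {0..}) (\<lambda>(x, s). f x s) \<and>
     Ck_on 4 (UNIV \<times> {0<..}) (\<lambda>(x, s). rv f x s) \<and>
     (\<forall>x. strict_mono_on {0..} (f x)) \<and>
     (\<forall>x. \<forall>s>0. D_m (rv f) x s > 0)"

definition assumption_F :: "real \<Rightarrow> real \<Rightarrow> (real ^ 'd \<Rightarrow> real \<Rightarrow> ereal) \<Rightarrow> bool" where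
  "assumption_F C\<^sub>0 \<tau> f \<longleftrightarrow>
     coupling f \<and>
     Liminf (top \<times>\<^sub>F at_top) (\<lambda>(x, s). ereal (s * D_m (rv f) x s)) > 0 \<and>
     (\<forall>x. \<forall>s>0.
        norm (s *\<^sub>R D_m (D_x (rv f)) x s) \<le> C\<^sub>0 * norm (D_x (rv f) x s) \<and>
        norm (D_x (rv f) x s)
          \<le> C\<^sub>0 * (1 + rpow \<bar>rv f x s\<bar> (\<tau> / 2) + rpow \<bar>s * D_m (rv f) x s\<bar> ((1 + \<tau>) / 2)) \<and>
        norm (D_x (D_x (rv f)) x s)
          \<le> C\<^sub>0 * (1 + rpow \<bar>rv f x s\<bar> (\<tau> / 2) + rpow \<bar>s * D_m (rv f) x s\<bar> ((1 + \<tau>) / 2)))"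

definition assumption_G :: "(real ^ 'd \<Rightarrow> real \<Rightarrow> ereal) \<Rightarrow> bool" where
  "assumption_G g \<longleftrightarrow>
     coupling g \<and>
     (\<forall>x. ((g x) \<longlongrightarrow> (SUP (y, s)\<in>UNIV \<times> {0..}. g y s)) at_top \<and>
          g x 0 = (INF (y, s)\<in>UNIV \<times> {0..}. g y s))"

definition assumption_SE :: "(real ^ 'd \<Rightarrow> real \<Rightarrow> ereal) \<Rightarrow> bool" where
  "assumption_SE f \<longleftrightarrow> (\<forall>x. f x 0 = - \<infinity>)"

text \<open>The standing convention that \<open>C\<^sub>0\<close> also dominates the following quantities.\<close>

definition C0_convention ::
  "real \<Rightarrow> real \<Rightarrow> (real ^ 'd \<Rightarrow> real ^ 'd \<Rightarrow> real) \<Rightarrow> (real ^ 'd \<Rightarrow> real \<Rightarrow> ereal) \<Rightarrow> (real ^ 'd \<Rightarrow> real) \<Rightarrow> bool"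
where
  "C0_convention C\<^sub>0 \<tau> H f m\<^sub>0 \<longleftrightarrow>
     (\<forall>x p.
        1 / C\<^sub>0 * (norm p)\<^sup>2 - C\<^sub>0 \<le> H x p \<and> H x p \<le> C\<^sub>0 * (norm p)\<^sup>2 + C\<^sub>0 \<and>
        norm (D_p H x p) \<le> C\<^sub>0 * (1 + norm p) \<and>
        norm (D_x H x p) \<le> C\<^sub>0 * (1 + norm p powr (1 + \<tau>)) \<and>
        norm (D_x (D_x H) x p) \<le> C\<^sub>0 * (1 + norm p powr (1 + \<tau>)) \<and>
        norm (D_x (D_p H) x p) \<le> C\<^sub>0 * (1 + norm p) powr \<tau>) \<and>
     C0_norm UNIV (\<lambda>x. chi_f f x 0) +
     (C0_norm UNIV m\<^sub>0 + C0_norm UNIV (grad m\<^sub>0)) +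
     C2_norm (UNIV \<times> {(INF x. m\<^sub>0 x)..(SUP x. m\<^sub>0 x)}) (rv f) \<le> ennreal C\<^sub>0"

text \<open>
  \<open>u \<in> C\<^sup>3\<close>, \<open>m \<in> C\<^sup>2\<close> up to the boundary.  The condition \<open>m \<ge> 0\<close> is needed for \<open>f(x,m)\<close> and \<open>g(x,m)\<close>
  to be defined; the equations in \<open>ereal\<close> say in particular that their values are finite.
\<close>

definition mfg_classical_solution ::
  "real \<Rightarrow> (real ^ 'd \<Rightarrow> real ^ 'd \<Rightarrow> real) \<Rightarrow> (real ^ 'd \<Rightarrow> real \<Rightarrow> ereal) \<Rightarrow> (real ^ 'd \<Rightarrow> real \<Rightarrow> ereal) \<Rightarrow>
   (real ^ 'd \<Rightarrow> real) \<Rightarrow> (real ^ 'd \<Rightarrow> real \<Rightarrow> real) \<Rightarrow> (real ^ 'd \<Rightarrow> real \<Rightarrow> real) \<Rightarrow> bool"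
where
  "mfg_classical_solution T H f g m\<^sub>0 u m \<longleftrightarrow>
     (\<forall>t\<in>{0..T}. torus_fun (\<lambda>x. u x t) \<and> torus_fun (\<lambda>x. m x t)) \<and>
     Ck_on 3 (UNIV \<times> {0..T}) (\<lambda>(x, t). u x t) \<and>
     Ck_on 2 (UNIV \<times> {0..T}) (\<lambda>(x, t). m x t) \<and>
     (\<forall>x. \<forall>t\<in>{0..T}. m x t \<ge> 0) \<and>
     (\<forall>x. \<forall>t\<in>{0<..<T}.
        ereal (- D_t T u x t + H x (D_x u x t)) = f x (m x t) \<and>
        D_t T m x t - divergence (\<lambda>y. m y t *\<^sub>R D_p H y (D_x u y t)) x = 0) \<and>
     (\<forall>x. m x 0 = m\<^sub>0 x \<and> ereal (u x T) = g x (m x T))"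

text \<open>
  A constant \<open>C = C(K\<^sub>1, \<dots>, K\<^sub>M)\<close> is a positive function of the list \<open>[K\<^sub>1, \<dots>, K\<^sub>M]\<close> that is
  nondecreasing in each of the nonnegative quantities \<open>K\<^sub>i\<close>.
\<close>

definition monotone_constant :: "(real list \<Rightarrow> real) \<Rightarrow> bool" where
  "monotone_constant C \<longleftrightarrow>
     (\<forall>xs ys. list_all2 (\<lambda>a b. 0 \<le> a \<and> a \<le> b) xs ys \<longrightarrow> 0 < C xs \<and> C xs \<le> C ys)"

end

theory Submission
  imports Defs
begin

text \<open>
  The two structural hypotheses split the variables: \<open>H(x,p) = h(p) + A(x)\<close> and
  \<open>f(x,m) = \<phi>(m) + B(x)\<close>.  With \<open>W = A - B\<close> and \<open>w = \<phi>(m) = - u\<^sub>t + h(Du) + W\<close>, eliminating \<open>m\<close> turns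
  the system into the quasilinear elliptic equation \<open>\<A>u + DW \<cdot> V = 0\<close>, where \<open>V = Dh(Du)\<close>,
  \<open>\<chi> = m \<phi>'(m)\<close> and \<open>\<A>v = D\<^sup>2v(a,a) + \<chi> tr (D\<^sup>2h(Du) D\<^sub>x\<^sup>2v)\<close> with the space-time vector \<open>a = (- V, 1)\<close>.

  Comparing \<open>u\<close> with quadratic functions of \<open>t\<close> moves its extrema to \<open>t = T\<close>, where \<open>Du = 0\<close> and the
  equation bounds \<open>f(x,m)\<close>; the terminal condition then bounds \<open>u\<close>, and \<open>m(\<cdot>,T)\<close> from both sides.

  For the gradient, \<open>u\<^sub>t\<close> satisfies the maximum principle, and Bernstein's method is applied to
  \<open>\<Phi> = h(Du) + W + l v\<^sup>2 / 2\<close>, where \<open>v\<close> differs from \<open>u\<close> by an affine function of \<open>t\<close> and has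
  opposite signs at \<open>t = 0\<close> and \<open>t = T\<close>.  At a critical point of \<open>\<Phi>\<close> the dangerous term with the
  derivative of \<open>\<chi>\<close> carries the factor \<open>l v \<partial>\<^sub>a v\<close>, so it is absorbed by \<open>l (\<partial>\<^sub>a v)\<^sup>2\<close> when \<open>l\<close> is small.
  This uses the bound \<open>\<bar>\<chi>\<^sub>w\<bar> \<le> C \<surd>\<chi>\<close>, which is only available where \<open>w\<close> is bounded below.  No lower
  bound on \<open>w\<close> over the whole slab is needed for it: since \<open>u\<^sub>t = \<Phi> - w - l v\<^sup>2 / 2\<close> is maximal on
  the boundary, where \<open>w\<close> is bounded, \<open>w\<close> is bounded below at the maximum of \<open>\<Phi>\<close>.
\<close>

section \<open>Calculus\<close>

text \<open>The elliptic equation is the derivative of \<open>w\<close> along \<open>a\<close>,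
  computed twice: the Hamilton-Jacobi equation expresses it through \<open>D\<^sup>2u(a,a)\<close>
  and \<open>DW\<close>, and the transport equation says that \<open>m\<close> changes along
  \<open>a\<close> at the rate \<open>m tr (D\<^sup>2h(Du) D\<^sub>x\<^sup>2u)\<close>.

  The obstacle is that nothing quantitative is known about \<open>m\<close> inside the slab: the
  value of \<open>f\<close> at \<open>m = 0\<close> forces \<open>m > 0\<close>, but not by how
  much. So \<open>m\<close> is estimated only at \<open>t = 0\<close>, from the data, and at
  \<open>t = T\<close>, from the terminal condition.

  The signs of \<open>v\<close> serve these two boundary pieces. For large \<open>Du\<close> one has
  \<open>\<partial>\<^sub>a v \<le> - |Du|\<^sup>2 / (2c)\<close>, so
  \<open>l v \<partial>\<^sub>a v\<close> has at each end the sign opposite to the one that a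
  boundary maximum of \<open>\<Phi>\<close> imposes on its derivative along \<open>a\<close>.

  Three derivatives of \<open>u\<close> are just enough: \<open>\<Phi>\<close> involves
  \<open>Du\<close> and is differentiated twice, and the equation is differentiated once.

  Every constant has to be fixed before the data are given. They are therefore explicit polynomials
  in one number \<open>k\<close> that dominates all parameters, with generous powers instead of
  sharp ones.\<close>

lemma linear_sum_Basis:
  fixes L :: "'a::euclidean_space \<Rightarrow> 'b::real_normed_vector"
  assumes "linear L"
  shows "L a = (\<Sum>i\<in>Basis. (a \<bullet> i) *\<^sub>R L i)"
  by (metis (no_types, lifting) assms euclidean_representation linear_scale linear_sum sum.cong)

text \<open>The product rule for a linear map applied to a moving vector. Expanding the vector in
  \<open>Basis\<close> reduces it to products of scalars with values in fixed directions, so the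
  derivative of \<open>L\<close> is needed direction by direction only, never as a map into an
  operator space.\<close>

lemma has_derivative_linear_apply:
  fixes L :: "'c::real_normed_vector \<Rightarrow> 'a::euclidean_space \<Rightarrow> 'b::real_normed_vector"
  assumes lin: "\<And>y. y \<in> S \<Longrightarrow> linear (L y)"
    and L: "\<And>a. ((\<lambda>y. L y a) has_derivative L' a) (at z within S)"
    and L'lin: "\<And>b. linear (\<lambda>a. L' a b)"
    and \<alpha>: "(\<alpha> has_derivative \<alpha>') (at z within S)"
    and z: "z \<in> S"
  shows "((\<lambda>y. L y (\<alpha> y)) has_derivative (\<lambda>b. L' (\<alpha> z) b + L z (\<alpha>' b))) (at z within S)"
proof -
  have "((\<lambda>y. \<Sum>i\<in>Basis. (\<alpha> y \<bullet> i) *\<^sub>R L y i) has_derivative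
        (\<lambda>b. \<Sum>i\<in>Basis. (\<alpha> z \<bullet> i) *\<^sub>R L' i b + (\<alpha>' b \<bullet> i) *\<^sub>R L z i)) (at z within S)"
    by (intro has_derivative_sum has_derivative_scaleR L has_derivative_inner_left \<alpha>)
  moreover have "(\<Sum>i\<in>Basis. (\<alpha> z \<bullet> i) *\<^sub>R L' i b + (\<alpha>' b \<bullet> i) *\<^sub>R L z i) = L' (\<alpha> z) b + L z (\<alpha>' b)" for b
    by (simp add: sum.distrib linear_sum_Basis[OF L'lin[of b], symmetric] linear_sum_Basis[OF lin[OF z], symmetric])
  ultimately have *: "((\<lambda>y. \<Sum>i\<in>Basis. (\<alpha> y \<bullet> i) *\<^sub>R L y i) has_derivative
        (\<lambda>b. L' (\<alpha> z) b + L z (\<alpha>' b))) (at z within S)" by simp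
  show ?thesis
    by (rule has_derivative_transform[OF z _ *]) (use lin linear_sum_Basis in blast)
qed

lemma has_real_derivative_line:
  fixes f :: "'a::real_normed_vector \<Rightarrow> real"
  assumes "(f has_derivative f') (at (z + t *\<^sub>R v))"
  shows "((\<lambda>t. f (z + t *\<^sub>R v)) has_real_derivative f' v) (at t)"
proof -
  have "((\<lambda>t. z + t *\<^sub>R v) has_derivative (\<lambda>h. h *\<^sub>R v)) (at t)"
    by (auto intro!: derivative_eq_intros)
  from has_derivative_compose[OF this assms]
  have "((\<lambda>t. f (z + t *\<^sub>R v)) has_derivative (\<lambda>h. f' (h *\<^sub>R v))) (at t)" .
  moreover have "(\<lambda>h. f' (h *\<^sub>R v)) = (*) (f' v)"
    using has_derivative_linear[OF assms] by (auto simp: linear_scale)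
  ultimately show ?thesis by (simp add: has_field_derivative_def)
qed

text \<open>The mean value theorem is used twice: in \<open>s\<close> for the difference of
  \<open>f\<close> along two parallel segments, then in \<open>t\<close> for the resulting
  difference of \<open>f'\<close> in direction \<open>a\<close>.\<close>

lemma second_difference_mvt:
  fixes f :: "'a::real_normed_vector \<Rightarrow> real"
  assumes f: "\<And>y. y \<in> S \<Longrightarrow> (f has_derivative f' y) (at y)"
    and f': "\<And>y. y \<in> S \<Longrightarrow> ((\<lambda>y. f' y a) has_derivative f'' y) (at y)"
    and h: "0 < h"
    and S: "\<And>s t. 0 \<le> s \<Longrightarrow> s \<le> h \<Longrightarrow> 0 \<le> t \<Longrightarrow> t \<le> h \<Longrightarrow> z + s *\<^sub>R a + t *\<^sub>R b \<in> S"
  obtains s t where "0 < s" "s < h" "0 < t" "t < h"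
    "f (z + h *\<^sub>R a + h *\<^sub>R b) - f (z + h *\<^sub>R a) - f (z + h *\<^sub>R b) + f z
       = h * h * f'' (z + s *\<^sub>R a + t *\<^sub>R b) b"
proof -
  have d: "((\<lambda>s. f (z + t *\<^sub>R b + s *\<^sub>R a)) has_real_derivative f' (z + t *\<^sub>R b + s *\<^sub>R a) a) (at s)"
    if "0 \<le> s" "s \<le> h" "0 \<le> t" "t \<le> h" for s t
    by (rule has_real_derivative_line, rule f) (use S[OF that] in \<open>simp add: add.commute add.left_commute\<close>)
  have "((\<lambda>s. f (z + h *\<^sub>R b + s *\<^sub>R a) - f (z + s *\<^sub>R a)) has_real_derivative
     f' (z + h *\<^sub>R b + s *\<^sub>R a) a - f' (z + s *\<^sub>R a) a) (at s)" if "0 \<le> s" "s \<le> h" for s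
    by (rule DERIV_diff) (use d[OF that, of h] d[OF that, of 0] h in auto)
  from MVT2[OF h this] obtain s where s: "0 < s" "s < h"
    "f (z + h *\<^sub>R b + h *\<^sub>R a) - f (z + h *\<^sub>R a) - (f (z + h *\<^sub>R b) - f z)
      = h * (f' (z + h *\<^sub>R b + s *\<^sub>R a) a - f' (z + s *\<^sub>R a) a)"
    by auto
  have "((\<lambda>t. f' (z + s *\<^sub>R a + t *\<^sub>R b) a) has_real_derivative f'' (z + s *\<^sub>R a + t *\<^sub>R b) b) (at t)"
    if "0 \<le> t" "t \<le> h" for t
    by (rule has_real_derivative_line[where f = "\<lambda>y. f' y a"], rule f') (use S[OF _ _ that, of s] s in auto)
  from MVT2[OF h this] obtain t where t: "0 < t" "t < h"
    "f' (z + s *\<^sub>R a + h *\<^sub>R b) a - f' (z + s *\<^sub>R a) a = h * f'' (z + s *\<^sub>R a + t *\<^sub>R b) b"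
    by auto
  have "z + h *\<^sub>R b + s *\<^sub>R a = z + s *\<^sub>R a + h *\<^sub>R b" "z + h *\<^sub>R b + h *\<^sub>R a = z + h *\<^sub>R a + h *\<^sub>R b"
    by (simp_all add: algebra_simps)
  with s(3) t(3) have "f (z + h *\<^sub>R a + h *\<^sub>R b) - f (z + h *\<^sub>R a) - f (z + h *\<^sub>R b) + f z
       = h * h * f'' (z + s *\<^sub>R a + t *\<^sub>R b) b" by simp
  with that s(1,2) t(1,2) show thesis by blast
qed

text \<open>The second difference over a parallelogram does not depend on the order of
  \<open>a\<close> and \<open>b\<close>. Evaluated in both orders it makes the two mixed derivatives
  agree at two points close to \<open>z\<close>, and continuity brings these points to
  \<open>z\<close>.\<close>

lemma second_derivative_symmetric:
  fixes f :: "'a::real_normed_vector \<Rightarrow> real"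
  assumes S: "open S" "z \<in> S"
    and f: "\<And>y. y \<in> S \<Longrightarrow> (f has_derivative f' y) (at y)"
    and f': "\<And>y a. y \<in> S \<Longrightarrow> ((\<lambda>y. f' y a) has_derivative f'' y a) (at y)"
    and cont: "\<And>a b. continuous_on S (\<lambda>y. f'' y a b)"
  shows "f'' z a b = f'' z b a"
proof (rule ccontr)
  assume neq: "f'' z a b \<noteq> f'' z b a"
  define e where "e = \<bar>f'' z a b - f'' z b a\<bar> / 2"
  have e: "e > 0" using neq by (simp add: e_def)
  have ev: "\<forall>\<^sub>F y in nhds z. dist (f'' y c d) (f'' z c d) < e" for c d
  proof -
    have "isCont (\<lambda>y. f'' y c d) z"
      using cont S continuous_on_eq_continuous_at by blast
    then have "((\<lambda>y. f'' y c d) \<longlongrightarrow> f'' z c d) (nhds z)"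
      unfolding continuous_at by (rule tendsto_at_iff_tendsto_nhds[THEN iffD1])
    then show ?thesis using e tendstoD by blast
  qed
  have "\<forall>\<^sub>F y in nhds z. y \<in> S \<and> dist (f'' y a b) (f'' z a b) < e \<and> dist (f'' y b a) (f'' z b a) < e"
    using ev[of a b] ev[of b a] eventually_nhds_in_open[OF S] by eventually_elim auto
  then obtain r where r: "r > 0" and near: "\<And>y. dist y z < r \<Longrightarrow>
      y \<in> S \<and> dist (f'' y a b) (f'' z a b) < e \<and> dist (f'' y b a) (f'' z b a) < e"
    unfolding eventually_nhds_metric by blast
  \<comment> \<open>This size keeps the parallelogram spanned by \<open>h *\<^sub>R a\<close> and
    \<open>h *\<^sub>R b\<close> in the ball of radius \<open>r\<close>; the summand 1 covers
    \<open>a = b = 0\<close>.\<close>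
  define h where "h = r / (2 * (norm a + norm b + 1))"
  have den: "0 < norm a + norm b + 1"
    using norm_ge_zero[of a] norm_ge_zero[of b] by linarith
  have h: "h > 0" using r den by (simp add: h_def)
  have hr: "h * (norm a + norm b) < r"
  proof -
    have "h * (norm a + norm b) \<le> h * (norm a + norm b + 1)" using h by simp
    also have "\<dots> = r / 2" unfolding h_def using den by (simp add: field_simps)
    finally show ?thesis using r by simp
  qed
  have box: "dist (z + s *\<^sub>R a + t *\<^sub>R b) z < r" if "0 \<le> s" "s \<le> h" "0 \<le> t" "t \<le> h" for s t
  proof -
    have "dist (z + s *\<^sub>R a + t *\<^sub>R b) z = norm (s *\<^sub>R a + t *\<^sub>R b)" by (simp add: dist_norm)
    also have "\<dots> \<le> s * norm a + t * norm b"
      by (rule norm_triangle_le) (use that in simp)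
    also have "\<dots> \<le> h * norm a + h * norm b"
      by (intro add_mono mult_right_mono) (use that in auto)
    also have "\<dots> < r" using hr by (simp add: distrib_left)
    finally show ?thesis .
  qed
  obtain s t where st: "0 < s" "s < h" "0 < t" "t < h" and
    1: "f (z + h *\<^sub>R a + h *\<^sub>R b) - f (z + h *\<^sub>R a) - f (z + h *\<^sub>R b) + f z
       = h * h * f'' (z + s *\<^sub>R a + t *\<^sub>R b) a b"
    by (rule second_difference_mvt[OF f f' h, where z = z and b = b]) (use near box in blast)+
  have box': "dist (z + s *\<^sub>R b + t *\<^sub>R a) z < r" if "0 \<le> s" "s \<le> h" "0 \<le> t" "t \<le> h" for s t
    using box[OF that(3,4,1,2)] by (simp add: algebra_simps)
  obtain s' t' where st': "0 < s'" "s' < h" "0 < t'" "t' < h" and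
    2: "f (z + h *\<^sub>R b + h *\<^sub>R a) - f (z + h *\<^sub>R b) - f (z + h *\<^sub>R a) + f z
       = h * h * f'' (z + s' *\<^sub>R b + t' *\<^sub>R a) b a"
    by (rule second_difference_mvt[OF f f' h, where z = z and b = a]) (use near box' in blast)+
  have "z + h *\<^sub>R b + h *\<^sub>R a = z + h *\<^sub>R a + h *\<^sub>R b" by (simp add: algebra_simps)
  with 1 2 have "h * h * f'' (z + s *\<^sub>R a + t *\<^sub>R b) a b = h * h * f'' (z + s' *\<^sub>R b + t' *\<^sub>R a) b a"
    by (simp only:)
  with h have eq: "f'' (z + s *\<^sub>R a + t *\<^sub>R b) a b = f'' (z + s' *\<^sub>R b + t' *\<^sub>R a) b a" by simp
  have "dist (f'' (z + s *\<^sub>R a + t *\<^sub>R b) a b) (f'' z a b) < e"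
    using near[OF box[of s t]] st by simp
  moreover have "dist (f'' (z + s' *\<^sub>R b + t' *\<^sub>R a) b a) (f'' z b a) < e"
    using near[OF box'[of s' t']] st' by simp
  ultimately have "\<bar>f'' z a b - f'' z b a\<bar> < 2 * e"
    using eq unfolding dist_real_def by linarith
  then show False by (simp add: e_def)
qed

text \<open>Everything happens on a line through \<open>z\<close>. If the second derivative were
  positive, the first one, which vanishes at \<open>z\<close>, would be positive just beyond
  \<open>z\<close> and \<open>f\<close> would increase there. The second derivative is needed at
  \<open>z\<close> only.\<close>

lemma second_derivative_test:
  fixes f :: "'a::real_normed_vector \<Rightarrow> real"
  assumes S: "open S" "z \<in> S"
    and max: "\<And>y. y \<in> S \<Longrightarrow> f y \<le> f z"
    and f: "\<And>y. y \<in> S \<Longrightarrow> (f has_derivative f' y) (at y)"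
  shows "f' z v = 0"
    and "((\<lambda>y. f' y v) has_derivative f'') (at z) \<Longrightarrow> f'' v \<le> 0"
proof -
  obtain r where r: "r > 0" "ball z r \<subseteq> S" using S open_contains_ball by blast
  define d where "d = r / (norm v + 1)"
  have den: "norm v + 1 > 0" using norm_ge_zero[of v] by linarith
  have d: "d > 0" using r den by (simp add: d_def)
  have inS: "z + t *\<^sub>R v \<in> S" if "\<bar>t\<bar> < d" for t
  proof -
    have "norm (t *\<^sub>R v) \<le> \<bar>t\<bar> * (norm v + 1)" by (simp add: mult_left_mono)
    also have "\<dots> < d * (norm v + 1)" using that den by simp
    also have "\<dots> = r" using den by (simp add: d_def)
    finally have "dist z (z + t *\<^sub>R v) < r" by (simp add: dist_norm)
    then show ?thesis using r by auto
  qed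
  have D: "((\<lambda>t. f (z + t *\<^sub>R v)) has_real_derivative f' (z + t *\<^sub>R v) v) (at t)" if "\<bar>t\<bar> < d" for t
    by (rule has_real_derivative_line, rule f, rule inS, rule that)
  have "f' (z + 0 *\<^sub>R v) v = 0"
    by (rule DERIV_local_max[OF D d]) (use d inS max in auto)
  then show 0: "f' z v = 0" by simp
  assume f'': "((\<lambda>y. f' y v) has_derivative f'') (at z)"
  show "f'' v \<le> 0"
  proof (rule ccontr)
    assume "\<not> f'' v \<le> 0"
    then have pos: "f'' v > 0" by simp
    have D2: "((\<lambda>t. f' (z + t *\<^sub>R v) v) has_real_derivative f'' v) (at 0)"
      by (rule has_real_derivative_line[where f = "\<lambda>y. f' y v"]) (use f'' in simp)
    from DERIV_pos_inc_right[OF D2 pos] obtain e where e: "e > 0"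
      "\<And>h. 0 < h \<Longrightarrow> h < e \<Longrightarrow> f' z v < f' (z + h *\<^sub>R v) v" by auto
    define h where "h = min d e / 2"
    have h: "h > 0" "h < d" "h < e" using d e by (auto simp: h_def)
    have "\<exists>t>0. t < h \<and> f (z + h *\<^sub>R v) - f (z + 0 *\<^sub>R v) = (h - 0) * f' (z + t *\<^sub>R v) v"
      by (rule MVT2[OF h(1)]) (use h D in auto)
    then obtain t where t: "0 < t" "t < h" "f (z + h *\<^sub>R v) - f z = h * f' (z + t *\<^sub>R v) v" by auto
    have "f' (z + t *\<^sub>R v) v > 0" using e(2)[of t] t h 0 by simp
    then have "f (z + h *\<^sub>R v) > f z" using t h by (metis diff_gt_0_iff_gt mult_pos_pos)
    then show False using max[OF inS[of h]] h by simp
  qed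
qed

section \<open>Positive semidefinite matrices as sums of squares\<close>

lemma inner_matrix_vector:
  fixes A :: "real ^ 'n ^ 'm"
  shows "x \<bullet> (A *v y) = (\<Sum>i\<in>UNIV. \<Sum>j\<in>UNIV. A $ i $ j * x $ i * y $ j)"
  by (simp add: inner_vec_def matrix_vector_mult_def sum_distrib_left mult_ac)

lemma symmetric_matrix_inner:
  fixes A :: "real ^ 'n ^ 'n"
  assumes "\<And>i j. A $ i $ j = A $ j $ i"
  shows "x \<bullet> (A *v y) = y \<bullet> (A *v x)"
  unfolding inner_matrix_vector
  by (subst sum.swap) (simp add: assms mult_ac)

text \<open>Cholesky elimination, by induction on a set \<open>I\<close> of indices outside which
  the rows vanish. A zero diagonal entry forces its whole row to vanish; otherwise subtracting one
  rank-one matrix clears the row and leaves a Schur complement, which is again positive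
  semidefinite.\<close>

lemma psd_decomposition_on:
  fixes P :: "real ^ 'n ^ 'n"
  assumes "finite I"
    and "\<And>i j. P $ i $ j = P $ j $ i" "\<And>x. 0 \<le> x \<bullet> (P *v x)"
    and "\<And>i j. i \<notin> I \<Longrightarrow> P $ i $ j = 0"
  shows "\<exists>q :: 'n \<Rightarrow> real ^ 'n. (\<forall>k. k \<notin> I \<longrightarrow> q k = 0) \<and>
      (\<forall>i j. P $ i $ j = (\<Sum>k\<in>UNIV. q k $ i * q k $ j))"
  using assms
proof (induction I arbitrary: P)
  case empty
  then show ?case by (intro exI[of _ "\<lambda>_. 0"]) auto
next
  case (insert a I)
  note sym = insert.prems(1) and psd = insert.prems(2) and supp = insert.prems(3)
  have Pa: "axis a 1 \<bullet> (P *v x) = (P *v x) $ a" for x by (simp add: inner_axis')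
  have expand: "(x - t *\<^sub>R axis a 1) \<bullet> (P *v (x - t *\<^sub>R axis a 1))
      = x \<bullet> (P *v x) - 2 * t * (P *v x) $ a + t\<^sup>2 * P $ a $ a" for x t
  proof -
    have "axis a 1 \<bullet> (P *v axis a 1) = P $ a $ a"
      by (simp add: Pa) (simp add: matrix_vector_mult_basis column_def)
    moreover have "x \<bullet> (P *v axis a 1) = (P *v x) $ a"
      using symmetric_matrix_inner[OF sym] Pa by metis
    ultimately show ?thesis
      by (simp add: matrix_vector_mult_diff_distrib inner_diff_left inner_diff_right
          matrix_vector_mult_scaleR Pa power2_eq_square algebra_simps)
  qed
  show ?case
  proof (cases "P $ a $ a = 0")
    case True
    have "P $ a $ j = 0" for j
    proof (rule ccontr)
      assume nz: "P $ a $ j \<noteq> 0"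
      define x where "x = (axis j 1 :: real ^ 'n)"
      have Px: "(P *v x) $ a = P $ a $ j" by (simp add: x_def matrix_vector_mult_basis column_def)
      \<comment> \<open>Along \<open>axis a 1\<close> the form is affine in \<open>t\<close> because
        its quadratic coefficient is 0; this \<open>t\<close> brings it to -1.\<close>
      define t where "t = (x \<bullet> (P *v x) + 1) / (2 * P $ a $ j)"
      have "0 \<le> x \<bullet> (P *v x) - 2 * t * P $ a $ j"
        using psd[of "x - t *\<^sub>R axis a 1"] unfolding expand True Px by simp
      also have "\<dots> = -1" using nz by (simp add: t_def field_simps)
      finally show False by simp
    qed
    then have "\<And>i j. i \<notin> I \<Longrightarrow> P $ i $ j = 0" using supp by (metis insertE)
    from insert.IH[OF sym psd this] show ?thesis by blast
  next
    case False
    have Paa: "P $ a $ a > 0"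
      using psd[of "axis a 1"] False unfolding Pa by (simp add: matrix_vector_mult_basis column_def)
    define v where "v = (1 / sqrt (P $ a $ a)) *\<^sub>R P $ a"
    define P' where "P' = (\<chi> i j. P $ i $ j - v $ i * v $ j)"
    have vv: "v $ i * v $ j = P $ a $ i * P $ a $ j / P $ a $ a" for i j
      using Paa by (simp add: v_def field_simps)
    have "P' $ i $ j = P' $ j $ i" for i j by (simp add: P'_def sym mult.commute)
    moreover have "0 \<le> x \<bullet> (P' *v x)" for x
    proof -
      have Px: "(P *v x) $ a = (\<Sum>j\<in>UNIV. P $ a $ j * x $ j)"
        by (simp add: matrix_vector_mult_def)
      have "x \<bullet> (P' *v x) = x \<bullet> (P *v x) - (\<Sum>i\<in>UNIV. \<Sum>j\<in>UNIV. (v $ i * v $ j) * x $ i * x $ j)"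
        unfolding inner_matrix_vector P'_def by (simp add: left_diff_distrib sum_subtractf)
      also have "(\<Sum>i\<in>UNIV. \<Sum>j\<in>UNIV. (v $ i * v $ j) * x $ i * x $ j) = ((P *v x) $ a)\<^sup>2 / P $ a $ a"
        unfolding vv Px power2_eq_square sum_product sum_divide_distrib
        by (intro sum.cong) (auto simp: field_simps)
      \<comment> \<open>The new form at \<open>x\<close> is the old one at \<open>x\<close> minus
        the multiple of \<open>axis a 1\<close> that minimizes it.\<close>
      also have "x \<bullet> (P *v x) - ((P *v x) $ a)\<^sup>2 / P $ a $ a
          = x \<bullet> (P *v x) - 2 * ((P *v x) $ a / P $ a $ a) * (P *v x) $ a + ((P *v x) $ a / P $ a $ a)\<^sup>2 * P $ a $ a"
        using Paa by (simp add: field_simps power2_eq_square)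
      also have "\<dots> \<ge> 0" using psd expand by metis
      finally show ?thesis .
    qed
    moreover have "P' $ i $ j = 0" if "i \<notin> I" for i j
    proof (cases "i = a")
      case True then show ?thesis unfolding P'_def using Paa by (simp add: vv)
    next
      case False
      then have "P $ i $ k = 0" for k using supp[of i k] that by auto
      then show ?thesis unfolding P'_def by (simp add: vv sym[of a i])
    qed
    ultimately obtain q :: "'n \<Rightarrow> real ^ 'n" where q: "\<And>k. k \<notin> I \<Longrightarrow> q k = 0"
      "\<And>i j. P' $ i $ j = (\<Sum>k\<in>UNIV. q k $ i * q k $ j)"
      using insert.IH[of P'] by blast
    have "P $ i $ j = (\<Sum>k\<in>UNIV. (q(a := v)) k $ i * (q(a := v)) k $ j)" for i j
    proof -
      have "q a = 0" using q insert by blast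
      have "P $ i $ j = P' $ i $ j + v $ i * v $ j" by (simp add: P'_def)
      also have "\<dots> = (\<Sum>k\<in>UNIV - {a}. q k $ i * q k $ j) + v $ i * v $ j"
        using \<open>q a = 0\<close> by (simp add: q(2) sum.remove[of UNIV a])
      also have "\<dots> = (\<Sum>k\<in>UNIV. (q(a := v)) k $ i * (q(a := v)) k $ j)"
        by (simp add: sum.remove[of UNIV a])
      finally show ?thesis .
    qed
    moreover have "\<And>k. k \<notin> insert a I \<Longrightarrow> (q(a := v)) k = 0" using q by auto
    ultimately show ?thesis by blast
  qed
qed

text \<open>Writes the trace of \<open>P\<close> against a Hessian as a sum of pure second
  derivatives in the directions \<open>q k\<close>, so that the maximum principle needs nothing
  beyond the one-dimensional second derivative test.\<close>

lemma psd_decomposition: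
  fixes P :: "real ^ 'n ^ 'n"
  assumes "\<And>i j. P $ i $ j = P $ j $ i" "\<And>x. 0 \<le> x \<bullet> (P *v x)"
  shows "\<exists>q :: 'n \<Rightarrow> real ^ 'n. \<forall>i j. P $ i $ j = (\<Sum>k\<in>UNIV. q k $ i * q k $ j)"
  using psd_decomposition_on[OF finite_class.finite_UNIV assms] by auto

section \<open>Maxima of periodic functions\<close>

lemma torus_fun_representative:
  fixes x :: "real ^ 'd"
  obtains v where "\<forall>i. v $ i \<in> \<int>" "x + v \<in> cbox 0 One"
proof
  show "\<forall>i. (\<chi> i. - of_int \<lfloor>x $ i\<rfloor>) $ i \<in> \<int>" by simp
  show "x + (\<chi> i. - of_int \<lfloor>x $ i\<rfloor>) \<in> cbox 0 One"
  proof -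
    have "(One :: real ^ 'd) $ i = 1" for i
      using inner_sum_left_Basis[of "axis i 1 :: real ^ 'd" "\<lambda>_. 1"]
      by (simp add: cart_eq_inner_axis axis_in_Basis_iff)
    then show ?thesis by (auto simp: mem_box_cart) linarith
  qed
qed

text \<open>Periodicity moves every point into the compact set \<open>cbox 0 One \<times> K\<close>.
  The set \<open>K\<close> is left general so as to cover the closed slab, its two boundary sheets
  and a single slice.\<close>

lemma periodic_attains_max:
  fixes \<Phi> :: "(real ^ 'd) \<times> real \<Rightarrow> real"
  assumes K: "compact K" "K \<noteq> {}"
    and per: "\<And>t. t \<in> K \<Longrightarrow> torus_fun (\<lambda>x. \<Phi> (x, t))"
    and cont: "continuous_on (UNIV \<times> K) \<Phi>"
  obtains z where "z \<in> UNIV \<times> K" "\<And>y. y \<in> UNIV \<times> K \<Longrightarrow> \<Phi> y \<le> \<Phi> z"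
proof -
  let ?C = "(cbox 0 One :: (real ^ 'd) set) \<times> K"
  have "(0 :: real ^ 'd) \<in> cbox 0 One" by (auto simp: mem_box)
  then have "compact ?C" "?C \<noteq> {}" using K by (auto intro: compact_Times)
  moreover have "continuous_on ?C \<Phi>" using cont by (rule continuous_on_subset) auto
  ultimately obtain z where z: "z \<in> ?C" "\<And>y. y \<in> ?C \<Longrightarrow> \<Phi> y \<le> \<Phi> z"
    using continuous_attains_sup[of ?C \<Phi>] by blast
  have "\<Phi> y \<le> \<Phi> z" if yK: "y \<in> UNIV \<times> K" for y
  proof -
    obtain x t where y: "y = (x, t)" "t \<in> K" using yK by blast
    obtain v where v: "\<forall>i. v $ i \<in> \<int>" "x + v \<in> cbox 0 One" using torus_fun_representative by blast
    have "\<Phi> (x + v, t) = \<Phi> (x, t)" using per[OF y(2)] v(1) unfolding torus_fun_def by blast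
    then show ?thesis using z(2)[of "(x + v, t)"] v(2) y by simp
  qed
  with that z(1) show thesis by auto
qed

section \<open>Functions of class \<open>C\<^sup>k\<close>\<close>

lemma Ck_on_add:
  "Ck_on k S F \<Longrightarrow> Ck_on k S G \<Longrightarrow> Ck_on k S (\<lambda>z. F z + G z)"
proof (induction k arbitrary: F G)
  case 0
  then show ?case by (simp add: continuous_on_add)
next
  case (Suc k)
  obtain F' G' where *: "\<forall>z\<in>S. (F has_derivative F' z) (at z within S)" "\<forall>z\<in>S. (G has_derivative G' z) (at z within S)"
    and "\<forall>b\<in>Basis. Ck_on k S (\<lambda>z. F' z b)" "\<forall>b\<in>Basis. Ck_on k S (\<lambda>z. G' z b)"
    using Suc.prems by auto
  then have "\<forall>b\<in>Basis. Ck_on k S (\<lambda>z. F' z b + G' z b)" using Suc.IH by blast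
  moreover have "\<forall>z\<in>S. ((\<lambda>z. F z + G z) has_derivative (\<lambda>b. F' z b + G' z b)) (at z within S)"
    using * by (simp add: has_derivative_add)
  ultimately show ?case by (auto intro!: exI[of _ "\<lambda>z b. F' z b + G' z b"])
qed

lemma Ck_on_scaleR:
  "Ck_on k S F \<Longrightarrow> Ck_on k S (\<lambda>z. r *\<^sub>R F z)"
proof (induction k arbitrary: F)
  case 0
  then show ?case by (simp add: continuous_on_scaleR)
next
  case (Suc k)
  obtain F' where *: "\<forall>z\<in>S. (F has_derivative F' z) (at z within S)"
    and "\<forall>b\<in>Basis. Ck_on k S (\<lambda>z. F' z b)"
    using Suc.prems by auto
  then have "\<forall>b\<in>Basis. Ck_on k S (\<lambda>z. r *\<^sub>R F' z b)" using Suc.IH by blast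
  moreover have "\<forall>z\<in>S. ((\<lambda>z. r *\<^sub>R F z) has_derivative (\<lambda>b. r *\<^sub>R F' z b)) (at z within S)"
    using * by (simp add: has_derivative_scaleR_right)
  ultimately show ?case by (auto intro!: exI[of _ "\<lambda>z b. r *\<^sub>R F' z b"])
qed

lemma Ck_on_zero: "Ck_on k S (\<lambda>z. 0)"
proof (induction k)
  case (Suc k)
  then show ?case by (auto intro!: exI[of _ "\<lambda>_ _. 0"])
qed simp

lemma Ck_on_sum:
  assumes "\<And>i. i \<in> I \<Longrightarrow> Ck_on k S (F i)"
  shows "Ck_on k S (\<lambda>z. \<Sum>i\<in>I. F i z)"
  using assms by (induction I rule: infinite_finite_induct) (auto intro: Ck_on_zero Ck_on_add)

text \<open>\<open>Ck_on\<close> controls the derivative in basis directions only and leaves it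
  arbitrary outside \<open>S\<close>. Extending linearly from the basis repairs both: the result is
  linear at every point and of class \<open>k\<close> in every direction.\<close>

lemma Ck_on_Suc_obtain:
  fixes F :: "'a::euclidean_space \<Rightarrow> 'b::real_normed_vector"
  assumes "Ck_on (Suc k) S F"
  obtains F' where "\<And>z. z \<in> S \<Longrightarrow> (F has_derivative F' z) (at z within S)"
    "\<And>z. linear (F' z)" "\<And>a. Ck_on k S (\<lambda>z. F' z a)"
proof -
  obtain F0 where F0: "\<And>z. z \<in> S \<Longrightarrow> (F has_derivative F0 z) (at z within S)"
    "\<And>b. b \<in> Basis \<Longrightarrow> Ck_on k S (\<lambda>z. F0 z b)" using assms by auto
  define F' where "F' z a = (\<Sum>b\<in>Basis. (a \<bullet> b) *\<^sub>R F0 z b)" for z a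
  have "F' z = F0 z" if "z \<in> S" for z
    unfolding F'_def by (rule ext, rule linear_sum_Basis[OF has_derivative_linear[OF F0(1)[OF that]], symmetric])
  moreover have "linear (F' z)" for z unfolding F'_def
    by (intro linearI) (simp_all add: inner_add_left scaleR_add_left sum.distrib scaleR_sum_right)
  moreover have "Ck_on k S (\<lambda>z. F' z a)" for a
    unfolding F'_def by (intro Ck_on_sum Ck_on_scaleR F0)
  ultimately show thesis using that[of F'] F0(1) by simp
qed

lemma Ck_on_continuous_on: "Ck_on k S F \<Longrightarrow> continuous_on S F"
  by (cases k) (auto intro: has_derivative_continuous_on)

lemma Ck_on_SucD: "Ck_on (Suc k) S F \<Longrightarrow> Ck_on k S F"
proof (induction k arbitrary: F)
  case 0
  then show ?case using Ck_on_continuous_on[OF 0] by simp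
next
  case (Suc k)
  from Suc.prems obtain F' where "\<forall>z\<in>S. (F has_derivative F' z) (at z within S)"
     "\<forall>b\<in>Basis. Ck_on (Suc k) S (\<lambda>z. F' z b)" by (auto simp del: Ck_on.simps(2) simp: Ck_on.simps(2)[of "Suc k"])
  then show ?case using Suc.IH by auto
qed

text \<open>A derivative is chosen separately for each direction \<open>a\<close>; re-expanding
  \<open>a\<close> in the basis turns these unrelated choices into one map that is linear in both
  directions.\<close>

lemma Ck_on_linear_step:
  fixes L :: "'c::euclidean_space \<Rightarrow> 'a::euclidean_space \<Rightarrow> 'b::real_normed_vector"
  assumes lin: "\<And>z. linear (L z)" and "\<And>a. Ck_on (Suc k) S (\<lambda>z. L z a)"
  obtains L' where "\<And>z a. z \<in> S \<Longrightarrow> ((\<lambda>z. L z a) has_derivative L' z a) (at z within S)"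
    "\<And>z b. linear (\<lambda>a. L' z a b)" "\<And>z a. linear (L' z a)" "\<And>a b. Ck_on k S (\<lambda>z. L' z a b)"
proof -
  have "\<exists>L'. (\<forall>z\<in>S. ((\<lambda>z. L z a) has_derivative L' z) (at z within S)) \<and> (\<forall>z. linear (L' z)) \<and>
      (\<forall>b. Ck_on k S (\<lambda>z. L' z b))" for a
    by (rule Ck_on_Suc_obtain[OF assms(2)[of a]]; blast)
  from choice[OF allI, OF this] obtain L0 where
    "\<forall>a. (\<forall>z\<in>S. ((\<lambda>z. L z a) has_derivative L0 a z) (at z within S)) \<and> (\<forall>z. linear (L0 a z)) \<and>
      (\<forall>b. Ck_on k S (\<lambda>z. L0 a z b))" ..
  then have L0: "\<And>a z. z \<in> S \<Longrightarrow> ((\<lambda>z. L z a) has_derivative L0 a z) (at z within S)"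
    "\<And>a z. linear (L0 a z)" "\<And>a b. Ck_on k S (\<lambda>z. L0 a z b)" by blast+
  define L' where "L' z a b = (\<Sum>i\<in>Basis. (a \<bullet> i) *\<^sub>R L0 i z b)" for z a b
  show thesis
  proof
    show "((\<lambda>z. L z a) has_derivative L' z a) (at z within S)" if "z \<in> S" for z a
    proof -
      have "((\<lambda>z. \<Sum>i\<in>Basis. (a \<bullet> i) *\<^sub>R L z i) has_derivative L' z a) (at z within S)"
        unfolding L'_def by (intro has_derivative_sum has_derivative_scaleR_right L0 that)
      then show ?thesis by (simp only: linear_sum_Basis[OF lin, symmetric])
    qed
    show "linear (\<lambda>a. L' z a b)" for z b unfolding L'_def
      by (intro linearI) (simp_all add: inner_add_left scaleR_add_left sum.distrib scaleR_sum_right)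
    show "linear (L' z a)" for z a unfolding L'_def
      by (intro linear_compose_sum ballI linear_compose_scale_right L0)
    show "Ck_on k S (\<lambda>z. L' z a b)" for a b
      unfolding L'_def by (intro Ck_on_sum Ck_on_scaleR L0)
  qed
qed

lemma Ck_on_bilinear_step:
  fixes L :: "'c::euclidean_space \<Rightarrow> 'a::euclidean_space \<Rightarrow> 'e::euclidean_space \<Rightarrow> 'b::real_normed_vector"
  assumes lin: "\<And>z b. linear (\<lambda>a. L z a b)" "\<And>z a. linear (L z a)"
    and "\<And>a b. Ck_on (Suc k) S (\<lambda>z. L z a b)"
  obtains L' where "\<And>z a b. z \<in> S \<Longrightarrow> ((\<lambda>z. L z a b) has_derivative L' z a b) (at z within S)"
    "\<And>z b c. linear (\<lambda>a. L' z a b c)" "\<And>z a c. linear (\<lambda>b. L' z a b c)" "\<And>z a b. linear (L' z a b)"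
    "\<And>a b c. Ck_on k S (\<lambda>z. L' z a b c)"
proof -
  have "\<exists>L'. (\<forall>z\<in>S. \<forall>b. ((\<lambda>z. L z a b) has_derivative L' z b) (at z within S)) \<and>
      (\<forall>z c. linear (\<lambda>b. L' z b c)) \<and> (\<forall>z b. linear (L' z b)) \<and>
      (\<forall>b c. Ck_on k S (\<lambda>z. L' z b c))" for a
    by (rule Ck_on_linear_step[of "\<lambda>z. L z a" k S, OF lin(2) assms(3)]; blast)
  from choice[OF allI, OF this] obtain L0 where
    "\<forall>a. (\<forall>z\<in>S. \<forall>b. ((\<lambda>z. L z a b) has_derivative L0 a z b) (at z within S)) \<and>
      (\<forall>z c. linear (\<lambda>b. L0 a z b c)) \<and> (\<forall>z b. linear (L0 a z b)) \<and>
      (\<forall>b c. Ck_on k S (\<lambda>z. L0 a z b c))" ..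
  then have L0: "\<And>a z b. z \<in> S \<Longrightarrow> ((\<lambda>z. L z a b) has_derivative L0 a z b) (at z within S)"
    "\<And>a z c. linear (\<lambda>b. L0 a z b c)" "\<And>a z b. linear (L0 a z b)" "\<And>a b c. Ck_on k S (\<lambda>z. L0 a z b c)"
    by blast+
  define L' where "L' z a b c = (\<Sum>i\<in>Basis. (a \<bullet> i) *\<^sub>R L0 i z b c)" for z a b c
  show thesis
  proof
    show "((\<lambda>z. L z a b) has_derivative L' z a b) (at z within S)" if "z \<in> S" for z a b
    proof -
      have "((\<lambda>z. \<Sum>i\<in>Basis. (a \<bullet> i) *\<^sub>R L z i b) has_derivative L' z a b) (at z within S)"
        unfolding L'_def by (intro has_derivative_sum has_derivative_scaleR_right L0 that)
      then show ?thesis unfolding linear_sum_Basis[OF lin(1)[of _ b], symmetric] .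
    qed
    show "linear (\<lambda>a. L' z a b c)" for z b c unfolding L'_def
      by (intro linearI) (simp_all add: inner_add_left scaleR_add_left sum.distrib scaleR_sum_right)
    show "linear (\<lambda>b. L' z a b c)" for z a c unfolding L'_def
      by (intro linear_compose_sum ballI linear_compose_scale_right L0)
    show "linear (L' z a b)" for z a b unfolding L'_def
      by (intro linear_compose_sum ballI linear_compose_scale_right L0)
    show "Ck_on k S (\<lambda>z. L' z a b c)" for a b c
      unfolding L'_def by (intro Ck_on_sum Ck_on_scaleR L0)
  qed
qed

text \<open>
  Directions are applied in the order of differentiation: \<open>U3 z a b c\<close> is the derivative at \<open>z\<close> in the
  direction \<open>c\<close> of the derivative in the direction \<open>b\<close> of the derivative of \<open>u\<close> in the direction \<open>a\<close>.
\<close>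

locale C3_function =
  fixes S :: "'a::euclidean_space set" and u :: "'a \<Rightarrow> real" and U1 U2 U3
  assumes deriv1: "\<And>z. z \<in> S \<Longrightarrow> (u has_derivative U1 z) (at z within S)"
    and deriv2: "\<And>z a. z \<in> S \<Longrightarrow> ((\<lambda>z. U1 z a) has_derivative U2 z a) (at z within S)"
    and deriv3: "\<And>z a b. z \<in> S \<Longrightarrow> ((\<lambda>z. U2 z a b) has_derivative U3 z a b) (at z within S)"
    and lin1: "\<And>z. linear (U1 z)"
    and lin2: "\<And>z b. linear (\<lambda>a. U2 z a b)" "\<And>z a. linear (U2 z a)"
    and lin3: "\<And>z b c. linear (\<lambda>a. U3 z a b c)" "\<And>z a c. linear (\<lambda>b. U3 z a b c)" "\<And>z a b. linear (U3 z a b)"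
    and cont3: "\<And>a b c. continuous_on S (\<lambda>z. U3 z a b c)"
    and closure: "S \<subseteq> closure (interior S)"
begin

lemma cont0: "continuous_on S u"
  by (rule has_derivative_continuous_on) (rule deriv1)

lemma cont1: "continuous_on S (\<lambda>z. U1 z a)"
  by (rule has_derivative_continuous_on) (rule deriv2)

lemma cont2: "continuous_on S (\<lambda>z. U2 z a b)"
  by (rule has_derivative_continuous_on) (rule deriv3)

lemma interior_derivs:
  assumes "z \<in> interior S"
  shows "(u has_derivative U1 z) (at z)" "((\<lambda>z. U1 z a) has_derivative U2 z a) (at z)"
    "((\<lambda>z. U2 z a b) has_derivative U3 z a b) (at z)"
proof -
  have "z \<in> S" using assms interior_subset by blast
  from deriv1[OF this] deriv2[OF this] deriv3[OF this]
  show "(u has_derivative U1 z) (at z)" "((\<lambda>z. U1 z a) has_derivative U2 z a) (at z)"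
    "((\<lambda>z. U2 z a b) has_derivative U3 z a b) (at z)"
    unfolding at_within_interior[OF assms] by (assumption | blast)+
qed

text \<open>Schwarz's theorem holds inside and passes to boundary points along a sequence of
  interior points, by continuity of \<open>U2\<close> on \<open>S\<close>. The boundary case is what
  makes the identities for \<open>a\<close> available at \<open>t = 0\<close> and
  \<open>t = T\<close>.\<close>

lemma sym2: 
  assumes "z \<in> S"
  shows "U2 z a b = U2 z b a"
proof -
  have "U2 z a b = U2 z b a" if "z \<in> interior S" for z
    by (rule second_derivative_symmetric[OF open_interior that interior_derivs(1,2)
        continuous_on_subset[OF cont2 interior_subset]])
  then have "U2 z a b - U2 z b a = 0" if "z \<in> interior S" for z using that by simp
  moreover have "continuous_on S (\<lambda>z. U2 z a b - U2 z b a)"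
    by (intro continuous_intros cont2)
  moreover have "z \<in> closure (interior S)" using assms closure by blast
  then obtain x where x: "\<And>n::nat. x n \<in> interior S" "x \<longlonglongrightarrow> z"
    unfolding closure_sequential by blast
  moreover have "x n \<in> S" for n using x interior_subset by blast
  ultimately have "(\<lambda>n. U2 (x n) a b - U2 (x n) b a) \<longlonglongrightarrow> U2 z a b - U2 z b a"
    using assms continuous_on_tendsto_compose[of S "\<lambda>z. U2 z a b - U2 z b a" x z] by simp
  moreover have "(\<lambda>n. U2 (x n) a b - U2 (x n) b a) = (\<lambda>_. 0)"
    using \<open>\<And>z. z \<in> interior S \<Longrightarrow> U2 z a b - U2 z b a = 0\<close> x by auto
  ultimately have "(\<lambda>_. 0) \<longlonglongrightarrow> U2 z a b - U2 z b a" by simp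
  from LIMSEQ_unique[OF this tendsto_const] show ?thesis by simp
qed

text \<open>The first exchange is \<open>sym2\<close> differentiated once more; the second is
  Schwarz's theorem for the function \<open>U1 z a\<close>.\<close>

lemma sym3:
  assumes z: "z \<in> interior S"
  shows "U3 z a b c = U3 z b a c" "U3 z a b c = U3 z a c b"
proof -
  have "((\<lambda>z. U2 z b a) has_derivative U3 z a b) (at z)"
    by (rule has_derivative_transform_within_open[OF interior_derivs(3)[OF z] open_interior z])
      (rule sym2, use interior_subset in blast)
  then show "U3 z a b c = U3 z b a c"
    by (rule fun_cong[OF has_derivative_unique[OF _ interior_derivs(3)[OF z]]])
  show "U3 z a b c = U3 z a c b"
    by (rule second_derivative_symmetric[OF open_interior z interior_derivs(2,3)
        continuous_on_subset[OF cont3 interior_subset]])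
qed

end

lemma Ck_on_3_obtain:
  assumes "Ck_on 3 S u" "S \<subseteq> closure (interior S)"
  obtains U1 U2 U3 where "C3_function S u U1 U2 U3"
proof -
  have "Ck_on (Suc (Suc (Suc 0))) S u" using assms(1) by (simp add: numeral_3_eq_3)
  obtain U1 where U1:
    "\<And>z. z \<in> S \<Longrightarrow> (u has_derivative U1 z) (at z within S)"
    "\<And>z. linear (U1 z)" "\<And>a. Ck_on (Suc (Suc 0)) S (\<lambda>z. U1 z a)"
    by (rule Ck_on_Suc_obtain[OF \<open>Ck_on (Suc (Suc (Suc 0))) S u\<close>]; blast)
  obtain U2 where U2:
    "\<And>z a. z \<in> S \<Longrightarrow> ((\<lambda>z. U1 z a) has_derivative U2 z a) (at z within S)"
    "\<And>z b. linear (\<lambda>a. U2 z a b)" "\<And>z a. linear (U2 z a)" "\<And>a b. Ck_on (Suc 0) S (\<lambda>z. U2 z a b)"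
    by (rule Ck_on_linear_step[OF U1(2,3)]; blast)
  obtain U3 where U3:
    "\<And>z a b. z \<in> S \<Longrightarrow> ((\<lambda>z. U2 z a b) has_derivative U3 z a b) (at z within S)"
    "\<And>z b c. linear (\<lambda>a. U3 z a b c)" "\<And>z a c. linear (\<lambda>b. U3 z a b c)" "\<And>z a b. linear (U3 z a b)"
    "\<And>a b c. Ck_on 0 S (\<lambda>z. U3 z a b c)"
    by (rule Ck_on_bilinear_step[OF U2(2,3,4)]; blast)
  have "continuous_on S (\<lambda>z. U3 z a b c)" for a b c using U3(5)[of a b c] by simp
  from C3_function.intro[OF U1(1) U2(1) U3(1) U1(2) U2(2,3) U3(2-4) this assms(2)]
  show thesis by (rule that)
qed

section \<open>The differentiated equation and the maximum principle\<close>

lemma linear_axis_sum: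
  fixes L :: "(real ^ 'd) \<times> real \<Rightarrow> real"
  assumes "linear L"
  shows "L (y, 0) = (\<Sum>i\<in>UNIV. y $ i * L (axis i 1, 0))"
proof -
  have "(y, 0 :: real) = (\<Sum>i\<in>UNIV. y $ i *\<^sub>R (axis i 1, 0))"
  proof (rule prod_eqI)
    have "fst (\<Sum>i\<in>UNIV. y $ i *\<^sub>R (axis i 1, 0 :: real)) = (\<Sum>i\<in>UNIV. y $ i *\<^sub>R axis i 1)"
      by (simp add: fst_sum)
    also have "\<dots> = y" by (simp add: vec_eq_iff axis_def if_distrib cong: if_cong)
    finally show "fst (y, 0 :: real) = fst (\<Sum>i\<in>UNIV. y $ i *\<^sub>R (axis i 1, 0 :: real))" by simp
  qed (simp add: snd_sum)
  then have "L (y, 0) = L (\<Sum>i\<in>UNIV. y $ i *\<^sub>R (axis i 1, 0))" by simp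
  also have "\<dots> = (\<Sum>i\<in>UNIV. y $ i * L (axis i 1, 0))"
    using assms by (simp add: linear_sum linear_scale del: scaleR_Pair)
  finally show ?thesis .
qed

text \<open>Applied both to second derivatives and, with one direction frozen, to third
  derivatives.\<close>

lemma bilinear_trace:
  fixes B :: "(real ^ 'd) \<times> real \<Rightarrow> (real ^ 'd) \<times> real \<Rightarrow> real" and P :: "real ^ 'd ^ 'd"
  assumes "\<And>b. linear (\<lambda>a. B a b)" "\<And>a. linear (B a)"
    and P: "\<And>i j. P $ i $ j = (\<Sum>k\<in>UNIV. q k $ i * q k $ j)"
  shows "(\<Sum>i\<in>UNIV. \<Sum>j\<in>UNIV. P $ i $ j * B (axis i 1, 0) (axis j 1, 0)) = (\<Sum>k\<in>UNIV. B (q k, 0) (q k, 0))"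
proof -
  have "B (y, 0) (y, 0) = (\<Sum>i\<in>UNIV. \<Sum>j\<in>UNIV. (y $ i * y $ j) * B (axis i 1, 0) (axis j 1, 0))" for y
    unfolding linear_axis_sum[OF assms(1)[of "(y, 0)"], of y]
    by (simp add: linear_axis_sum[OF assms(2), of _ y] sum_distrib_left mult_ac)
  then have "(\<Sum>k\<in>UNIV. B (q k, 0) (q k, 0))
     = (\<Sum>k\<in>UNIV. \<Sum>i\<in>UNIV. \<Sum>j\<in>UNIV. (q k $ i * q k $ j) * B (axis i 1, 0) (axis j 1, 0))" by simp
  also have "\<dots> = (\<Sum>i\<in>UNIV. \<Sum>j\<in>UNIV. \<Sum>k\<in>UNIV. (q k $ i * q k $ j) * B (axis i 1, 0) (axis j 1, 0))"
    by (subst sum.swap, intro sum.cong refl, rule sum.swap)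
  finally show ?thesis by (simp add: P sum_distrib_right)
qed

lemma norm_matrix_vector_le:
  fixes A :: "real ^ 'n ^ 'm"
  shows "norm (A *v x) \<le> norm A * norm x"
proof (rule power2_le_imp_le)
  have "(norm (A *v x))\<^sup>2 = (\<Sum>i\<in>UNIV. (A $ i \<bullet> x)\<^sup>2)"
    unfolding norm_vec_def L2_set_def
    by (simp add: sum_nonneg matrix_vector_mult_def inner_vec_def)
  also have "\<dots> \<le> (\<Sum>i\<in>UNIV. (norm (A $ i) * norm x)\<^sup>2)"
    by (intro sum_mono) (metis Cauchy_Schwarz_ineq2 abs_ge_zero power2_abs power_mono)
  also have "\<dots> = (norm A * norm x)\<^sup>2"
    unfolding norm_vec_def[of A] L2_set_def
    by (simp add: power_mult_distrib sum_distrib_right sum_nonneg)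
  finally show "(norm (A *v x))\<^sup>2 \<le> (norm A * norm x)\<^sup>2" .
qed simp

text \<open>One-sided, so that it applies on the boundary of the slab to directions pointing
  inwards.\<close>

lemma directional_derivative_nonpos_at_max:
  fixes f :: "'a::real_normed_vector \<Rightarrow> real"
  assumes f: "(f has_derivative f') (at z within S)"
    and max: "\<And>y. y \<in> S \<Longrightarrow> f y \<le> f z"
    and d: "d > 0" "\<And>h. 0 \<le> h \<Longrightarrow> h < d \<Longrightarrow> z + h *\<^sub>R v \<in> S"
  shows "f' v \<le> 0"
proof (rule ccontr)
  assume "\<not> f' v \<le> 0"
  then have pos: "f' v > 0" by simp
  let ?g = "\<lambda>h. z + h *\<^sub>R v"
  have img: "?g ` {0..<d} \<subseteq> S" using d by auto
  have "(?g has_derivative (\<lambda>h. h *\<^sub>R v)) (at 0 within {0..<d})"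
    by (auto intro!: derivative_eq_intros)
  moreover have "(f has_derivative f') (at (?g 0) within ?g ` {0..<d})"
    using has_derivative_subset[OF f img] by simp
  ultimately have "((\<lambda>h. f (?g h)) has_derivative (\<lambda>h. f' (h *\<^sub>R v))) (at 0 within {0..<d})"
    by (rule has_derivative_in_compose)
  moreover have "(\<lambda>h. f' (h *\<^sub>R v)) = (*) (f' v)"
    using has_derivative_linear[OF f] by (auto simp: linear_scale)
  ultimately have D: "((\<lambda>h. f (?g h)) has_real_derivative f' v) (at 0 within {0..<d})"
    by (simp add: has_field_derivative_def)
  from has_real_derivative_pos_inc_right[OF D pos] obtain e where e: "e > 0"
    "\<And>h. h > 0 \<Longrightarrow> h \<in> {0..<d} \<Longrightarrow> h < e \<Longrightarrow> f z < f (?g h)" by auto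
  define h where "h = min d e / 2"
  have "h > 0" "h < d" "h < e" using d e by (auto simp: h_def)
  with e(2)[of h] max[OF d(2)[of h]] show False by auto
qed

lemma slab_max_derivatives:
  fixes f :: "(real ^ 'd) \<times> real \<Rightarrow> real"
  assumes f: "(f has_derivative f') (at (x, t) within UNIV \<times> {0..T})"
    and max: "\<And>y. y \<in> UNIV \<times> {0..T} \<Longrightarrow> f y \<le> f (x, t)"
    and t: "t \<in> {0..T}" "0 < T"
  shows "f' (y, 0) = 0" "t < T \<Longrightarrow> f' (0, 1) \<le> 0" "0 < t \<Longrightarrow> 0 \<le> f' (0, 1)"
proof -
  have le: "f' (y, 0) \<le> 0" for y
    by (rule directional_derivative_nonpos_at_max[OF f max, of 1]) (use t in auto)
  have "f' (- y, 0) = - f' (y, 0)"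
    using linear_neg[OF has_derivative_linear[OF f], of "(y, 0)"] by simp
  with le[of y] le[of "- y"] show "f' (y, 0) = 0" by simp
  show "f' (0, 1) \<le> 0" if "t < T"
    by (rule directional_derivative_nonpos_at_max[OF f max, of "T - t"]) (use t that in auto)
  have "f' (0, -1) \<le> 0" if "0 < t"
    by (rule directional_derivative_nonpos_at_max[OF f max, of t]) (use t that in auto)
  moreover have "f' (0, -1) = - f' (0, 1)"
    using linear_neg[OF has_derivative_linear[OF f], of "(0, 1)"] by simp
  ultimately show "0 \<le> f' (0, 1)" if "0 < t" using that by simp
qed

text \<open>
  \<open>V\<close>, \<open>P\<close>, \<open>Q\<close> are the derivatives of \<open>h\<close>, and \<open>Y\<close>, \<open>Z\<close> those of \<open>W\<close>; \<open>p = Du\<close>, \<open>dp\<close> and \<open>dw\<close> are the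
  space-time derivatives of \<open>p\<close> and \<open>w\<close>, and \<open>tr\<close> is the trace of \<open>P(Du) D\<^sub>x\<^sup>2u\<close>.
\<close>

locale hamilton_jacobi = C3_function "(UNIV :: (real ^ 'd) set) \<times> {0..T}" u U1 U2 U3
  for T :: real and u :: "(real ^ 'd) \<times> real \<Rightarrow> real" and U1 U2 U3 +
  fixes c :: real
    and Hh :: "real ^ 'd \<Rightarrow> real" and V :: "real ^ 'd \<Rightarrow> real ^ 'd" and P :: "real ^ 'd \<Rightarrow> real ^ 'd ^ 'd"
    and Q :: "real ^ 'd \<Rightarrow> real ^ 'd \<Rightarrow> real ^ 'd ^ 'd"
    and W :: "real ^ 'd \<Rightarrow> real" and Y :: "real ^ 'd \<Rightarrow> real ^ 'd" and Z :: "real ^ 'd \<Rightarrow> real ^ 'd ^ 'd"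
    and p :: "(real ^ 'd) \<times> real \<Rightarrow> real ^ 'd"
    and dp :: "(real ^ 'd) \<times> real \<Rightarrow> (real ^ 'd) \<times> real \<Rightarrow> real ^ 'd"
    and a :: "(real ^ 'd) \<times> real \<Rightarrow> (real ^ 'd) \<times> real"
    and w :: "(real ^ 'd) \<times> real \<Rightarrow> real"
    and dw :: "(real ^ 'd) \<times> real \<Rightarrow> (real ^ 'd) \<times> real \<Rightarrow> real"
    and tr :: "(real ^ 'd) \<times> real \<Rightarrow> real"
  defines "p \<equiv> \<lambda>z. \<chi> i. U1 z (axis i 1, 0)"
    and "dp \<equiv> \<lambda>z b. \<chi> i. U2 z (axis i 1, 0) b"
    and "a \<equiv> \<lambda>z. (- V (p z), 1)"
    and "w \<equiv> \<lambda>z. - U1 z (0, 1) + Hh (p z) + W (fst z)"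
    and "dw \<equiv> \<lambda>z b. - U2 z (a z) b + Y (fst z) \<bullet> fst b"
    and "tr \<equiv> \<lambda>z. \<Sum>i\<in>UNIV. \<Sum>j\<in>UNIV. P (p z) $ i $ j * U2 z (axis i 1, 0) (axis j 1, 0)"
  assumes T: "T > 0" and c: "c \<ge> 1"
    and Hh: "\<And>y. (Hh has_derivative (\<lambda>v. V y \<bullet> v)) (at y)"
    and V: "\<And>y. (V has_derivative (\<lambda>v. P y *v v)) (at y)"
    and P: "\<And>y. (P has_derivative Q y) (at y)"
    and P_sym: "\<And>y i j. P y $ i $ j = P y $ j $ i"
    and P_lower: "\<And>y v. 1 / c * (norm v)\<^sup>2 \<le> v \<bullet> (P y *v v)"
    and P_upper: "\<And>y v. v \<bullet> (P y *v v) \<le> c * (norm v)\<^sup>2"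
    and Q_bound: "\<And>y v. norm (Q y v) \<le> c / (1 + norm y) * norm v"
    and Hh_lower: "\<And>y. 1 / c * (norm y)\<^sup>2 - c \<le> Hh y"
    and Hh_upper: "\<And>y. Hh y \<le> c * (norm y)\<^sup>2 + c"
    and V_inner: "\<And>y. V y \<bullet> y \<ge> 2 * Hh y - c"
    and V_bound: "\<And>y. norm (V y) \<le> c * (1 + norm y)"
    and W: "\<And>x. (W has_derivative (\<lambda>v. Y x \<bullet> v)) (at x)"
    and Y: "\<And>x. (Y has_derivative (\<lambda>v. Z x *v v)) (at x)"
    and W_bound: "\<And>x. \<bar>W x\<bar> \<le> 4 * c"
    and Y_bound: "\<And>x. norm (Y x) \<le> 2 * c"
    and Z_bound: "\<And>x. norm (Z x) \<le> 2 * c"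
    and W_periodic: "torus_fun W"
    and u_periodic: "\<And>t. t \<in> {0..T} \<Longrightarrow> torus_fun (\<lambda>x. u (x, t))"
    and U1_periodic: "\<And>t b. t \<in> {0..T} \<Longrightarrow> torus_fun (\<lambda>x. U1 (x, t) b)"
    and U2_periodic: "\<And>t b b'. t \<in> {0..T} \<Longrightarrow> torus_fun (\<lambda>x. U2 (x, t) b b')"
begin

abbreviation "slab \<equiv> (UNIV :: (real ^ 'd) set) \<times> {0..T}"
abbreviation "open_slab \<equiv> (UNIV :: (real ^ 'd) set) \<times> {0<..<T}"

lemma interior_slab: "interior slab = open_slab"
  by (simp add: interior_Times)

lemma open_slab_slab: "z \<in> open_slab \<Longrightarrow> z \<in> slab" by auto

lemma is_open_slab: "open open_slab" by (simp add: open_Times)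

lemma U1_space: "U1 z (y, 0) = p z \<bullet> y"
  unfolding linear_axis_sum[OF lin1, of z y] p_def inner_vec_def by (simp add: mult.commute)

lemma U2_space: "U2 z (y, 0) b = dp z b \<bullet> y"
  unfolding linear_axis_sum[OF lin2(1)[of z b], of y] dp_def inner_vec_def by (simp add: mult.commute)

lemma U2_a: "U2 z (a z) b = U2 z (0, 1) b - V (p z) \<bullet> dp z b"
proof -
  have "a z = (0, 1) - (V (p z), 0)" by (simp add: a_def)
  then show ?thesis by (simp only: linear_diff[OF lin2(1)] U2_space inner_commute)
qed

text \<open>Symmetry of \<open>U2\<close> trades the derivative of \<open>Du\<close> along
  \<open>a\<close> for the spatial derivative of \<open>w\<close>. On the boundary the latter is
  known from the initial and terminal conditions.\<close>

lemma U2_space_a: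
  assumes "z \<in> slab"
  shows "dp z (a z) \<bullet> y = Y (fst z) \<bullet> y - dw z (y, 0)"
  using sym2[OF assms, of "(y, 0)" "a z"] by (simp add: U2_space dw_def)

lemma dw_eq: "dw z b = - U2 z (0, 1) b + V (p z) \<bullet> dp z b + Y (fst z) \<bullet> fst b"
  by (simp add: dw_def U2_a)

lemma p_deriv:
  assumes "z \<in> slab"
  shows "(p has_derivative dp z) (at z within slab)"
proof (subst has_derivative_componentwise_within, intro ballI)
  fix i :: "real ^ 'd" assume "i \<in> Basis"
  have "((\<lambda>z. U1 z (i, 0)) has_derivative U2 z (i, 0)) (at z within slab)"
    by (rule deriv2[OF assms])
  then show "((\<lambda>x. p x \<bullet> i) has_derivative (\<lambda>x. dp z x \<bullet> i)) (at z within slab)"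
    by (simp add: U1_space U2_space[abs_def])
qed

lemma w_deriv:
  assumes "z \<in> slab"
  shows "(w has_derivative dw z) (at z within slab)"
proof -
  have "((\<lambda>z. Hh (p z)) has_derivative (\<lambda>b. V (p z) \<bullet> dp z b)) (at z within slab)"
    by (rule has_derivative_compose[OF p_deriv[OF assms] Hh])
  moreover have "((\<lambda>z. W (fst z)) has_derivative (\<lambda>b. Y (fst z) \<bullet> fst b)) (at z within slab)"
    by (rule has_derivative_compose[OF has_derivative_fst[OF has_derivative_ident] W])
  ultimately show ?thesis unfolding w_def dw_eq[abs_def]
    by (intro has_derivative_add has_derivative_minus deriv2 assms)
qed

lemma p_deriv_at: "z \<in> open_slab \<Longrightarrow> (p has_derivative dp z) (at z)"
  using p_deriv[OF open_slab_slab, of z] at_within_interior[of z slab] by (simp add: interior_slab)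

lemma deriv_at:
  assumes "z \<in> open_slab"
  shows "(u has_derivative U1 z) (at z)" "((\<lambda>z. U1 z b) has_derivative U2 z b) (at z)"
    "((\<lambda>z. U2 z b b') has_derivative U3 z b b') (at z)"
  using interior_derivs[of z] assms by (simp_all add: interior_slab)

lemma p_cont: "continuous_on slab p"
  by (rule has_derivative_continuous_on) (rule p_deriv)

lemma p_periodic: "t \<in> {0..T} \<Longrightarrow> torus_fun (\<lambda>x. p (x, t))"
  using U1_periodic[of t] unfolding torus_fun_def p_def by (simp add: vec_eq_iff)

lemma P_decomposition: "\<exists>q :: 'd \<Rightarrow> real ^ 'd. \<forall>i j. P y $ i $ j = (\<Sum>k\<in>UNIV. q k $ i * q k $ j)"
proof -
  have "0 \<le> v \<bullet> (P y *v v)" for v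
    by (rule order_trans[OF _ P_lower]) (use c in simp)
  then show ?thesis by (rule psd_decomposition[OF P_sym])
qed

lemma tr_decomposed:
  assumes "\<And>i j. P (p z) $ i $ j = (\<Sum>k\<in>UNIV. q k $ i * q k $ j)"
  shows "tr z = (\<Sum>k\<in>UNIV. U2 z (q k, 0) (q k, 0))"
  unfolding tr_def by (rule bilinear_trace[OF lin2 assms])

lemma snd_a [simp]: "snd (a z) = 1" and fst_a: "fst (a z) = - V (p z)"
  by (simp_all add: a_def)

end

text \<open>\<open>X\<close> is \<open>\<chi>\<close> along the solution, and \<open>X'\<close> is its derivative with respect to \<open>w\<close>.\<close>

locale separable_mfg = hamilton_jacobi T u U1 U2 U3
  for T and u :: "(real ^ 'd) \<times> real \<Rightarrow> real" and U1 U2 U3 +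
  fixes X X' :: "(real ^ 'd) \<times> real \<Rightarrow> real"
  assumes X_pos: "\<And>z. z \<in> UNIV \<times> {0<..<T} \<Longrightarrow> X z > 0"
    and X_deriv: "\<And>z. z \<in> UNIV \<times> {0<..<T} \<Longrightarrow> (X has_derivative (\<lambda>b. X' z * dw z b)) (at z)"
    and X'_cont: "continuous_on (UNIV \<times> {0..T}) X'"
    and X'_periodic: "\<And>t. t \<in> {0..T} \<Longrightarrow> torus_fun (\<lambda>x. X' (x, t))"
    and equation: "\<And>z. z \<in> UNIV \<times> {0<..<T} \<Longrightarrow>
        U2 z (a z) (a z) + X z * tr z + Y (fst z) \<bullet> V (p z) = 0"
begin

text \<open>The equation holds on an open set, so its derivative vanishes. The vector
  \<open>a\<close> enters twice and both contributions agree by symmetry, whence the factor 2; the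
  remaining terms come from \<open>X\<close>, \<open>P\<close>, \<open>Y\<close> and
  \<open>V\<close> by the product and chain rules.\<close>

lemma equation_derivative:
  assumes z: "z \<in> open_slab"
  shows "U3 z (a z) (a z) b - 2 * (dp z (a z) \<bullet> (P (p z) *v dp z b)) + X' z * dw z b * tr z
    + X z * (\<Sum>i\<in>UNIV. \<Sum>j\<in>UNIV. Q (p z) (dp z b) $ i $ j * U2 z (axis i 1, 0) (axis j 1, 0))
    + X z * (\<Sum>i\<in>UNIV. \<Sum>j\<in>UNIV. P (p z) $ i $ j * U3 z (axis i 1, 0) (axis j 1, 0) b)
    + (Z (fst z) *v fst b) \<bullet> V (p z) + Y (fst z) \<bullet> (P (p z) *v dp z b) = 0"
proof -
  note dV = has_derivative_compose[OF p_deriv_at[OF z] V]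
  have da: "(a has_derivative (\<lambda>b. (- (P (p z) *v dp z b), 0))) (at z)"
    unfolding a_def by (intro has_derivative_Pair has_derivative_minus dV has_derivative_const)
  have 1: "((\<lambda>y. U2 y e (a y)) has_derivative
      (\<lambda>b. U3 z e (a z) b + U2 z e (- (P (p z) *v dp z b), 0))) (at z)" for e
    by (rule has_derivative_linear_apply[where L = "\<lambda>y. U2 y e" and L' = "U3 z e", OF lin2(2) _ lin3(2) da UNIV_I])
      (rule deriv_at(3)[OF z])
  have 2: "((\<lambda>y. U2 y (a y) (a y)) has_derivative
      (\<lambda>b. (U3 z (a z) (a z) b + U2 z (a z) (- (P (p z) *v dp z b), 0)) + U2 z (- (P (p z) *v dp z b), 0) (a z))) (at z)"
    by (rule has_derivative_linear_apply[where L = "\<lambda>y e. U2 y e (a y)" and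
         L' = "\<lambda>e b. U3 z e (a z) b + U2 z e (- (P (p z) *v dp z b), 0)", OF lin2(1) 1 _ da UNIV_I])
      (intro linear_compose_add lin3 lin2)
  have P': "((\<lambda>y. P (p y) $ i $ j) has_derivative (\<lambda>b. Q (p z) (dp z b) $ i $ j)) (at z)" for i j
    by (intro bounded_linear.has_derivative[OF bounded_linear_vec_nth] has_derivative_compose[OF p_deriv_at[OF z] P])
  have 3: "(tr has_derivative (\<lambda>b. (\<Sum>i\<in>UNIV. \<Sum>j\<in>UNIV. P (p z) $ i $ j * U3 z (axis i 1, 0) (axis j 1, 0) b
      + Q (p z) (dp z b) $ i $ j * U2 z (axis i 1, 0) (axis j 1, 0)))) (at z)"
    unfolding tr_def by (intro has_derivative_sum has_derivative_mult P' deriv_at z)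
  have 4: "((\<lambda>y. Y (fst y) \<bullet> V (p y)) has_derivative
      (\<lambda>b. Y (fst z) \<bullet> (P (p z) *v dp z b) + (Z (fst z) *v fst b) \<bullet> V (p z))) (at z)"
    by (intro has_derivative_inner dV has_derivative_compose[OF has_derivative_fst[OF has_derivative_ident] Y])
  let ?D = "\<lambda>b. ((U3 z (a z) (a z) b + U2 z (a z) (- (P (p z) *v dp z b), 0)) + U2 z (- (P (p z) *v dp z b), 0) (a z))
     + (X z * (\<Sum>i\<in>UNIV. \<Sum>j\<in>UNIV. P (p z) $ i $ j * U3 z (axis i 1, 0) (axis j 1, 0) b
      + Q (p z) (dp z b) $ i $ j * U2 z (axis i 1, 0) (axis j 1, 0)) + (X' z * dw z b) * tr z)
     + (Y (fst z) \<bullet> (P (p z) *v dp z b) + (Z (fst z) *v fst b) \<bullet> V (p z))"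
  have "((\<lambda>y. U2 y (a y) (a y) + X y * tr y + Y (fst y) \<bullet> V (p y)) has_derivative ?D) (at z)"
    by (intro has_derivative_add has_derivative_mult 2 3 4 X_deriv z)
  then have "((\<lambda>y. 0) has_derivative ?D) (at z)"
    by (rule has_derivative_transform_within_open[OF _ is_open_slab z]) (rule equation)
  then have "?D b = 0" using fun_cong[OF has_derivative_unique[OF _ has_derivative_const]] by blast
  moreover have "U2 z (- y, 0) (a z) = - (dp z (a z) \<bullet> y)" "U2 z (a z) (- y, 0) = - (dp z (a z) \<bullet> y)" for y
    using sym2[OF open_slab_slab[OF z], of "(- y, 0)" "a z"] by (simp_all add: U2_space)
  ultimately show ?thesis
    by (simp add: sum.distrib algebra_simps)
qed

text \<open>The operator is a sum of pure second derivatives with nonnegative weights: 1 in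
  direction \<open>a z\<close> and \<open>X z\<close> in the directions \<open>q k\<close>. Each of
  them is nonpositive at a maximum.\<close>

lemma maximum_principle:
  assumes z: "z \<in> open_slab"
    and max: "\<And>y. y \<in> slab \<Longrightarrow> \<Phi> y \<le> \<Phi> z"
    and d1: "\<And>y. y \<in> open_slab \<Longrightarrow> (\<Phi> has_derivative \<Phi>1 y) (at y)"
    and d2: "\<And>v. ((\<lambda>y. \<Phi>1 y v) has_derivative \<Phi>2 v) (at z)"
  shows "\<Phi>1 z v = 0" "\<Phi>2 (a z) (a z) + X z * (\<Sum>k\<in>UNIV. \<Phi>2 (q k, 0) (q k, 0)) \<le> 0"
proof -
  have max': "\<And>y. y \<in> open_slab \<Longrightarrow> \<Phi> y \<le> \<Phi> z" using max open_slab_slab by blast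
  show "\<Phi>1 z v = 0" by (rule second_derivative_test(1)[OF is_open_slab z max' d1])
  have "\<Phi>2 v v \<le> 0" for v
    by (rule second_derivative_test(2)[OF is_open_slab z max' d1 d2])
  then show "\<Phi>2 (a z) (a z) + X z * (\<Sum>k\<in>UNIV. \<Phi>2 (q k, 0) (q k, 0)) \<le> 0"
    using X_pos[OF z] by (intro add_nonpos_nonpos mult_nonneg_nonpos sum_nonpos) auto
qed

end

section \<open>Comparison arguments for \<open>u\<close> and its time derivative\<close>

context separable_mfg
begin

text \<open>The sign \<open>\<sigma>\<close> treats the maximum and the minimum of \<open>u\<close>
  together. Adding a convex function of \<open>t\<close> leaves \<open>p = 0\<close> at the maximum
  point, where the equation reduces to a bound on \<open>Y \<bullet> V 0\<close>.\<close>

lemma u_max_at_terminal_time: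
  assumes \<sigma>: "\<sigma> = 1 \<or> \<sigma> = -1" and w0: "\<And>x. \<bar>w (x, 0)\<bar> \<le> 3 * c"
  obtains x where "p (x, T) = 0" "0 \<le> \<sigma> * U1 (x, T) (0, 1) + (8 * c + 1) + (2 * c\<^sup>2 + 1) * T"
    "\<And>y t. t \<in> {0..T} \<Longrightarrow>
      \<sigma> * u (y, t) + (8 * c + 1) * t + (2 * c\<^sup>2 + 1) * t\<^sup>2 / 2
        \<le> \<sigma> * u (x, T) + (8 * c + 1) * T + (2 * c\<^sup>2 + 1) * T\<^sup>2 / 2"
proof -
  \<comment> \<open>\<open>A\<close> exceeds the bound \<open>c + 4 * c + 3 * c\<close> for the time
    derivative at a point with \<open>t = 0\<close> and \<open>p = 0\<close>, which excludes the
    initial time. \<open>B\<close> exceeds the bound \<open>2 * c * c\<close> for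
    \<open>Y \<bullet> V 0\<close>, which excludes interior points.\<close>
  define A where "A = 8 * c + 1"
  define B where "B = 2 * c\<^sup>2 + 1"
  define \<Phi> where "\<Phi> z = \<sigma> * u z + A * snd z + B * (snd z)\<^sup>2 / 2" for z
  define \<Phi>1 where "\<Phi>1 z b = \<sigma> * U1 z b + A * snd b + B * snd z * snd b" for z b
  have \<sigma>2: "\<bar>\<sigma>\<bar> = 1" using \<sigma> by auto
  have d1: "(\<Phi> has_derivative \<Phi>1 z) (at z within slab)" if "z \<in> slab" for z
    unfolding \<Phi>_def \<Phi>1_def power2_eq_square
    by (rule derivative_eq_intros deriv1[OF that] refl)+ (auto simp: algebra_simps)
  obtain z where z: "z \<in> slab" "\<And>y. y \<in> slab \<Longrightarrow> \<Phi> y \<le> \<Phi> z"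
  proof (rule periodic_attains_max[of "{0..T}" \<Phi>])
    show "continuous_on slab \<Phi>" by (rule has_derivative_continuous_on) (rule d1)
    show "torus_fun (\<lambda>x. \<Phi> (x, t))" if "t \<in> {0..T}" for t
      using u_periodic[OF that] by (simp add: torus_fun_def \<Phi>_def)
  qed (use T in auto)
  obtain x t where zxt: "z = (x, t)" by (cases z)
  have t: "t \<in> {0..T}" using z zxt by simp
  have "\<Phi>1 (x, t) (y, 0) = 0" for y
    by (rule slab_max_derivatives(1)[OF d1]) (use z zxt t T in auto)
  then have "\<sigma> * (p z \<bullet> y) = 0" for y by (simp add: \<Phi>1_def U1_space zxt)
  from this[of "p z"] have "p z \<bullet> p z = 0" using \<sigma>2 by auto
  then have pz: "p z = 0" by simp
  have V0: "norm (V 0) \<le> c" using V_bound[of 0] by simp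
  have "t = T"
  proof (rule ccontr)
    assume "t \<noteq> T"
    then have tT: "t < T" using t by simp
    show False
    proof (cases "t = 0")
      case True
      have "\<Phi>1 (x, t) (0, 1) \<le> 0"
        by (rule slab_max_derivatives(2)[OF d1]) (use z zxt t tT T in auto)
      then have "\<sigma> * U1 z (0, 1) + A \<le> 0" by (simp add: \<Phi>1_def zxt True)
      moreover have "U1 z (0, 1) = Hh 0 + W x - w z" unfolding w_def pz by (simp add: zxt)
      moreover have "\<bar>Hh 0\<bar> \<le> c" using Hh_lower[of 0] Hh_upper[of 0] by simp
      ultimately show False
        using w0[of x] W_bound[of x] \<sigma> c unfolding A_def zxt True by auto
    next
      case False
      then have zi: "z \<in> open_slab" using tT t zxt by simp
      have d1': "(\<Phi> has_derivative \<Phi>1 y) (at y)" if "y \<in> open_slab" for y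
        using d1[OF open_slab_slab[OF that]] at_within_interior[of y slab] that by (simp add: interior_slab)
      define \<Phi>2 where "\<Phi>2 v b = \<sigma> * U2 z v b + B * snd v * snd b" for v b
      have d2: "((\<lambda>y. \<Phi>1 y v) has_derivative \<Phi>2 v) (at z)" for v
        unfolding \<Phi>1_def \<Phi>2_def
        by (rule derivative_eq_intros deriv_at[OF zi] refl)+ (auto simp: algebra_simps)
      obtain q :: "'d \<Rightarrow> real ^ 'd" where
        "\<forall>i j. P (p z) $ i $ j = (\<Sum>k\<in>UNIV. q k $ i * q k $ j)"
        using P_decomposition[of "p z"] ..
      then have q: "\<And>i j. P (p z) $ i $ j = (\<Sum>k\<in>UNIV. q k $ i * q k $ j)" by simp
      have "\<Phi>2 (a z) (a z) + X z * (\<Sum>k\<in>UNIV. \<Phi>2 (q k, 0) (q k, 0)) \<le> 0"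
        by (rule maximum_principle(2)[OF zi z(2) d1' d2])
      then have "\<sigma> * U2 z (a z) (a z) + B + X z * (\<sigma> * tr z) \<le> 0"
        unfolding \<Phi>2_def by (simp add: tr_decomposed[OF q] sum_distrib_left)
      moreover have "\<sigma> * U2 z (a z) (a z) + X z * (\<sigma> * tr z) = - \<sigma> * (Y (fst z) \<bullet> V (p z))"
        using equation[OF zi] by algebra
      ultimately have "B \<le> \<sigma> * (Y (fst z) \<bullet> V (p z))" by simp
      then have "B \<le> \<sigma> * (Y x \<bullet> V 0)" unfolding pz by (simp add: zxt)
      also have "\<dots> \<le> \<bar>Y x \<bullet> V 0\<bar>" using \<sigma> by auto
      also have "\<dots> \<le> norm (Y x) * norm (V 0)" by (rule Cauchy_Schwarz_ineq2)
      also have "\<dots> \<le> 2 * c * c" using Y_bound V0 c by (intro mult_mono) auto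
      finally show False by (simp add: B_def power2_eq_square)
    qed
  qed
  have "0 \<le> \<Phi>1 (x, T) (0, 1)"
    by (rule slab_max_derivatives(3)[OF d1]) (use z zxt \<open>t = T\<close> T in auto)
  then have "0 \<le> \<sigma> * U1 (x, T) (0, 1) + A + B * T" by (simp add: \<Phi>1_def)
  moreover have "\<Phi> (y, s) \<le> \<Phi> (x, T)" if "s \<in> {0..T}" for y s
    using z(2)[of "(y, s)"] that zxt \<open>t = T\<close> by simp
  ultimately show thesis
    using that[of x] pz zxt \<open>t = T\<close> unfolding \<Phi>_def A_def B_def by simp
qed

text \<open>The equation differentiated in time is a linear elliptic equation for \<open>u_t\<close>
  without a zeroth-order term, but with the first-order term \<open>X' * dw * tr\<close>. The
  perturbation \<open>\<epsilon> * exp (\<mu> * t)\<close> makes the inequality strict when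
  \<open>\<mu>\<close> exceeds the supremum of that coefficient; then \<open>\<epsilon>\<close>
  tends to 0. The number \<open>\<mu>\<close> depends on the solution, which is harmless because it
  leaves no trace in the conclusion.\<close>

lemma time_derivative_max_at_boundary:
  assumes \<sigma>: "\<sigma> = 1 \<or> \<sigma> = -1"
  obtains x t where "t \<in> {0, T}" "\<And>z. z \<in> slab \<Longrightarrow> \<sigma> * U1 z (0, 1) \<le> \<sigma> * U1 (x, t) (0, 1)"
proof -
  let ?s = "\<lambda>z. \<sigma> * U1 z (0, 1)"
  have s_cont: "continuous_on slab ?s" by (intro continuous_intros cont1)
  have s_per: "torus_fun (\<lambda>x. ?s (x, t))" if "t \<in> {0..T}" for t
    using U1_periodic[OF that] by (simp add: torus_fun_def)
  obtain z1 where z1: "z1 \<in> UNIV \<times> {0, T}" "\<And>y. y \<in> UNIV \<times> {0, T} \<Longrightarrow> ?s y \<le> ?s z1"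
  proof (rule periodic_attains_max[of "{0, T}" ?s])
    show "continuous_on (UNIV \<times> {0, T}) ?s" by (rule continuous_on_subset[OF s_cont]) (use T in auto)
    show "torus_fun (\<lambda>x. ?s (x, t))" if "t \<in> {0, T}" for t using s_per[of t] that T by auto
  qed (use T in auto)
  obtain zb where zb: "\<And>y. y \<in> slab \<Longrightarrow> \<bar>X' y * tr y\<bar> \<le> \<bar>X' zb * tr zb\<bar>"
  proof (rule periodic_attains_max[of "{0..T}" "\<lambda>y. \<bar>X' y * tr y\<bar>"])
    have "continuous_on UNIV P" using P has_derivative_continuous_on by (metis UNIV_I)
    then have "continuous_on slab (\<lambda>y. P (p y))"
      by (rule continuous_on_compose2[OF _ p_cont]) simp
    then have cP: "continuous_on slab (\<lambda>y. P (p y) $ i $ j)" for i j by (intro continuous_intros)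
    show "continuous_on slab (\<lambda>y. \<bar>X' y * tr y\<bar>)"
      unfolding tr_def by (intro continuous_on_rabs continuous_on_mult continuous_on_sum cP X'_cont cont2)
    show "torus_fun (\<lambda>x. \<bar>X' (x, t) * tr (x, t)\<bar>)" if "t \<in> {0..T}" for t
      using X'_periodic[OF that] U2_periodic[OF that] p_periodic[OF that]
      by (simp add: torus_fun_def tr_def)
  qed (use T in auto)
  define \<mu> where "\<mu> = \<bar>X' zb * tr zb\<bar> + 1"
  have \<mu>: "\<mu> > 0" by (simp add: \<mu>_def)
  have "?s y \<le> ?s z1 + e" if y: "y \<in> slab" and e0: "e > 0" for y e
  proof -
    define \<epsilon> where "\<epsilon> = e / exp (\<mu> * T)"
    have \<epsilon>: "\<epsilon> > 0" using e0 by (simp add: \<epsilon>_def)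
    define \<Phi> where "\<Phi> z = ?s z + \<epsilon> * exp (\<mu> * snd z)" for z :: "(real ^ 'd) \<times> real"
    define \<Phi>1 where "\<Phi>1 z b = \<sigma> * U2 z (0, 1) b + \<epsilon> * \<mu> * exp (\<mu> * snd z) * snd b" for z b
    obtain z where z: "z \<in> slab" "\<And>y. y \<in> slab \<Longrightarrow> \<Phi> y \<le> \<Phi> z"
    proof (rule periodic_attains_max[of "{0..T}" \<Phi>])
      show "continuous_on slab \<Phi>" unfolding \<Phi>_def by (intro continuous_intros s_cont cont1)
      show "torus_fun (\<lambda>x. \<Phi> (x, t))" if "t \<in> {0..T}" for t
        using s_per[OF that] by (simp add: torus_fun_def \<Phi>_def)
    qed (use T in auto)
    have "z \<notin> open_slab"
    proof
      assume zi: "z \<in> open_slab"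
      define E where "E = \<epsilon> * exp (\<mu> * snd z)"
      have E: "E > 0" using \<epsilon> by (simp add: E_def)
      have d1: "(\<Phi> has_derivative \<Phi>1 y) (at y)" if "y \<in> open_slab" for y
        unfolding \<Phi>_def \<Phi>1_def
        by (rule derivative_eq_intros deriv_at[OF that] refl)+ (auto simp: algebra_simps)
      define \<Phi>2 where "\<Phi>2 v b = \<sigma> * U3 z (0, 1) v b + E * \<mu>\<^sup>2 * snd v * snd b" for v b
      have d2: "((\<lambda>y. \<Phi>1 y v) has_derivative \<Phi>2 v) (at z)" for v
        unfolding \<Phi>1_def \<Phi>2_def E_def
        by (rule derivative_eq_intros deriv_at[OF zi] refl)+ (auto simp: algebra_simps power2_eq_square)
      obtain q :: "'d \<Rightarrow> real ^ 'd" where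
        "\<forall>i j. P (p z) $ i $ j = (\<Sum>k\<in>UNIV. q k $ i * q k $ j)"
        using P_decomposition[of "p z"] ..
      then have q: "\<And>i j. P (p z) $ i $ j = (\<Sum>k\<in>UNIV. q k $ i * q k $ j)" by simp
      let ?t = "(0, 1) :: (real ^ 'd) \<times> real"
      have "\<Phi>2 (a z) (a z) + X z * (\<Sum>k\<in>UNIV. \<Phi>2 (q k, 0) (q k, 0)) \<le> 0"
        by (rule maximum_principle(2)[OF zi z(2) d1 d2])
      then have 1: "\<sigma> * (U3 z ?t (a z) (a z) + X z * (\<Sum>k\<in>UNIV. U3 z ?t (q k, 0) (q k, 0))) + E * \<mu>\<^sup>2 \<le> 0"
        unfolding \<Phi>2_def by (simp add: sum_distrib_left algebra_simps)
      have crit: "\<sigma> * U2 z ?t v = - E * \<mu> * snd v" for v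
        using maximum_principle(1)[OF zi z(2) d1 d2, of v] unfolding \<Phi>1_def E_def by (simp add: algebra_simps)
      \<comment> \<open>At the critical point the spatial gradient of \<open>u_t\<close> vanishes.
        All terms of the differentiated equation containing \<open>dp z ?t\<close> disappear, and
        \<open>dw z ?t\<close> reduces to minus the second time derivative of
        \<open>u\<close>.\<close>
      have "\<sigma> * (dp z ?t \<bullet> y) = 0" for y
        using crit[of "(y, 0)"] sym2[OF z(1), of "(y, 0)" ?t] by (simp add: U2_space)
      from this[of "dp z ?t"] have "dp z ?t \<bullet> dp z ?t = 0" using \<sigma> by auto
      then have dp0: "dp z ?t = 0" by simp
      have dw: "\<sigma> * dw z ?t = E * \<mu>"
        using crit[of ?t] unfolding dw_eq dp0 by simp
      have Q0: "Q (p z) 0 = 0" using Q_bound[of "p z" 0] by simp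
      have "U3 z ?t (a z) (a z) = U3 z (a z) (a z) ?t" "U3 z ?t b b = U3 z b b ?t" for b
        using sym3[of z] zi by (metis interior_slab)+
      moreover have "(\<Sum>i\<in>UNIV. \<Sum>j\<in>UNIV. P (p z) $ i $ j * U3 z (axis i 1, 0) (axis j 1, 0) ?t)
          = (\<Sum>k\<in>UNIV. U3 z (q k, 0) (q k, 0) ?t)"
        by (rule bilinear_trace[OF lin3(1,2) q])
      ultimately have "U3 z ?t (a z) (a z) + X z * (\<Sum>k\<in>UNIV. U3 z ?t (q k, 0) (q k, 0)) = - (X' z * dw z ?t * tr z)"
        using equation_derivative[OF zi, of ?t] unfolding dp0 Q0 by simp
      with 1 have "E * \<mu>\<^sup>2 \<le> \<sigma> * dw z ?t * (X' z * tr z)" by (simp add: algebra_simps)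
      then have "E * \<mu> * \<mu> \<le> E * \<mu> * (X' z * tr z)" unfolding dw by (simp add: power2_eq_square)
      then have "\<mu> \<le> X' z * tr z" using E \<mu> by simp
      then show False using zb[OF z(1)] unfolding \<mu>_def by linarith
    qed
    then have "z \<in> UNIV \<times> {0, T}" using z(1) by (cases z) auto
    then have sz: "?s z \<le> ?s z1" by (rule z1(2))
    have "?s y \<le> \<Phi> y" using \<epsilon> by (simp add: \<Phi>_def)
    also have "\<dots> \<le> \<Phi> z" using z(2) y by blast
    also have "\<dots> \<le> ?s z1 + \<epsilon> * exp (\<mu> * T)"
    proof -
      have "\<epsilon> * exp (\<mu> * snd z) \<le> \<epsilon> * exp (\<mu> * T)" using z(1) \<mu> \<epsilon> by (cases z) auto
      with sz show ?thesis unfolding \<Phi>_def by linarith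
    qed
    finally show ?thesis by (simp add: \<epsilon>_def)
  qed
  then have le: "?s y \<le> ?s z1" if "y \<in> slab" for y
    using that field_le_epsilon by blast
  obtain x t where xt: "z1 = (x, t)" by (cases z1)
  show thesis
  proof (rule that)
    show "t \<in> {0, T}" using z1(1) xt by auto
    show "?s z \<le> ?s (x, t)" if "z \<in> slab" for z using le[OF that] unfolding xt .
  qed
qed

end

section \<open>The Bernstein estimate\<close>

lemma decomposition_inner:
  fixes P :: "real ^ 'n ^ 'n"
  assumes "\<And>i j. P $ i $ j = (\<Sum>k\<in>UNIV. q k $ i * q k $ j)"
  shows "x \<bullet> (P *v y) = (\<Sum>k\<in>UNIV. (x \<bullet> q k) * (y \<bullet> q k))"
proof -
  have "(\<Sum>k\<in>UNIV. (x \<bullet> q k) * (y \<bullet> q k))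
      = (\<Sum>k\<in>UNIV. \<Sum>i\<in>UNIV. \<Sum>j\<in>UNIV. (q k $ i * q k $ j) * x $ i * y $ j)"
    unfolding inner_vec_def sum_product by (intro sum.cong refl) simp
  also have "\<dots> = (\<Sum>i\<in>UNIV. \<Sum>j\<in>UNIV. \<Sum>k\<in>UNIV. (q k $ i * q k $ j) * x $ i * y $ j)"
    by (subst sum.swap, intro sum.cong refl, rule sum.swap)
  finally show ?thesis unfolding inner_matrix_vector assms by (simp add: sum_distrib_right)
qed

text \<open>The left side is the trace of \<open>P\<close>, which is estimated on the coordinate
  vectors.\<close>

lemma decomposition_norm:
  fixes P :: "real ^ 'n ^ 'n" and c :: real
  assumes "\<And>i j. P $ i $ j = (\<Sum>k\<in>UNIV. q k $ i * q k $ j)"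
    and "\<And>v. v \<bullet> (P *v v) \<le> c * (norm v)\<^sup>2"
  shows "(\<Sum>k\<in>UNIV. (norm (q k))\<^sup>2) \<le> CARD('n) * c"
proof -
  have "(\<Sum>k\<in>UNIV. (norm (q k))\<^sup>2) = (\<Sum>k\<in>UNIV. \<Sum>i\<in>UNIV. q k $ i * q k $ i)"
    unfolding power2_norm_eq_inner inner_vec_def by simp
  also have "\<dots> = (\<Sum>i\<in>UNIV. \<Sum>k\<in>UNIV. q k $ i * q k $ i)" by (rule sum.swap)
  also have "\<dots> = (\<Sum>i\<in>UNIV. axis i 1 \<bullet> (P *v axis i 1))"
    by (simp add: assms(1)[symmetric] inner_axis' matrix_vector_mult_basis column_def)
  also have "\<dots> \<le> (\<Sum>i\<in>(UNIV :: 'n set). c * (norm (axis i 1 :: real ^ 'n))\<^sup>2)"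
    by (intro sum_mono assms(2))
  finally show ?thesis by simp
qed

text \<open>The numerical core of the interior estimate, with \<open>x\<close> for the norm of
  \<open>Du\<close>, \<open>g\<close> for that of the spatial gradient of \<open>w\<close>,
  \<open>r\<close> for the square root of \<open>\<chi>\<close>, \<open>G\<close> for the norm of
  the spatial Hessian, \<open>U\<close> for the absolute value of \<open>v\<close>, and
  \<open>D\<close> for the derivative of \<open>v\<close> along \<open>a\<close>. The positive terms
  absorb everything except multiples of \<open>l * x\<^sup>2\<close>; since \<open>D\<close> grows
  quadratically in \<open>x\<close>, the term \<open>l * D\<^sup>2\<close> then bounds
  \<open>x\<close>.\<close>

lemma bernstein_algebra:
  fixes c :: real
  assumes c: "1 \<le> c" "c \<le> k" and N: "0 \<le> N" "N \<le> k\<^sup>2" and B: "0 \<le> B" and U: "0 \<le> U" "U \<le> k"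
    and nonneg: "0 \<le> x" "0 \<le> g" "0 \<le> r" "0 \<le> G"
    and lam: "l = 1 / (8 * (1 + B)\<^sup>2 * k ^ 8)"
    and main: "g\<^sup>2 / c - 2 * N * g * (l * U * x) - 2 * c * N * (l * U * x) - 2 * B * r * (l * U * \<bar>D\<bar>) * (N * G)
       + r\<^sup>2 * (G\<^sup>2 / c\<^sup>2) - r\<^sup>2 * (c * (2 * c + 1) * G) - r\<^sup>2 * (2 * c * N) + l * D\<^sup>2 + l * r\<^sup>2 * (x\<^sup>2 / c)
       - l * U * (2 * c * (c * (1 + x))) \<le> 0"
    and D: "16 * k\<^sup>2 \<le> x\<^sup>2 \<Longrightarrow> x\<^sup>2 / (2 * c) \<le> \<bar>D\<bar>"
  shows "x\<^sup>2 \<le> 2000 * (1 + B) ^ 4 * k ^ 24"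
proof (rule ccontr)
  assume "\<not> x\<^sup>2 \<le> 2000 * (1 + B) ^ 4 * k ^ 24"
  then have xR: "2000 * (1 + B) ^ 4 * k ^ 24 < x\<^sup>2" by simp
  define b where "b = 1 + B"
  have b: "1 \<le> b" "B \<le> b" using B by (auto simp: b_def)
  have k: "1 \<le> k" using c by simp
  have bp: "1 \<le> b ^ n" for n using b by simp
  have kp: "k ^ m \<le> k ^ n" if "m \<le> n" for m n using power_increasing[OF that k] .
  have l: "l * (8 * b\<^sup>2 * k ^ 8) = 1" unfolding lam b_def[symmetric] using b k by simp
  have lpos: "l > 0" unfolding lam b_def[symmetric] using b k by (auto intro!: divide_pos_pos mult_pos_pos)
  have bk: "y * k ^ m \<le> y * (b ^ n * k ^ m')" if "m \<le> m'" "0 \<le> y" for y m m' n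
  proof (intro mult_left_mono that)
    have "1 * k ^ m \<le> b ^ n * k ^ m'" using kp[OF that(1)] bp[of n] k by (intro mult_mono) auto
    then show "k ^ m \<le> b ^ n * k ^ m'" by simp
  qed
  have xk: "y * k ^ m \<le> x\<^sup>2" if "m \<le> 24" "0 \<le> y" "y \<le> 2000" for y m
  proof -
    have "y * k ^ m \<le> y * (b ^ 4 * k ^ 24)" by (rule bk) (use that in auto)
    also have "\<dots> \<le> 2000 * (b ^ 4 * k ^ 24)" by (rule mult_right_mono) (use that b k in auto)
    finally show ?thesis using xR unfolding b_def by (simp add: mult.assoc)
  qed
  have x2: "1 \<le> x\<^sup>2" using xk[of 0 1] by simp
  have x1: "1 \<le> x" using x2 nonneg(1) power2_le_imp_le[of 1 x] by simp
  have xx: "x \<le> x\<^sup>2" using x1 by (simp add: power2_eq_square)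
  have lU: "l * U \<le> 1"
  proof -
    have "U \<le> 8 * b\<^sup>2 * k ^ 8" using bk[of 1 8 8 2] U k by (simp add: mult.assoc)
    then have "l * U \<le> l * (8 * b\<^sup>2 * k ^ 8)" using lpos by (intro mult_left_mono) auto
    then show ?thesis using l by simp
  qed
  \<comment> \<open>This inequality dictates \<open>l\<close>: the product on the left without
    \<open>l\<close> is at most \<open>4 * b\<^sup>2 * k ^ 8\<close>.\<close>
  have key: "4 * c\<^sup>2 * (B * N * U)\<^sup>2 * l \<le> 1 / 2"
  proof -
    have "B * N * U \<le> b * k\<^sup>2 * k" using b N U B k by (intro mult_mono) auto
    then have "(B * N * U)\<^sup>2 \<le> (b * k\<^sup>2 * k)\<^sup>2" using B N U by (intro power_mono) auto
    moreover have "c\<^sup>2 \<le> k\<^sup>2" using c by (intro power_mono) auto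
    ultimately have "c\<^sup>2 * (B * N * U)\<^sup>2 \<le> k\<^sup>2 * (b * k\<^sup>2 * k)\<^sup>2" by (intro mult_mono) auto
    also have "\<dots> = b\<^sup>2 * k ^ 8" by (simp add: power_mult_distrib power_mult[symmetric] power_add[symmetric] power2_eq_square eval_nat_numeral)
    finally have "c\<^sup>2 * (B * N * U)\<^sup>2 * l \<le> b\<^sup>2 * k ^ 8 * l" using lpos by (intro mult_right_mono) auto
    moreover have "b\<^sup>2 * k ^ 8 * l = 1 / 8" using l by (simp add: mult_ac)
    ultimately have "c\<^sup>2 * (B * N * U)\<^sup>2 * l \<le> 1 / 8" by linarith
    then show ?thesis by (simp add: mult.assoc)
  qed
  define y where "y = l * U * x"
  \<comment> \<open>Completing the square in \<open>g\<close>.\<close>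
  have s1: "g\<^sup>2 / c - 2 * N * g * y \<ge> - (c * N\<^sup>2 * y\<^sup>2)"
  proof -
    have "0 \<le> (g - c * N * y)\<^sup>2 / c" using c by simp
    also have "\<dots> = g\<^sup>2 / c - 2 * N * g * y + c * N\<^sup>2 * y\<^sup>2"
      using c by (simp add: power2_eq_square field_simps)
    finally show ?thesis by simp
  qed
  \<comment> \<open>The term with the derivative of \<open>\<chi>\<close> is split by Young's
    inequality between a quarter of the Hessian term and half of
    \<open>l * D\<^sup>2\<close>.\<close>
  have s2: "2 * B * r * (l * U * \<bar>D\<bar>) * (N * G) \<le> r\<^sup>2 * (G\<^sup>2 / (4 * c\<^sup>2)) + l * D\<^sup>2 / 2"
  proof -
    define e where "e = B * N * U * l * \<bar>D\<bar>"
    have "0 \<le> (r * G / (2 * c) - 2 * c * e)\<^sup>2" by simp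
    also have "\<dots> = r\<^sup>2 * (G\<^sup>2 / (4 * c\<^sup>2)) + 4 * c\<^sup>2 * e\<^sup>2 - 2 * r * G * e"
      using c by (simp add: power2_eq_square field_simps)
    finally have "2 * r * G * e \<le> r\<^sup>2 * (G\<^sup>2 / (4 * c\<^sup>2)) + 4 * c\<^sup>2 * e\<^sup>2" by simp
    also have "4 * c\<^sup>2 * e\<^sup>2 = (4 * c\<^sup>2 * (B * N * U)\<^sup>2 * l) * (l * D\<^sup>2)"
      unfolding e_def by (simp add: power_mult_distrib power2_eq_square)
    also have "\<dots> \<le> 1 / 2 * (l * D\<^sup>2)" using key lpos by (intro mult_right_mono) auto
    finally show ?thesis unfolding e_def by (simp add: mult_ac)
  qed
  \<comment> \<open>A second quarter of the Hessian term absorbs the one linear in \<open>G\<close>;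
    the remaining constant is left to \<open>s4\<close>.\<close>
  have s3: "c * (2 * c + 1) * G \<le> G\<^sup>2 / (4 * c\<^sup>2) + c ^ 4 * (2 * c + 1)\<^sup>2"
  proof -
    have "0 \<le> (G / (2 * c) - c\<^sup>2 * (2 * c + 1))\<^sup>2" by simp
    also have "\<dots> = G\<^sup>2 / (4 * c\<^sup>2) + c ^ 4 * (2 * c + 1)\<^sup>2 - c * (2 * c + 1) * G"
      using c by (simp add: power2_diff power_mult_distrib power_divide) (simp add: power2_eq_square field_simps)
    finally show ?thesis by simp
  qed
  \<comment> \<open>The penalty is small with \<open>l\<close>, but the assumed size of
    \<open>x\<^sup>2\<close> exceeds \<open>1 / l\<close> by enough powers of \<open>b\<close> and
    \<open>k\<close>.\<close>
  have s4: "c ^ 4 * (2 * c + 1)\<^sup>2 + 2 * c * N \<le> l * (x\<^sup>2 / c)"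
  proof -
    have "c ^ 4 * (2 * c + 1)\<^sup>2 \<le> k ^ 4 * (3 * k)\<^sup>2" using c by (intro mult_mono power_mono) auto
    moreover have "2 * c * N \<le> 2 * k * k\<^sup>2" using c N by (intro mult_mono) auto
    ultimately have "c ^ 4 * (2 * c + 1)\<^sup>2 + 2 * c * N \<le> 9 * k ^ 6 + 2 * k ^ 3"
      by (simp add: power_mult_distrib power_add[symmetric] eval_nat_numeral)
    also have "\<dots> \<le> 11 * k ^ 6" using kp[of 3 6] by simp
    finally have "(c ^ 4 * (2 * c + 1)\<^sup>2 + 2 * c * N) * c \<le> (11 * k ^ 6) * k" using c N by (intro mult_mono) auto
    also have "\<dots> = l * (8 * b\<^sup>2 * k ^ 8) * (11 * k ^ 7)" unfolding l by (simp add: eval_nat_numeral)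
    also have "\<dots> = l * (88 * b\<^sup>2 * k ^ 15)" by (simp add: power_add[symmetric] mult_ac)
    also have "\<dots> \<le> l * x\<^sup>2"
    proof (intro mult_left_mono)
      have "b ^ 2 * k ^ 15 \<le> b ^ 4 * k ^ 24" using b k by (intro mult_mono power_increasing) auto
      moreover have "0 \<le> b ^ 4 * k ^ 24" using b k by simp
      ultimately have "88 * b\<^sup>2 * k ^ 15 \<le> 2000 * b ^ 4 * k ^ 24" unfolding mult.assoc by linarith
      then show "88 * b\<^sup>2 * k ^ 15 \<le> x\<^sup>2" using xR unfolding b_def by linarith
    qed (use lpos in simp)
    finally show ?thesis using c by (simp add: field_simps)
  qed
  have "r\<^sup>2 * (c ^ 4 * (2 * c + 1)\<^sup>2) + r\<^sup>2 * (2 * c * N) \<le> l * r\<^sup>2 * (x\<^sup>2 / c)"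
    using mult_left_mono[OF s4, of "r\<^sup>2"] by (simp add: distrib_left mult.left_commute mult.assoc)
  moreover have "r\<^sup>2 * (c * (2 * c + 1) * G) \<le> r\<^sup>2 * (G\<^sup>2 / (4 * c\<^sup>2)) + r\<^sup>2 * (c ^ 4 * (2 * c + 1)\<^sup>2)"
    using mult_left_mono[OF s3, of "r\<^sup>2"] by (simp only: distrib_left zero_le_power2)
  moreover have "r\<^sup>2 * (G\<^sup>2 / c\<^sup>2) = 4 * (r\<^sup>2 * (G\<^sup>2 / (4 * c\<^sup>2)))" by simp
  moreover have "0 \<le> r\<^sup>2 * (G\<^sup>2 / (4 * c\<^sup>2))" by simp
  ultimately have "l * D\<^sup>2 / 2 \<le> c * N\<^sup>2 * y\<^sup>2 + 2 * c * N * y + l * U * (2 * c * (c * (1 + x)))"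
    using main s1 s2 unfolding y_def[symmetric] by linarith
  also have "\<dots> \<le> l * (7 * k ^ 6 * x\<^sup>2)"
  proof -
    have y: "0 \<le> y" "y \<le> l * k * x" unfolding y_def using U lpos nonneg by (auto intro!: mult_mono)
    have "y\<^sup>2 = (l * U) * (l * U) * x\<^sup>2" unfolding y_def by (simp add: power2_eq_square)
    also have "\<dots> \<le> 1 * (l * k) * x\<^sup>2" using lU U lpos k by (intro mult_mono) auto
    finally have y2: "y\<^sup>2 \<le> l * k * x\<^sup>2" by simp
    have "c * N\<^sup>2 * y\<^sup>2 \<le> k * (k\<^sup>2)\<^sup>2 * (l * k * x\<^sup>2)" using y2 c N by (intro mult_mono power_mono) auto
    moreover have "2 * c * N * y \<le> 2 * k * k\<^sup>2 * (l * k * x\<^sup>2)"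
    proof (intro mult_mono)
      show "y \<le> l * k * x\<^sup>2" using y xx lpos k by (meson mult_left_mono mult_nonneg_nonneg order_trans less_imp_le zero_le_one)
    qed (use c N y in auto)
    moreover have "l * U * (2 * c * (c * (1 + x))) \<le> l * k * (2 * k * (k * (2 * x\<^sup>2)))"
      using c U lpos xx x2 nonneg by (intro mult_mono) auto
    ultimately have "c * N\<^sup>2 * y\<^sup>2 + 2 * c * N * y + l * U * (2 * c * (c * (1 + x)))
       \<le> l * ((k ^ 6 + 2 * k ^ 4 + 4 * k ^ 3) * x\<^sup>2)"
      by (simp add: algebra_simps eval_nat_numeral)
    also have "\<dots> \<le> l * (7 * k ^ 6 * x\<^sup>2)"
      using kp[of 4 6] kp[of 3 6] lpos by (intro mult_left_mono mult_right_mono) auto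
    finally show ?thesis .
  qed
  \<comment> \<open>Here \<open>D\<^sup>2\<close> is at most quadratic in \<open>x\<close>, whereas
    the lower bound for \<open>D\<close> makes it at least of order \<open>x ^ 4\<close>.\<close>
  finally have "D\<^sup>2 \<le> 14 * k ^ 6 * x\<^sup>2" using lpos by simp
  moreover have "x\<^sup>2 * x\<^sup>2 \<le> 4 * k\<^sup>2 * D\<^sup>2"
  proof -
    have "x\<^sup>2 / (2 * c) \<le> \<bar>D\<bar>" using D xk[of 2 16] by simp
    then have "x\<^sup>2 \<le> 2 * c * \<bar>D\<bar>" using c by (simp add: field_simps)
    also have "\<dots> \<le> 2 * k * \<bar>D\<bar>" using c by (intro mult_right_mono) auto
    finally have "(x\<^sup>2)\<^sup>2 \<le> (2 * k * \<bar>D\<bar>)\<^sup>2" by (intro power_mono) auto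
    moreover have "(2 * k * \<bar>D\<bar>)\<^sup>2 = 4 * k\<^sup>2 * D\<^sup>2" by (simp add: power_mult_distrib)
    ultimately show ?thesis by (simp only: power2_eq_square[of "x\<^sup>2"])
  qed
  ultimately have "x\<^sup>2 * x\<^sup>2 \<le> 4 * k\<^sup>2 * (14 * k ^ 6 * x\<^sup>2)"
    by (meson mult_left_mono order_trans zero_le_power2 mult_nonneg_nonneg zero_le_numeral)
  also have "\<dots> = (56 * k ^ 8) * x\<^sup>2" by (simp add: eval_nat_numeral)
  finally have "x\<^sup>2 * x\<^sup>2 \<le> (56 * k ^ 8) * x\<^sup>2" .
  then have "x\<^sup>2 \<le> 56 * k ^ 8" by (rule mult_right_le_imp_le) (use x2 in linarith)
  moreover have "56 * k ^ 8 < x\<^sup>2"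
    using xk[of 8 57] kp[of 0 8] by simp
  ultimately show False by simp
qed

text \<open>\<open>ut\<close> is the \<open>v\<close> of the overview. \<open>k\<close> collects the
  structural bounds and \<open>B\<close> those on the couplings, so that both may later be read off
  from the constants of the theorem. In \<open>dw_terminal\<close> only the sign of
  \<open>\<alpha>\<close> is recorded: no bound on the ratio of the slopes of \<open>f\<close> and
  \<open>g\<close> is available or required. The bound on \<open>X'\<close> is restricted to
  \<open>- k \<le> w z\<close>, while \<open>w_lower\<close> gives \<open>- (k - 1)\<close> on the
  boundary; the gap of 1 is the room for the penalty.\<close>

locale bernstein = separable_mfg +
  fixes k B a0 a1 l :: real and ut :: "(real ^ 'a) \<times> real \<Rightarrow> real"
    and \<Phi> :: "(real ^ 'a) \<times> real \<Rightarrow> real"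
    and \<Phi>1 :: "(real ^ 'a) \<times> real \<Rightarrow> (real ^ 'a) \<times> real \<Rightarrow> real"
  defines "ut \<equiv> \<lambda>z. u z + a0 + a1 * snd z"
    and "l \<equiv> 1 / (8 * (1 + B)\<^sup>2 * k ^ 8)"
    and "\<Phi> \<equiv> \<lambda>z. Hh (p z) + W (fst z) + l * (ut z)\<^sup>2 / 2"
    and "\<Phi>1 \<equiv> \<lambda>z b. U2 z (V (p z), 0) b + Y (fst z) \<bullet> fst b + l * ut z * (U1 z b + a1 * snd b)"
  assumes k: "c \<le> k" "CARD('a) \<le> k" "\<bar>a1\<bar> \<le> k" and B: "0 \<le> B"
    and ut_bound: "\<And>z. z \<in> UNIV \<times> {0..T} \<Longrightarrow> \<bar>ut z\<bar> \<le> k"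
    and ut_initial: "\<And>x. ut (x, 0) \<le> -1"
    and ut_terminal: "\<And>x. 1 \<le> ut (x, T)"
    and X'_bound: "\<And>z. z \<in> UNIV \<times> {0<..<T} \<Longrightarrow> - k \<le> w z \<Longrightarrow> \<bar>X' z\<bar> \<le> 2 * B * sqrt (X z)"
    and w_lower: "\<And>x t. t \<in> {0, T} \<Longrightarrow> - (k - 1) \<le> w (x, t)"
    and w_upper: "\<And>x t. t \<in> {0, T} \<Longrightarrow> w (x, t) \<le> k + B"
    and dw_initial: "\<And>x y. \<bar>dw (x, 0) (y, 0)\<bar> \<le> c\<^sup>2 * norm y"
    and dw_terminal: "\<And>x. \<exists>\<alpha> \<gamma>. 0 < \<alpha> \<and> norm \<gamma> \<le> B \<and> (\<forall>y. dw (x, T) (y, 0) = \<alpha> * ((p (x, T) - \<gamma>) \<bullet> y))"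
begin

lemma k1: "1 \<le> k" using c k by simp

lemma l_pos: "0 < l"
  unfolding l_def using B k1 by (intro divide_pos_pos mult_pos_pos zero_less_power) auto

lemma l_eq: "l * (8 * (1 + B)\<^sup>2 * k ^ 8) = 1"
  unfolding l_def using B k1 by simp

text \<open>With values in \<open>[0, 1]\<close> the penalty costs at most 1 when bounds on
  \<open>w\<close> are carried from the boundary to the maximum point of
  \<open>\<Phi>\<close>.\<close>

lemma penalty_bound:
  assumes "z \<in> slab"
  shows "0 \<le> l * (ut z)\<^sup>2 / 2" "l * (ut z)\<^sup>2 / 2 \<le> 1"
proof -
  show "0 \<le> l * (ut z)\<^sup>2 / 2" using l_pos by simp
  have "(ut z)\<^sup>2 \<le> k\<^sup>2" using ut_bound[OF assms] by (simp add: abs_le_square_iff[symmetric] k1 order_trans[OF zero_le_one])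
  also have "1 * k\<^sup>2 \<le> (1 + B)\<^sup>2 * k ^ 8"
    by (intro mult_mono power_increasing) (use B k1 in auto)
  finally have "l * (ut z)\<^sup>2 \<le> l * ((1 + B)\<^sup>2 * k ^ 8)" using l_pos by (intro mult_left_mono) auto
  then show "l * (ut z)\<^sup>2 / 2 \<le> 1" using l_eq by simp
qed

lemma \<Phi>_deriv:
  assumes "z \<in> slab"
  shows "(\<Phi> has_derivative \<Phi>1 z) (at z within slab)"
proof -
  have "((\<lambda>z. Hh (p z)) has_derivative (\<lambda>b. V (p z) \<bullet> dp z b)) (at z within slab)"
    by (rule has_derivative_compose[OF p_deriv[OF assms] Hh])
  then have 1: "((\<lambda>z. Hh (p z)) has_derivative (\<lambda>b. U2 z (V (p z), 0) b)) (at z within slab)"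
    by (simp add: U2_space inner_commute)
  have 2: "((\<lambda>z. W (fst z)) has_derivative (\<lambda>b. Y (fst z) \<bullet> fst b)) (at z within slab)"
    by (rule has_derivative_compose[OF has_derivative_fst[OF has_derivative_ident] W])
  have 3: "((\<lambda>z. l * (ut z)\<^sup>2 / 2) has_derivative (\<lambda>b. l * ut z * (U1 z b + a1 * snd b))) (at z within slab)"
    unfolding ut_def by (rule derivative_eq_intros deriv1[OF assms] refl)+ (auto simp: algebra_simps power2_eq_square)
  show ?thesis unfolding \<Phi>_def \<Phi>1_def by (intro has_derivative_add 1 2 3)
qed

lemma \<Phi>1_a:
  assumes z: "z \<in> slab"
  shows "\<Phi>1 z (a z) = - dw z (V (p z), 0) + l * ut z * (U1 z (a z) + a1)"
  unfolding \<Phi>1_def by (simp add: U2_space U2_space_a[OF z] fst_a)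

lemma U1_a: "U1 z (a z) = Hh (p z) + W (fst z) - w z - V (p z) \<bullet> p z"
proof -
  have "a z = (0, 1) - (V (p z), 0)" by (simp add: a_def)
  then have "U1 z (a z) = U1 z (0, 1) - p z \<bullet> V (p z)"
    by (simp only: linear_diff[OF lin1] U1_space)
  then show ?thesis by (simp add: w_def inner_commute)
qed

text \<open>By \<open>V_inner\<close> the difference \<open>Hh - V \<bullet> p\<close> is at most
  \<open>c - Hh\<close>, hence at most \<open>2 * c\<close> minus the norm of \<open>p\<close>
  squared over \<open>c\<close>. The remaining constants bring the total to at most
  \<open>8 * k\<close>, and the assumed size of \<open>p\<close> makes this half of the quadratic
  term.\<close>

lemma penalty_transport:
  assumes "- k \<le> w z" "16 * k\<^sup>2 \<le> (norm (p z))\<^sup>2"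
  shows "U1 z (a z) + a1 \<le> - ((norm (p z))\<^sup>2 / (2 * c))"
proof -
  have "16 * k * k \<le> (norm (p z))\<^sup>2" using assms(2) by (simp add: power2_eq_square)
  moreover have "16 * k * c \<le> 16 * k * k" using k k1 by (intro mult_left_mono) auto
  ultimately have "8 * k \<le> (norm (p z))\<^sup>2 / (2 * c)" using c by (simp add: field_simps)
  moreover have "(norm (p z))\<^sup>2 / c = (norm (p z))\<^sup>2 / (2 * c) + (norm (p z))\<^sup>2 / (2 * c)" using c by (simp add: field_simps)
  ultimately show ?thesis
    using V_inner[of "p z"] Hh_lower[of "p z"] W_bound[of "fst z"] assms(1) k unfolding U1_a by auto
qed

lemma norm_ge_1:
  assumes "2000 * (1 + B) ^ 4 * k ^ 24 < (norm (p z))\<^sup>2"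
  shows "1 \<le> norm (p z)" "40 * (1 + B)\<^sup>2 * k ^ 12 \<le> norm (p z)" "16 * k\<^sup>2 \<le> (norm (p z))\<^sup>2"
proof -
  have "(40 * (1 + B)\<^sup>2 * k ^ 12)\<^sup>2 = 1600 * ((1 + B) ^ 4 * k ^ 24)"
    by (simp add: power_mult_distrib power_mult[symmetric])
  also have "\<dots> \<le> 2000 * (1 + B) ^ 4 * k ^ 24" using B k1 by simp
  finally have sq: "(40 * (1 + B)\<^sup>2 * k ^ 12)\<^sup>2 \<le> (norm (p z))\<^sup>2" using assms by linarith
  show 40: "40 * (1 + B)\<^sup>2 * k ^ 12 \<le> norm (p z)"
    by (rule power2_le_imp_le[OF sq]) simp
  have "1 * 1 \<le> (1 + B)\<^sup>2 * k ^ 12" using B k1 by (intro mult_mono one_le_power) auto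
  then show "1 \<le> norm (p z)" using 40 by linarith
  have "1 * k ^ 2 \<le> (1 + B) ^ 4 * k ^ 24" using B k1 by (intro mult_mono one_le_power power_increasing) auto
  moreover have "0 \<le> (1 + B) ^ 4 * k ^ 24" using B k1 by simp
  ultimately show "16 * k\<^sup>2 \<le> (norm (p z))\<^sup>2" using assms unfolding mult.assoc by linarith
qed

text \<open>At a maximum at \<open>t = 0\<close> the derivative of \<open>\<Phi>\<close> along
  \<open>a\<close> is nonpositive. There \<open>ut \<le> -1\<close>, so the penalty contributes a
  positive term quadratic in \<open>p\<close>, while the spatial derivative of \<open>w\<close> in
  direction \<open>V\<close> is only linear in \<open>p\<close>, since the gradient of
  \<open>w\<close> is bounded at \<open>t = 0\<close>.\<close>

lemma bernstein_initial:
  assumes max: "\<And>y. y \<in> slab \<Longrightarrow> \<Phi> y \<le> \<Phi> (x, 0)"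
  shows "(norm (p (x, 0)))\<^sup>2 \<le> 2000 * (1 + B) ^ 4 * k ^ 24"
proof (rule ccontr)
  define z where "z = (x, 0 :: real)"
  assume "\<not> ?thesis"
  then have big: "2000 * (1 + B) ^ 4 * k ^ 24 < (norm (p z))\<^sup>2" by (simp add: z_def)
  note n = norm_ge_1[OF big]
  have zs: "z \<in> slab" using T by (simp add: z_def)
  have 0: "\<Phi>1 z (y, 0) = 0" for y unfolding z_def
    by (rule slab_max_derivatives(1)[OF \<Phi>_deriv]) (use max T in auto)
  have 1: "\<Phi>1 z (0, 1) \<le> 0" unfolding z_def
    by (rule slab_max_derivatives(2)[OF \<Phi>_deriv]) (use max T in auto)
  have "a z = (- V (p z), 0) + (0, 1)" by (simp add: a_def)
  then have "\<Phi>1 z (a z) = \<Phi>1 z (- V (p z), 0) + \<Phi>1 z (0, 1)"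
    by (simp only: linear_add[OF has_derivative_linear[OF \<Phi>_deriv[OF zs]]])
  then have "\<Phi>1 z (a z) \<le> 0" using 0 1 by simp
  then have "l * ut z * (U1 z (a z) + a1) \<le> dw z (V (p z), 0)" unfolding \<Phi>1_a[OF zs] by simp
  also have "\<dots> \<le> c\<^sup>2 * norm (V (p z))" using dw_initial[of x "V (p z)"] by (simp add: z_def)
  also have "\<dots> \<le> c\<^sup>2 * (c * (1 + norm (p z)))" by (intro mult_left_mono V_bound) simp
  also have "\<dots> \<le> k\<^sup>2 * (k * (2 * norm (p z)))" using c k k1 n by (intro mult_mono power_mono) auto
  finally have 2: "l * ut z * (U1 z (a z) + a1) \<le> 2 * k ^ 3 * norm (p z)" by (simp add: eval_nat_numeral)
  have D: "U1 z (a z) + a1 \<le> - ((norm (p z))\<^sup>2 / (2 * c))"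
    by (rule penalty_transport[OF _ n(3)]) (use w_lower[of 0 x] in \<open>simp add: z_def\<close>)
  have "(norm (p z))\<^sup>2 / (2 * k) \<le> (norm (p z))\<^sup>2 / (2 * c)" using c k by (intro divide_left_mono) auto
  then have "(norm (p z))\<^sup>2 / (2 * k) \<le> - (U1 z (a z) + a1)" using D by simp
  also have "\<dots> \<le> ut z * (U1 z (a z) + a1)"
  proof -
    have "0 \<le> (norm (p z))\<^sup>2 / (2 * c)" using c by simp
    then have "0 \<le> - (U1 z (a z) + a1)" using D by linarith
    then have "1 * - (U1 z (a z) + a1) \<le> - ut z * - (U1 z (a z) + a1)"
      using ut_initial[of x] by (intro mult_right_mono) (auto simp: z_def)
    then show ?thesis by (simp add: algebra_simps)
  qed
  finally have "l * ((norm (p z))\<^sup>2 / (2 * k)) \<le> l * (ut z * (U1 z (a z) + a1))"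
    using l_pos by (intro mult_left_mono) auto
  also have "\<dots> \<le> 2 * k ^ 3 * norm (p z)" using 2 by (simp add: mult.assoc)
  finally have "l * (norm (p z))\<^sup>2 \<le> 4 * k ^ 4 * norm (p z)" using k1 by (simp add: field_simps eval_nat_numeral)
  then have "l * norm (p z) * norm (p z) \<le> 4 * k ^ 4 * norm (p z)" by (simp add: power2_eq_square mult.assoc)
  \<comment> \<open>Multiplying by \<open>1 / l\<close> gives
    \<open>32 * (1 + B)\<^sup>2 * k ^ 12\<close>, which contradicts the factor 40 in
    \<open>norm_ge_1\<close>.\<close>
  then have "l * norm (p z) \<le> 4 * k ^ 4" by (rule mult_right_le_imp_le) (use n in linarith)
  then have "(8 * (1 + B)\<^sup>2 * k ^ 8) * (l * norm (p z)) \<le> (8 * (1 + B)\<^sup>2 * k ^ 8) * (4 * k ^ 4)"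
    by (intro mult_left_mono) (use k1 in auto)
  also have "(8 * (1 + B)\<^sup>2 * k ^ 8) * (l * norm (p z)) = (l * (8 * (1 + B)\<^sup>2 * k ^ 8)) * norm (p z)"
    by (simp only: mult_ac)
  also have "\<dots> = norm (p z)" by (simp only: l_eq mult_1)
  also have "(8 * (1 + B)\<^sup>2 * k ^ 8) * (4 * k ^ 4) = 32 * ((1 + B)\<^sup>2 * k ^ 12)"
    by (simp add: mult_ac power_add[symmetric])
  finally have "norm (p z) \<le> 32 * ((1 + B)\<^sup>2 * k ^ 12)" .
  moreover have "0 < (1 + B)\<^sup>2 * k ^ 12" using B k1 by (intro mult_pos_pos zero_less_power) auto
  ultimately show False using n(2) unfolding mult.assoc by linarith
qed

text \<open>Now the derivative along \<open>a\<close> is nonnegative, and \<open>1 \<le> ut\<close>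
  makes the penalty term negative. This forces \<open>dw\<close> in direction \<open>V\<close> to be
  negative. By the terminal condition that means \<open>(p - \<gamma>) \<bullet> V < 0\<close>,
  which the coercivity of \<open>V \<bullet> p\<close> excludes for large \<open>p\<close>.\<close>

lemma bernstein_terminal:
  assumes max: "\<And>y. y \<in> slab \<Longrightarrow> \<Phi> y \<le> \<Phi> (x, T)"
  shows "(norm (p (x, T)))\<^sup>2 \<le> 2000 * (1 + B) ^ 4 * k ^ 24"
proof (rule ccontr)
  define z where "z = (x, T)"
  assume "\<not> ?thesis"
  then have big: "2000 * (1 + B) ^ 4 * k ^ 24 < (norm (p z))\<^sup>2" by (simp add: z_def)
  note n = norm_ge_1[OF big]
  define r where "r = norm (p z)"
  have r: "1 \<le> r" "40 * (1 + B)\<^sup>2 * k ^ 12 \<le> r" using n by (auto simp: r_def)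
  have zs: "z \<in> slab" using T by (simp add: z_def)
  have 0: "\<Phi>1 z (y, 0) = 0" for y unfolding z_def
    by (rule slab_max_derivatives(1)[OF \<Phi>_deriv]) (use max T in auto)
  have 1: "0 \<le> \<Phi>1 z (0, 1)" unfolding z_def
    by (rule slab_max_derivatives(3)[OF \<Phi>_deriv]) (use max T in auto)
  have "a z = (- V (p z), 0) + (0, 1)" by (simp add: a_def)
  then have "\<Phi>1 z (a z) = \<Phi>1 z (- V (p z), 0) + \<Phi>1 z (0, 1)"
    by (simp only: linear_add[OF has_derivative_linear[OF \<Phi>_deriv[OF zs]]])
  then have "0 \<le> \<Phi>1 z (a z)" using 0 1 by simp
  then have 2: "dw z (V (p z), 0) \<le> l * ut z * (U1 z (a z) + a1)" unfolding \<Phi>1_a[OF zs] by simp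
  have D: "U1 z (a z) + a1 \<le> - ((norm (p z))\<^sup>2 / (2 * c))"
    by (rule penalty_transport[OF _ n(3)]) (use w_lower[of T x] in \<open>simp add: z_def\<close>)
  have "0 < (norm (p z))\<^sup>2 / (2 * c)" using n(1) c by (intro divide_pos_pos zero_less_power) linarith+
  then have "U1 z (a z) + a1 < 0" using D by linarith
  moreover have "0 < l * ut z" using l_pos ut_terminal[of x] by (intro mult_pos_pos) (auto simp: z_def)
  ultimately have "l * ut z * (U1 z (a z) + a1) < 0" by (rule mult_pos_neg[rotated])
  then have dw: "dw z (V (p z), 0) < 0" using 2 by simp
  obtain \<alpha> \<gamma> where \<alpha>: "0 < \<alpha>" "norm \<gamma> \<le> B" and *: "\<forall>y. dw z (y, 0) = \<alpha> * ((p z - \<gamma>) \<bullet> y)"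
    using dw_terminal[of x] unfolding z_def[symmetric] by blast
  have "(p z - \<gamma>) \<bullet> V (p z) < 0" using dw * \<alpha> by (simp add: mult_less_0_iff)
  then have "V (p z) \<bullet> p z < \<gamma> \<bullet> V (p z)" by (simp add: inner_diff_left inner_commute[of "V (p z)" "p z"])
  also have "\<dots> \<le> norm \<gamma> * norm (V (p z))" by (rule norm_cauchy_schwarz)
  also have "\<dots> \<le> B * (c * (1 + r))" unfolding r_def using \<alpha> B by (intro mult_mono V_bound) auto
  also have "\<dots> \<le> B * (k * (2 * r))" using B c k k1 r by (intro mult_mono) auto
  finally have "2 * (r\<^sup>2 / c) - 3 * c \<le> B * (k * (2 * r))"
    using V_inner[of "p z"] Hh_lower[of "p z"] unfolding r_def by simp
  moreover have "r\<^sup>2 / k \<le> r\<^sup>2 / c" using c k by (intro divide_left_mono) auto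
  ultimately have "2 * (r\<^sup>2 / k) \<le> 3 * k + B * (k * (2 * r))" using k by linarith
  also have "\<dots> \<le> 3 * k * r + B * (k * (2 * r))" using k1 r by simp
  finally have "2 * r\<^sup>2 \<le> k * (3 * k * r + B * (k * (2 * r)))" using k1 by (simp add: field_simps)
  also have "\<dots> = (k\<^sup>2 * (3 + 2 * B)) * r" by (simp add: algebra_simps power2_eq_square)
  finally have "2 * r \<le> k\<^sup>2 * (3 + 2 * B)" using r by (simp add: power2_eq_square)
  also have "\<dots> \<le> k ^ 12 * (3 * (1 + B)\<^sup>2)"
  proof (intro mult_mono power_increasing)
    show "3 + 2 * B \<le> 3 * (1 + B)\<^sup>2" using B by (simp add: power2_eq_square algebra_simps)
  qed (use k1 B in auto)
  finally have "2 * r \<le> 3 * ((1 + B)\<^sup>2 * k ^ 12)" by (simp add: mult_ac)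
  moreover have "0 < (1 + B)\<^sup>2 * k ^ 12" using B k1 by (intro mult_pos_pos zero_less_power) auto
  ultimately show False using r(2) unfolding mult.assoc by linarith
qed

text \<open>The equation differentiated in direction \<open>b\<close> is subtracted from the
  second-order inequality for \<open>\<Phi>\<close>. The leading part of \<open>\<Phi>1\<close> is
  \<open>U2 z b\<close>, so all third derivatives cancel. The critical point conditions then rewrite
  what is left in terms of \<open>q0\<close>, \<open>\<rho>\<close>, \<open>D\<close> and the
  Hessian.\<close>

lemma bernstein_interior:
  assumes z: "z \<in> open_slab" and max: "\<And>y. y \<in> slab \<Longrightarrow> \<Phi> y \<le> \<Phi> z"
    and w: "- k \<le> w z"
  shows "(norm (p z))\<^sup>2 \<le> 2000 * (1 + B) ^ 4 * k ^ 24"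
proof -
  note zs = open_slab_slab[OF z]
  define b where "b = (V (p z), 0 :: real)"
  define Pz where "Pz = P (p z)"
  define y where "y = Y (fst z)"
  define Zz where "Zz = Z (fst z)"
  define v where "v = ut z"
  define D where "D = U1 z (a z) + a1"
  define \<rho> where "\<rho> = (l * v) *\<^sub>R p z"
  \<comment> \<open>By \<open>U2_space_a\<close> this is the spatial gradient of
    \<open>w\<close>.\<close>
  define q0 where "q0 = y - dp z (a z)"
  define M where "M = (\<chi> i j. U2 z (axis i 1, 0) (axis j 1, 0))"
  have Psym: "x1 \<bullet> (Pz *v x2) = x2 \<bullet> (Pz *v x1)" for x1 x2
    unfolding Pz_def by (rule symmetric_matrix_inner[OF P_sym])
  obtain q :: "'a \<Rightarrow> real ^ 'a" where
    "\<forall>i j. P (p z) $ i $ j = (\<Sum>k\<in>UNIV. q k $ i * q k $ j)"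
    using P_decomposition[of "p z"] ..
  then have q: "\<And>i j. P (p z) $ i $ j = (\<Sum>k\<in>UNIV. q k $ i * q k $ j)" by simp
  have d1: "(\<Phi> has_derivative \<Phi>1 y) (at y)" if "y \<in> open_slab" for y
    using \<Phi>_deriv[OF open_slab_slab[OF that]] at_within_interior[of y slab] that by (simp add: interior_slab)
  define \<Phi>2 where "\<Phi>2 e e' = U3 z b e e' + dp z e \<bullet> (Pz *v dp z e') + (Zz *v fst e') \<bullet> fst e
      + l * ((U1 z e' + a1 * snd e') * (U1 z e + a1 * snd e) + v * U2 z e e')" for e e'
  have d2: "((\<lambda>y. \<Phi>1 y e) has_derivative \<Phi>2 e) (at z)" for e
  proof -
    have dVp: "((\<lambda>y. (V (p y), 0 :: real)) has_derivative (\<lambda>b. (Pz *v dp z b, 0))) (at z)"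
      unfolding Pz_def by (intro has_derivative_Pair has_derivative_compose[OF p_deriv_at[OF z] V] has_derivative_const)
    have 1: "((\<lambda>y. U2 y (V (p y), 0) e) has_derivative (\<lambda>b'. U3 z b e b' + U2 z (Pz *v dp z b', 0) e)) (at z)"
      unfolding b_def
      by (rule has_derivative_linear_apply[where L = "\<lambda>y c. U2 y c e" and L' = "\<lambda>c. U3 z c e", OF lin2(1) _ lin3(1) dVp UNIV_I])
        (rule deriv_at(3)[OF z])
    have 2: "((\<lambda>y. Y (fst y) \<bullet> fst e) has_derivative (\<lambda>b'. (Zz *v fst b') \<bullet> fst e)) (at z)"
      unfolding Zz_def by (intro has_derivative_inner_left has_derivative_compose[OF has_derivative_fst[OF has_derivative_ident] Y])
    have 3: "((\<lambda>y. l * ut y * (U1 y e + a1 * snd e)) has_derivative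
        (\<lambda>b'. l * ((U1 z b' + a1 * snd b') * (U1 z e + a1 * snd e) + v * U2 z e b'))) (at z)"
      unfolding ut_def v_def by (rule derivative_eq_intros deriv_at[OF z] refl)+ (auto simp: algebra_simps)
    have "(\<lambda>b'. U3 z b e b' + U2 z (Pz *v dp z b', 0) e + (Zz *v fst b') \<bullet> fst e
        + l * ((U1 z b' + a1 * snd b') * (U1 z e + a1 * snd e) + v * U2 z e b')) = \<Phi>2 e"
      unfolding \<Phi>2_def by (simp add: U2_space)
    with has_derivative_add[OF has_derivative_add[OF 1 2] 3] show ?thesis unfolding \<Phi>1_def by simp
  qed
  have crit: "\<Phi>1 z e = 0" for e by (rule maximum_principle(1)[OF z max d1 d2])
  have dpb: "dp z b = - (y + \<rho>)"
  proof -
    have "dp z b \<bullet> x = - (y + \<rho>) \<bullet> x" for x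
    proof -
      have "dp z b \<bullet> x = U2 z b (x, 0)" using sym2[OF zs, of "(x, 0)" b] by (simp add: U2_space)
      also have "\<dots> = - (y \<bullet> x) - l * v * (p z \<bullet> x)"
        using crit[of "(x, 0)"] unfolding \<Phi>1_def b_def y_def v_def by (simp add: U1_space)
      finally show ?thesis unfolding \<rho>_def by (simp add: inner_diff_left inner_add_left)
    qed
    then have "\<forall>x. dp z b \<bullet> x = - (y + \<rho>) \<bullet> x" ..
    then show ?thesis by (simp only: vector_eq_rdot)
  qed
  have dpa: "dp z (a z) = y - q0" by (simp add: q0_def)
  \<comment> \<open>Criticality in direction \<open>a z\<close> gives the term with
    \<open>X'\<close> the small factor \<open>l * v * D\<close>.\<close>
  have dwb: "dw z b = l * v * D"
    using \<Phi>1_a[OF zs] crit[of "a z"] unfolding b_def v_def D_def by simp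
  have dpk: "dp z (x, 0) = M *v x" for x
    unfolding dp_def M_def matrix_vector_mult_def vec_eq_iff
    by (simp add: linear_axis_sum[OF lin2(2), of _ _ x] mult.commute)
  have s3: "U3 z b x x = U3 z x x b" for x
    using sym3[of z] z by (metis interior_slab)
  have tr3: "(\<Sum>i\<in>UNIV. \<Sum>j\<in>UNIV. P (p z) $ i $ j * U3 z (axis i 1, 0) (axis j 1, 0) b)
      = (\<Sum>k\<in>UNIV. U3 z (q k, 0) (q k, 0) b)"
    by (rule bilinear_trace[OF lin3(1,2) q])
  define QM where "QM = Q (p z) (dp z b) \<bullet> M"
  have QM: "(\<Sum>i\<in>UNIV. \<Sum>j\<in>UNIV. Q (p z) (dp z b) $ i $ j * U2 z (axis i 1, 0) (axis j 1, 0)) = QM"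
    unfolding QM_def M_def inner_vec_def by simp
  have E: "U3 z (a z) (a z) b - 2 * ((y - q0) \<bullet> (Pz *v dp z b)) + X' z * (l * v * D) * tr z
    + X z * QM + X z * (\<Sum>k\<in>UNIV. U3 z (q k, 0) (q k, 0) b) + (Zz *v V (p z)) \<bullet> V (p z) + y \<bullet> (Pz *v dp z b) = 0"
    using equation_derivative[OF z, of b] unfolding QM tr3 dpa dwb
    by (simp add: b_def Pz_def y_def Zz_def)
  have "\<Phi>2 (a z) (a z) + X z * (\<Sum>k\<in>UNIV. \<Phi>2 (q k, 0) (q k, 0)) \<le> 0"
    by (rule maximum_principle(2)[OF z max d1 d2])
  moreover have "\<Phi>2 (a z) (a z) = U3 z (a z) (a z) b + (y - q0) \<bullet> (Pz *v (y - q0)) + (Zz *v V (p z)) \<bullet> V (p z)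
      + l * D\<^sup>2 + l * v * U2 z (a z) (a z)"
    unfolding \<Phi>2_def dpa s3
    by (simp add: fst_a D_def power2_eq_square algebra_simps
        matrix_vector_mult_diff_distrib[of Zz 0 "V (p z)", simplified])
  moreover have "(\<Sum>k\<in>UNIV. \<Phi>2 (q k, 0) (q k, 0)) = (\<Sum>k\<in>UNIV. U3 z (q k, 0) (q k, 0) b)
      + (\<Sum>k\<in>UNIV. (M *v q k) \<bullet> (Pz *v (M *v q k))) + (\<Sum>k\<in>UNIV. q k \<bullet> (Zz *v q k))
      + l * (p z \<bullet> (Pz *v p z)) + l * v * tr z"
    unfolding \<Phi>2_def s3 dpk tr_decomposed[OF q] decomposition_inner[OF q, of "p z" "p z", folded Pz_def]
    by (simp add: U1_space sum.distrib sum_distrib_left distrib_left mult.assoc inner_commute)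
  \<comment> \<open>Besides the third derivatives, the two terms with \<open>Zz\<close> applied to
    \<open>V (p z)\<close> cancel.\<close>
  ultimately have "(y - q0) \<bullet> (Pz *v (y - q0)) + 2 * ((y - q0) \<bullet> (Pz *v dp z b)) - y \<bullet> (Pz *v dp z b)
      - X' z * (l * v * D) * tr z - X z * QM + X z * (\<Sum>k\<in>UNIV. (M *v q k) \<bullet> (Pz *v (M *v q k)))
      + X z * (\<Sum>k\<in>UNIV. q k \<bullet> (Zz *v q k)) + l * D\<^sup>2 + l * X z * (p z \<bullet> (Pz *v p z))
      + l * v * (U2 z (a z) (a z) + X z * tr z) \<le> 0"
    using E by (simp add: algebra_simps)
  moreover have "U2 z (a z) (a z) + X z * tr z = - (y \<bullet> V (p z))"
    using equation[OF z] by (simp add: y_def)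
  \<comment> \<open>After inserting \<open>dp z b = - (y + \<rho>)\<close>, the terms quadratic in
    \<open>y\<close> and those mixing \<open>y\<close> with \<open>q0\<close> cancel; the surviving
    mixed terms contain \<open>\<rho>\<close> and hence \<open>l\<close>.\<close>
  moreover have "(y - q0) \<bullet> (Pz *v (y - q0)) + 2 * ((y - q0) \<bullet> (Pz *v dp z b)) - y \<bullet> (Pz *v dp z b)
      = q0 \<bullet> (Pz *v q0) + 2 * (q0 \<bullet> (Pz *v \<rho>)) - y \<bullet> (Pz *v \<rho>)"
  proof -
    have neg: "Pz *v (- x) = - (Pz *v x)" for x
      using matrix_vector_mult_diff_distrib[of Pz 0 x] by simp
    show ?thesis unfolding dpb neg
      by (simp add: algebra_simps matrix_vector_right_distrib matrix_vector_mult_diff_distrib Psym[of q0 y] Psym[of \<rho> y])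
  qed
  ultimately have main: "q0 \<bullet> (Pz *v q0) + 2 * (q0 \<bullet> (Pz *v \<rho>)) - y \<bullet> (Pz *v \<rho>)
      - X' z * (l * v * D) * tr z - X z * QM + X z * (\<Sum>k\<in>UNIV. (M *v q k) \<bullet> (Pz *v (M *v q k)))
      + X z * (\<Sum>k\<in>UNIV. q k \<bullet> (Zz *v q k)) + l * D\<^sup>2 + l * X z * (p z \<bullet> (Pz *v p z))
      - l * v * (y \<bullet> V (p z)) \<le> 0"
    by simp
  define N where "N = CARD('a) * c"
  define r where "r = sqrt (X z)"
  have r2: "r\<^sup>2 = X z" and r0: "0 \<le> r" using X_pos[OF z] by (simp_all add: r_def)
  have N: "0 \<le> N" "N \<le> k\<^sup>2" unfolding N_def power2_eq_square using c k by (auto intro!: mult_mono)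
  have qN: "(\<Sum>k\<in>UNIV. (norm (q k))\<^sup>2) \<le> N"
    unfolding N_def by (rule decomposition_norm[OF q P_upper])
  have PN: "\<bar>x1 \<bullet> (Pz *v x2)\<bar> \<le> N * norm x1 * norm x2" for x1 x2
  proof -
    have "\<bar>x1 \<bullet> (Pz *v x2)\<bar> \<le> (\<Sum>k\<in>UNIV. \<bar>(x1 \<bullet> q k) * (x2 \<bullet> q k)\<bar>)"
      unfolding Pz_def decomposition_inner[OF q] by (rule sum_abs)
    also have "\<dots> \<le> (\<Sum>k\<in>UNIV. (norm (q k))\<^sup>2 * (norm x1 * norm x2))"
    proof (rule sum_mono)
      fix k
      have "\<bar>x1 \<bullet> q k\<bar> * \<bar>x2 \<bullet> q k\<bar> \<le> (norm x1 * norm (q k)) * (norm x2 * norm (q k))"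
        by (intro mult_mono Cauchy_Schwarz_ineq2) auto
      then show "\<bar>(x1 \<bullet> q k) * (x2 \<bullet> q k)\<bar> \<le> (norm (q k))\<^sup>2 * (norm x1 * norm x2)"
        by (simp add: abs_mult power2_eq_square mult_ac)
    qed
    also have "\<dots> \<le> N * (norm x1 * norm x2)"
      unfolding sum_distrib_right[symmetric] by (intro mult_right_mono qN) auto
    finally show ?thesis by (simp add: mult.assoc)
  qed
  have AN: "\<bar>\<Sum>k\<in>UNIV. q k \<bullet> (A *v q k)\<bar> \<le> N * norm A" for A :: "real ^ 'a ^ 'a"
  proof -
    have "\<bar>\<Sum>k\<in>UNIV. q k \<bullet> (A *v q k)\<bar> \<le> (\<Sum>k\<in>UNIV. \<bar>q k \<bullet> (A *v q k)\<bar>)" by (rule sum_abs)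
    also have "\<dots> \<le> (\<Sum>k\<in>UNIV. (norm (q k))\<^sup>2 * norm A)"
    proof (rule sum_mono)
      fix k
      have "\<bar>q k \<bullet> (A *v q k)\<bar> \<le> norm (q k) * norm (A *v q k)" by (rule Cauchy_Schwarz_ineq2)
      also have "\<dots> \<le> norm (q k) * (norm A * norm (q k))" by (intro mult_left_mono norm_matrix_vector_le) auto
      finally show "\<bar>q k \<bullet> (A *v q k)\<bar> \<le> (norm (q k))\<^sup>2 * norm A" by (simp add: power2_eq_square mult_ac)
    qed
    also have "\<dots> \<le> N * norm A"
      unfolding sum_distrib_right[symmetric] by (intro mult_right_mono qN) auto
    finally show ?thesis .
  qed
  have trN: "\<bar>tr z\<bar> \<le> N * norm M"
  proof -
    have "tr z = (\<Sum>k\<in>UNIV. q k \<bullet> (M *v q k))"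
      unfolding tr_decomposed[OF q] by (simp add: U2_space dpk inner_commute)
    then show ?thesis using AN by simp
  qed
  have y2: "norm y \<le> 2 * c" unfolding y_def by (rule Y_bound)
  have rho: "norm \<rho> = l * \<bar>v\<bar> * norm (p z)" unfolding \<rho>_def using l_pos by (simp add: abs_mult)
  have v: "0 \<le> \<bar>v\<bar>" "\<bar>v\<bar> \<le> k" using ut_bound[OF zs] by (auto simp: v_def)
  have lv: "l * \<bar>v\<bar> \<le> 1"
  proof -
    have "k ^ 1 \<le> k ^ 8" using k1 by (intro power_increasing) auto
    moreover have "1 * k ^ 8 \<le> (8 * (1 + B)\<^sup>2) * k ^ 8"
    proof (intro mult_right_mono)
      have "1 \<le> (1 + B)\<^sup>2" using B by (intro one_le_power) auto
      then show "1 \<le> 8 * (1 + B)\<^sup>2" by simp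
    qed (use k1 in auto)
    ultimately have "\<bar>v\<bar> \<le> 8 * (1 + B)\<^sup>2 * k ^ 8" using v by simp
    then have "l * \<bar>v\<bar> \<le> l * (8 * (1 + B)\<^sup>2 * k ^ 8)" using l_pos by (intro mult_left_mono) auto
    then show ?thesis using l_eq by simp
  qed
  have i1: "(norm q0)\<^sup>2 / c \<le> q0 \<bullet> (Pz *v q0)" using P_lower[of q0 "p z"] by (simp add: Pz_def)
  have i2: "- (2 * N * norm q0 * (l * \<bar>v\<bar> * norm (p z))) \<le> 2 * (q0 \<bullet> (Pz *v \<rho>))"
    using PN[of q0 \<rho>] unfolding rho by linarith
  have i3: "y \<bullet> (Pz *v \<rho>) \<le> 2 * c * N * (l * \<bar>v\<bar> * norm (p z))"
  proof -
    have "y \<bullet> (Pz *v \<rho>) \<le> N * norm y * norm \<rho>" using PN[of y \<rho>] by linarith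
    also have "\<dots> \<le> N * (2 * c) * norm \<rho>" using N y2 by (intro mult_right_mono mult_left_mono) auto
    finally show ?thesis unfolding rho by (simp add: mult_ac)
  qed
  have i4: "X' z * (l * v * D) * tr z \<le> 2 * B * r * (l * \<bar>v\<bar> * \<bar>D\<bar>) * (N * norm M)"
  proof -
    have "X' z * (l * v * D) * tr z \<le> \<bar>X' z\<bar> * (l * \<bar>v\<bar> * \<bar>D\<bar>) * \<bar>tr z\<bar>"
      using l_pos abs_ge_self[of "X' z * (l * v * D) * tr z"] by (simp add: abs_mult)
    also have "\<dots> \<le> 2 * B * r * (l * \<bar>v\<bar> * \<bar>D\<bar>) * (N * norm M)"
      using X'_bound[OF z w] trN l_pos B r0 unfolding r_def by (intro mult_mono) auto
    finally show ?thesis .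
  qed
  \<comment> \<open>The decay of \<open>Q\<close> in \<open>p\<close> exactly balances the linear
    growth of \<open>dp z b\<close>.\<close>
  have i5: "X z * QM \<le> r\<^sup>2 * (c * (2 * c + 1) * norm M)"
  proof -
    have "norm (dp z b) \<le> 2 * c + norm (p z)"
    proof -
      have "norm (dp z b) \<le> norm y + norm \<rho>" unfolding dpb norm_minus_cancel by (rule norm_triangle_ineq)
      also have "norm \<rho> \<le> 1 * norm (p z)" unfolding rho using lv by (intro mult_right_mono) auto
      finally show ?thesis using y2 by simp
    qed
    also have "\<dots> \<le> (2 * c + 1) * (1 + norm (p z))" using c by (simp add: algebra_simps)
    finally have dpb': "norm (dp z b) \<le> (2 * c + 1) * (1 + norm (p z))" .
    have pos: "0 < 1 + norm (p z)" using norm_ge_zero[of "p z"] by linarith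
    have "QM \<le> norm (Q (p z) (dp z b)) * norm M" unfolding QM_def by (rule norm_cauchy_schwarz)
    also have "norm (Q (p z) (dp z b)) \<le> c / (1 + norm (p z)) * norm (dp z b)" by (rule Q_bound)
    also have "\<dots> \<le> c / (1 + norm (p z)) * ((2 * c + 1) * (1 + norm (p z)))"
      using dpb' c pos by (intro mult_left_mono) auto
    also have "\<dots> = c * (2 * c + 1)" using pos by simp
    finally have "QM \<le> c * (2 * c + 1) * norm M" by (simp add: mult_right_mono)
    then show ?thesis unfolding r2 using X_pos[OF z] by (intro mult_left_mono) auto
  qed
  \<comment> \<open>Ellipticity is used twice: on the rows of \<open>M\<close>, which yields the sum
    of the squared norms of \<open>M *v q k\<close>, and then on these vectors.\<close>
  have i6: "r\<^sup>2 * ((norm M)\<^sup>2 / c\<^sup>2) \<le> X z * (\<Sum>k\<in>UNIV. (M *v q k) \<bullet> (Pz *v (M *v q k)))"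
  proof -
    have "(norm M)\<^sup>2 / c = (\<Sum>i\<in>UNIV. 1 / c * (norm (M $ i))\<^sup>2)"
      unfolding power2_norm_eq_inner inner_vec_def[of M] by (simp add: sum_divide_distrib)
    also have "\<dots> \<le> (\<Sum>i\<in>UNIV. M $ i \<bullet> (Pz *v (M $ i)))" unfolding Pz_def by (intro sum_mono P_lower)
    also have "\<dots> = (\<Sum>i\<in>UNIV. \<Sum>k\<in>UNIV. (M $ i \<bullet> q k)\<^sup>2)"
      unfolding Pz_def decomposition_inner[OF q] power2_eq_square ..
    also have "\<dots> = (\<Sum>k\<in>UNIV. \<Sum>i\<in>UNIV. (M $ i \<bullet> q k)\<^sup>2)" by (rule sum.swap)
    also have "\<dots> = (\<Sum>k\<in>UNIV. (norm (M *v q k))\<^sup>2)"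
      unfolding power2_norm_eq_inner by (simp add: inner_vec_def matrix_vector_mult_def power2_eq_square)
    finally have "(norm M)\<^sup>2 / c / c \<le> (\<Sum>k\<in>UNIV. (norm (M *v q k))\<^sup>2) / c" using c by (intro divide_right_mono) auto
    also have "\<dots> = (\<Sum>k\<in>UNIV. 1 / c * (norm (M *v q k))\<^sup>2)" by (simp add: sum_divide_distrib)
    also have "\<dots> \<le> (\<Sum>k\<in>UNIV. (M *v q k) \<bullet> (Pz *v (M *v q k)))" unfolding Pz_def by (intro sum_mono P_lower)
    finally have "(norm M)\<^sup>2 / c\<^sup>2 \<le> (\<Sum>k\<in>UNIV. (M *v q k) \<bullet> (Pz *v (M *v q k)))"
      by (simp add: power2_eq_square)
    then show ?thesis unfolding r2 using X_pos[OF z] by (intro mult_left_mono) auto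
  qed
  have i7: "- (r\<^sup>2 * (2 * c * N)) \<le> X z * (\<Sum>k\<in>UNIV. q k \<bullet> (Zz *v q k))"
  proof -
    have "N * norm Zz \<le> N * (2 * c)" unfolding Zz_def using N by (intro mult_left_mono Z_bound)
    then have "- (2 * c * N) \<le> (\<Sum>k\<in>UNIV. q k \<bullet> (Zz *v q k))" using AN[of Zz] by (simp add: mult_ac)
    then have "X z * - (2 * c * N) \<le> X z * (\<Sum>k\<in>UNIV. q k \<bullet> (Zz *v q k))"
      using X_pos[OF z] by (intro mult_left_mono) auto
    then show ?thesis unfolding r2 by simp
  qed
  have i8: "l * r\<^sup>2 * ((norm (p z))\<^sup>2 / c) \<le> l * X z * (p z \<bullet> (Pz *v p z))"
    unfolding r2 using P_lower[of "p z" "p z"] l_pos X_pos[OF z] by (intro mult_left_mono) (auto simp: Pz_def)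
  have i9: "l * v * (y \<bullet> V (p z)) \<le> l * \<bar>v\<bar> * (2 * c * (c * (1 + norm (p z))))"
  proof -
    have "\<bar>y \<bullet> V (p z)\<bar> \<le> norm y * norm (V (p z))" by (rule Cauchy_Schwarz_ineq2)
    also have "\<dots> \<le> 2 * c * (c * (1 + norm (p z)))" using y2 V_bound[of "p z"] c by (intro mult_mono) auto
    finally have "l * \<bar>v\<bar> * \<bar>y \<bullet> V (p z)\<bar> \<le> l * \<bar>v\<bar> * (2 * c * (c * (1 + norm (p z))))"
      using l_pos by (intro mult_left_mono) auto
    then show ?thesis using l_pos abs_ge_self[of "l * v * (y \<bullet> V (p z))"] by (simp add: abs_mult)
  qed
  show ?thesis
  proof (rule bernstein_algebra[OF c k(1) N B v norm_ge_zero norm_ge_zero r0 norm_ge_zero])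
    show "l = 1 / (8 * (1 + B)\<^sup>2 * k ^ 8)" by (simp add: l_def)
    show "(norm q0)\<^sup>2 / c - 2 * N * norm q0 * (l * \<bar>v\<bar> * norm (p z)) - 2 * c * N * (l * \<bar>v\<bar> * norm (p z))
      - 2 * B * r * (l * \<bar>v\<bar> * \<bar>D\<bar>) * (N * norm M)
      + r\<^sup>2 * ((norm M)\<^sup>2 / c\<^sup>2) - r\<^sup>2 * (c * (2 * c + 1) * norm M) - r\<^sup>2 * (2 * c * N) + l * D\<^sup>2
      + l * r\<^sup>2 * ((norm (p z))\<^sup>2 / c) - l * \<bar>v\<bar> * (2 * c * (c * (1 + norm (p z)))) \<le> 0"
      using main i1 i2 i3 i4 i5 i6 i7 i8 i9 by linarith
    assume "16 * k\<^sup>2 \<le> (norm (p z))\<^sup>2"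
    from penalty_transport[OF w this] show "(norm (p z))\<^sup>2 / (2 * c) \<le> \<bar>D\<bar>" unfolding D_def by linarith
  qed
qed

text \<open>
  The maximum of \<open>\<Phi>\<close> lies where \<open>w\<close> is bounded below: \<open>u\<^sub>t = \<Phi> - w - \<rho>\<close>, with \<open>\<rho>\<close> the penalty, is largest
  on the boundary, where \<open>w\<close> is bounded below, so \<open>u\<^sub>t \<le> max \<Phi> + k - 1\<close> everywhere.
\<close>

lemma gradient_bound:
  assumes z: "z \<in> slab"
  shows "(norm (p z))\<^sup>2 \<le> 12 * k\<^sup>2 * (2000 * (1 + B) ^ 4 * k ^ 24)"
    and "\<bar>U1 z (0, 1)\<bar> \<le> 20 * k ^ 3 * (2000 * (1 + B) ^ 4 * k ^ 24)"
proof -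
  define R where "R = 2000 * (1 + B) ^ 4 * k ^ 24"
  have "1 * 1 \<le> (1 + B) ^ 4 * k ^ 24" using B k1 by (intro mult_mono one_le_power) auto
  then have R1: "1 \<le> R" unfolding R_def by simp
  have "(1 + B) ^ 1 * 1 \<le> (1 + B) ^ 4 * k ^ 24" using B k1 by (intro mult_mono one_le_power power_increasing) auto
  then have RB: "B \<le> R" using B unfolding R_def by simp
  have time_deriv: "U1 y (0, 1) = \<Phi> y - l * (ut y)\<^sup>2 / 2 - w y" for y
    unfolding \<Phi>_def w_def by simp
  obtain z0 where z0: "z0 \<in> slab" "\<And>y. y \<in> slab \<Longrightarrow> \<Phi> y \<le> \<Phi> z0"
  proof (rule periodic_attains_max[of "{0..T}" \<Phi>])
    show "continuous_on slab \<Phi>" by (rule has_derivative_continuous_on) (rule \<Phi>_deriv)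
    show "torus_fun (\<lambda>x. \<Phi> (x, t))" if "t \<in> {0..T}" for t
      using u_periodic[OF that] p_periodic[OF that] W_periodic by (simp add: torus_fun_def \<Phi>_def ut_def)
  qed (use T in auto)
  obtain x1 t1 where t1: "t1 \<in> {0, T}"
    and max1: "\<And>y. y \<in> slab \<Longrightarrow> 1 * U1 y (0, 1) \<le> 1 * U1 (x1, t1) (0, 1)"
    by (rule time_derivative_max_at_boundary[OF disjI1[OF refl]]; blast)
  have s1: "(x1, t1) \<in> slab" using t1 T by auto
  have "U1 z0 (0, 1) \<le> U1 (x1, t1) (0, 1)" using max1[OF z0(1)] by simp
  then have w0: "- k \<le> w z0"
    using z0(2)[OF s1] w_lower[OF t1, of x1] penalty_bound[OF s1] penalty_bound[OF z0(1)]
    unfolding time_deriv by linarith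
  have "(norm (p z0))\<^sup>2 \<le> R"
  proof -
    obtain x t where xt: "z0 = (x, t)" by (cases z0)
    consider "t = 0" | "t = T" | "z0 \<in> open_slab" using z0(1) xt by fastforce
    then show ?thesis
    proof cases
      case 1
      then show ?thesis using bernstein_initial[of x] z0(2) xt unfolding R_def by simp
    next
      case 2
      then show ?thesis using bernstein_terminal[of x] z0(2) xt unfolding R_def by simp
    next
      case 3
      then show ?thesis using bernstein_interior[OF 3 z0(2) w0] unfolding R_def by simp
    qed
  qed
  then have "c * (norm (p z0))\<^sup>2 \<le> c * R" using c by (intro mult_left_mono) auto
  also have "\<dots> \<le> k * R" using k R1 by (intro mult_right_mono) auto
  finally have \<Phi>0: "\<Phi> z0 \<le> k * R + 5 * k + 1"
    using Hh_upper[of "p z0"] W_bound[of "fst z0"] penalty_bound[OF z0(1)] k unfolding \<Phi>_def by linarith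
  have kR: "k \<le> k * R" using R1 k1 by simp
  \<comment> \<open>The gradient bound at the maximum point bounds \<open>\<Phi>\<close> everywhere,
    and the quadratic lower bound on \<open>Hh\<close> turns this back into a bound on
    \<open>p\<close>.\<close>
  have p_bound: "(norm (p y))\<^sup>2 \<le> 12 * k\<^sup>2 * R" if y: "y \<in> slab" for y
  proof -
    have "1 / c * (norm (p y))\<^sup>2 \<le> k * R + 10 * k + 1"
      using z0(2)[OF y] \<Phi>0 Hh_lower[of "p y"] W_bound[of "fst y"] penalty_bound[OF y] k unfolding \<Phi>_def by linarith
    also have "\<dots> \<le> 12 * (k * R)" using kR k1 by linarith
    finally have "(norm (p y))\<^sup>2 \<le> c * (12 * (k * R))" using c by (simp add: field_simps)
    also have "\<dots> \<le> k * (12 * (k * R))" using k k1 R1 by (intro mult_right_mono) auto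
    finally show ?thesis by (simp add: power2_eq_square mult_ac)
  qed
  then show "(norm (p z))\<^sup>2 \<le> 12 * k\<^sup>2 * (2000 * (1 + B) ^ 4 * k ^ 24)" using z unfolding R_def by blast
  \<comment> \<open>On the boundary \<open>w\<close> is bounded on both sides, so the definition of
    \<open>w\<close> bounds the time derivative there; the maximum principle with both signs extends
    this to the slab.\<close>
  have bd: "\<bar>U1 (x, t) (0, 1)\<bar> \<le> 20 * k ^ 3 * R" if t: "t \<in> {0, T}" for x t
  proof -
    define y where "y = (x, t)"
    have ys: "y \<in> slab" using t T by (auto simp: y_def)
    have "c * (norm (p y))\<^sup>2 \<le> k * (12 * k\<^sup>2 * R)" using p_bound[OF ys] c k by (intro mult_mono) auto
    also have "\<dots> = 12 * (k ^ 3 * R)" by (simp add: eval_nat_numeral)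
    finally have 1: "c * (norm (p y))\<^sup>2 \<le> 12 * (k ^ 3 * R)" .
    have "1 / c * (norm (p y))\<^sup>2 \<ge> 0" "0 \<le> k ^ 3 * R" using c k1 R1 by simp_all
    then have "\<bar>Hh (p y)\<bar> \<le> 12 * (k ^ 3 * R) + k"
      using Hh_upper[of "p y"] Hh_lower[of "p y"] 1 k R1 k1 unfolding abs_le_iff by linarith
    moreover have "U1 y (0, 1) = Hh (p y) + W (fst y) - w y" unfolding w_def by simp
    ultimately have "\<bar>U1 y (0, 1)\<bar> \<le> 12 * (k ^ 3 * R) + 6 * k + B"
      using W_bound[of "fst y"] w_lower[OF t, of x] w_upper[OF t, of x] k B k1
      unfolding y_def[symmetric] by linarith
    moreover have "k ^ 1 * 1 \<le> k ^ 3 * R" using k1 R1 by (intro mult_mono power_increasing) auto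
    moreover have "1 * R \<le> k ^ 3 * R" using k1 R1 by (intro mult_right_mono one_le_power) auto
    ultimately show ?thesis using RB unfolding y_def by simp
  qed
  have max: "\<sigma> * U1 z (0, 1) \<le> 20 * k ^ 3 * R" if \<sigma>: "\<sigma> = 1 \<or> \<sigma> = -1" for \<sigma>
  proof -
    obtain x t where t: "t \<in> {0, T}" and m: "\<And>y. y \<in> slab \<Longrightarrow> \<sigma> * U1 y (0, 1) \<le> \<sigma> * U1 (x, t) (0, 1)"
      by (rule time_derivative_max_at_boundary[OF \<sigma>]; blast)
    show ?thesis using m[OF z] bd[OF t, of x] \<sigma> by auto
  qed
  from max[of 1] max[of "-1"] show "\<bar>U1 z (0, 1)\<bar> \<le> 20 * k ^ 3 * (2000 * (1 + B) ^ 4 * k ^ 24)"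
    unfolding R_def by auto
qed

end

section \<open>Gradients, slices and periodicity\<close>

lemma has_derivative_vec_nth:
  fixes f :: "'a::real_normed_vector \<Rightarrow> 'b::euclidean_space ^ 'd"
  assumes "\<And>i. ((\<lambda>x. f x $ i) has_derivative (\<lambda>h. f' h $ i)) (at x within S)"
  shows "(f has_derivative f') (at x within S)"
proof (subst has_derivative_componentwise_within, intro ballI)
  fix b :: "'b ^ 'd" assume "b \<in> Basis"
  then obtain i e where b: "b = axis i e" "e \<in> Basis" by (auto simp: Basis_vec_def)
  have "((\<lambda>x. f x $ i \<bullet> e) has_derivative (\<lambda>h. f' h $ i \<bullet> e)) (at x within S)"
    by (rule has_derivative_inner_left[OF assms])
  then show "((\<lambda>x. f x \<bullet> b) has_derivative (\<lambda>h. f' h \<bullet> b)) (at x within S)"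
    by (simp add: b inner_axis)
qed

lemma grad_nth:
  assumes "(F has_derivative F') (at x)"
  shows "grad F x $ i = F' (axis i 1)"
  unfolding grad_def using frechet_derivative_at[OF assms] by simp

lemma linear_axis_expansion:
  fixes L :: "real ^ 'd \<Rightarrow> 'b::real_normed_vector"
  assumes "linear L"
  shows "L v = (\<Sum>i\<in>UNIV. v $ i *\<^sub>R L (axis i 1))"
proof -
  have v: "v = (\<Sum>i\<in>UNIV. v $ i *\<^sub>R axis i 1)"
    by (simp add: vec_eq_iff axis_def if_distrib cong: if_cong)
  show ?thesis by (subst v) (simp add: linear_sum[OF assms] linear_scale[OF assms])
qed

lemma has_derivative_grad:
  fixes F :: "real ^ 'd \<Rightarrow> 'b::real_normed_vector"
  assumes "F differentiable at x"
  shows "(F has_derivative (\<lambda>v. \<Sum>i\<in>UNIV. v $ i *\<^sub>R grad F x $ i)) (at x)"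
proof -
  from assms obtain F' where F': "(F has_derivative F') (at x)" unfolding differentiable_def ..
  have "F' v = (\<Sum>i\<in>UNIV. v $ i *\<^sub>R grad F x $ i)" for v
    unfolding grad_nth[OF F'] by (rule linear_axis_expansion[OF has_derivative_linear[OF F']])
  then have "F' = (\<lambda>v. \<Sum>i\<in>UNIV. v $ i *\<^sub>R grad F x $ i)" by (rule ext)
  with F' show ?thesis by simp
qed

lemma has_derivative_grad_real:
  fixes F :: "real ^ 'd \<Rightarrow> real"
  assumes "F differentiable at x"
  shows "(F has_derivative (\<lambda>v. grad F x \<bullet> v)) (at x)"
  using has_derivative_grad[OF assms] by (simp add: inner_vec_def mult.commute)

lemma norm_sum_scaleR_le:
  fixes A :: "'b::real_normed_vector ^ 'd"
  shows "norm (\<Sum>i\<in>UNIV. v $ i *\<^sub>R A $ i) \<le> norm A * norm (v :: real ^ 'd)"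
proof -
  have "norm (\<Sum>i\<in>UNIV. v $ i *\<^sub>R A $ i) \<le> (\<Sum>i\<in>UNIV. \<bar>norm (A $ i)\<bar> * \<bar>v $ i\<bar>)"
    by (rule order_trans[OF norm_sum]) (simp add: mult.commute)
  also have "\<dots> \<le> L2_set (\<lambda>i. norm (A $ i)) UNIV * L2_set (\<lambda>i. v $ i) UNIV"
    by (rule L2_set_mult_ineq)
  also have "\<dots> = norm A * norm v" by (simp add: norm_vec_def L2_set_def)
  finally show ?thesis .
qed

text \<open>Shifting the argument and differentiating gives a second derivative of the same
  function. Derivatives are unique at interior points, and continuity extends the equality to
  \<open>S\<close>.\<close>

lemma derivative_shift_invariant:
  fixes g :: "'a::euclidean_space \<Rightarrow> real"
  assumes S: "S \<subseteq> closure (interior S)" "\<And>z. z \<in> S \<Longrightarrow> z + e \<in> S"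
    and g: "\<And>z. z \<in> S \<Longrightarrow> g (z + e) = g z" "\<And>z. z \<in> S \<Longrightarrow> (g has_derivative G z) (at z within S)"
    and cont: "\<And>a. continuous_on S (\<lambda>z. G z a)" and z: "z \<in> S"
  shows "G (z + e) a = G z a"
proof -
  have int: "G (y + e) a - G y a = 0" if y: "y \<in> interior S" for y
  proof -
    have yS: "y \<in> S" using y interior_subset by blast
    have "((\<lambda>y. g (y + e)) has_derivative (\<lambda>h. G (y + e) h)) (at y within S)"
    proof (rule has_derivative_in_compose[where f = "\<lambda>y. y + e" and f' = "\<lambda>h. h"])
      show "((\<lambda>y. y + e) has_derivative (\<lambda>h. h)) (at y within S)" by (auto intro!: derivative_eq_intros)
      show "(g has_derivative G (y + e)) (at (y + e) within (\<lambda>y. y + e) ` S)"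
        by (rule has_derivative_subset[OF g(2)[OF S(2)[OF yS]]]) (use S(2) in blast)
    qed
    then have "(g has_derivative G (y + e)) (at y within S)"
      by (rule has_derivative_transform[OF yS, rotated]) (simp add: g(1))
    then have "(g has_derivative G (y + e)) (at y)" "(g has_derivative G y) (at y)"
      using g(2)[OF yS] unfolding at_within_interior[OF y] by simp_all
    then have "G (y + e) = G y" by (rule has_derivative_unique)
    then show ?thesis by simp
  qed
  have "continuous_on S (\<lambda>y. G (y + e) a)"
    by (rule continuous_on_compose2[OF cont[of a], where f = "\<lambda>y. y + e"])
      (use S(2) in \<open>auto intro!: continuous_intros\<close>)
  then have c: "continuous_on S (\<lambda>y. G (y + e) a - G y a)" by (intro continuous_on_diff cont)
  have "z \<in> closure (interior S)" using z S(1) by blast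
  then obtain x where x: "\<And>n::nat. x n \<in> interior S" "x \<longlonglongrightarrow> z" unfolding closure_sequential by blast
  have "x n \<in> S" for n using x(1) interior_subset by blast
  then have "(\<lambda>n. G (x n + e) a - G (x n) a) \<longlonglongrightarrow> G (z + e) a - G z a"
    using continuous_on_tendsto_compose[OF c x(2) z] by simp
  then have "(\<lambda>n. 0) \<longlonglongrightarrow> G (z + e) a - G z a" by (simp add: int x(1))
  from LIMSEQ_unique[OF this tendsto_const] show ?thesis by simp
qed

context C3_function
begin

lemma shift_invariant:
  assumes e: "\<And>z. z \<in> S \<Longrightarrow> z + e \<in> S" and u: "\<And>z. z \<in> S \<Longrightarrow> u (z + e) = u z" and z: "z \<in> S"
  shows "U1 (z + e) a = U1 z a" "U2 (z + e) a b = U2 z a b"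
proof -
  have 1: "U1 (y + e) a = U1 y a" if "y \<in> S" for y a
    by (rule derivative_shift_invariant[OF closure e u deriv1 cont1 that])
  show "U1 (z + e) a = U1 z a" by (rule 1[OF z])
  show "U2 (z + e) a b = U2 z a b"
    by (rule derivative_shift_invariant[where g = "\<lambda>z. U1 z a", OF closure e 1 deriv2 cont2 z])
qed

end

lemma C3_function_torus:
  fixes u :: "(real ^ 'd) \<times> real \<Rightarrow> real"
  assumes "C3_function (UNIV \<times> J) u U1 U2 U3" and u: "\<And>t. t \<in> J \<Longrightarrow> torus_fun (\<lambda>x. u (x, t))" and t: "t \<in> J"
  shows "torus_fun (\<lambda>x. U1 (x, t) a)" "torus_fun (\<lambda>x. U2 (x, t) a b)"
proof -
  interpret C3_function "UNIV \<times> J" u U1 U2 U3 by (rule assms(1))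
  have "U1 ((x, t) + (v, 0)) a = U1 (x, t) a \<and> U2 ((x, t) + (v, 0)) a b = U2 (x, t) a b"
    if v: "\<forall>i. v $ i \<in> \<int>" for x v
  proof -
    have e: "z + (v, 0) \<in> UNIV \<times> J" if "z \<in> UNIV \<times> J" for z using that by auto
    have u': "u (z + (v, 0)) = u z" if "z \<in> UNIV \<times> J" for z
      using u[of "snd z"] that v unfolding torus_fun_def by (cases z) auto
    have "(x, t) \<in> UNIV \<times> J" using t by simp
    from shift_invariant[OF e u' this] show ?thesis by simp
  qed
  then show "torus_fun (\<lambda>x. U1 (x, t) a)" "torus_fun (\<lambda>x. U2 (x, t) a b)"
    unfolding torus_fun_def by simp_all
qed

text \<open>Used with \<open>J = {0<..}\<close> for the couplings and \<open>J = UNIV\<close> for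
  the Hamiltonian. Openness of \<open>J\<close> makes every point interior, so slices in either
  variable have ordinary derivatives.\<close>

locale C3_product = C3_function "(UNIV :: (real ^ 'd) set) \<times> J" u U1 U2 U3
  for J :: "'c::euclidean_space set" and u U1 U2 U3 +
  assumes open_J: "open J"
begin

lemma product_interior: "interior (UNIV \<times> J) = UNIV \<times> J"
  by (rule interior_open) (simp add: open_J open_Times)

lemma slice_deriv:
  assumes "s \<in> J"
  shows "((\<lambda>y. u (y, s)) has_derivative (\<lambda>v. U1 (x, s) (v, 0))) (at x)"
    "((\<lambda>y. U1 (y, s) a) has_derivative (\<lambda>v. U2 (x, s) a (v, 0))) (at x)"
proof -
  have P: "((\<lambda>y. (y, s)) has_derivative (\<lambda>v. (v, 0))) (at x)"
    by (intro has_derivative_Pair has_derivative_ident has_derivative_const)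
  show "((\<lambda>y. u (y, s)) has_derivative (\<lambda>v. U1 (x, s) (v, 0))) (at x)"
    by (rule has_derivative_compose[OF P]) (rule interior_derivs(1), simp add: product_interior assms)
  show "((\<lambda>y. U1 (y, s) a) has_derivative (\<lambda>v. U2 (x, s) a (v, 0))) (at x)"
    by (rule has_derivative_compose[OF P]) (rule interior_derivs(2), simp add: product_interior assms)
qed

lemma slice_differentiable:
  assumes "s \<in> J"
  shows "(\<lambda>y. u (y, s)) differentiable at x"
  by (rule differentiableI) (rule slice_deriv(1)[OF assms])

lemma slice_grad:
  assumes "s \<in> J"
  shows "grad (\<lambda>y. u (y, s)) x = (\<chi> i. U1 (x, s) (axis i 1, 0))"
  using grad_nth[OF slice_deriv(1)[OF assms]] by (simp add: vec_eq_iff)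

lemma slice_grad_deriv:
  assumes "s \<in> J"
  shows "(grad (\<lambda>y. u (y, s)) has_derivative (\<lambda>v. \<chi> i. U2 (x, s) (axis i 1, 0) (v, 0))) (at x)"
  by (rule has_derivative_vec_nth) (simp add: slice_grad[OF assms] slice_deriv[OF assms])

lemma slice_hessian:
  assumes "s \<in> J"
  shows "grad (grad (\<lambda>y. u (y, s))) x = (\<chi> i j. U2 (x, s) (axis i 1, 0) (axis j 1, 0))"
proof -
  have "grad (grad (\<lambda>y. u (y, s))) x $ i $ j = U2 (x, s) (axis i 1, 0) (axis j 1, 0)" for i j
    unfolding grad_nth[OF slice_grad_deriv[OF assms]]
    using sym2[of "(x, s)" "(axis i 1, 0)" "(axis j 1, 0)"] assms by simp
  then show ?thesis by (simp add: vec_eq_iff)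
qed

lemma slice_grad_deriv_hessian:
  assumes "s \<in> J"
  shows "(grad (\<lambda>y. u (y, s)) has_derivative (\<lambda>v. grad (grad (\<lambda>y. u (y, s))) x *v v)) (at x)"
proof -
  have lin: "linear (\<lambda>v. U2 (x, s) a (v, 0))" for a
    by (rule has_derivative_linear[OF slice_deriv(2)[OF assms]])
  have expand: "U2 (x, s) a (v, 0) = (\<Sum>j\<in>UNIV. U2 (x, s) a (axis j 1, 0) * v $ j)" for a v
    using linear_axis_expansion[OF lin[of a], of v] by (simp add: mult.commute)
  have "(\<chi> i. U2 (x, s) (axis i 1, 0) (v, 0)) = grad (grad (\<lambda>y. u (y, s))) x *v v" for v
    unfolding slice_hessian[OF assms] matrix_vector_mult_def by (simp add: vec_eq_iff expand[of _ v])
  then show ?thesis using slice_grad_deriv[OF assms, of x] by simp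
qed

end

lemma C3_product_obtain:
  fixes F :: "real ^ 'd \<Rightarrow> 'c::euclidean_space \<Rightarrow> real"
  assumes "Ck_on 4 (UNIV \<times> J) (\<lambda>(x, s). F x s)" "open J"
  obtains U1 U2 U3 where "C3_product J (\<lambda>(x, s). F x s) U1 U2 U3"
proof -
  have "Ck_on (Suc 3) (UNIV \<times> J) (\<lambda>(x, s). F x s)" using assms(1) by simp
  then have 3: "Ck_on 3 (UNIV \<times> J) (\<lambda>(x, s). F x s)" by (rule Ck_on_SucD)
  have "interior ((UNIV :: (real ^ 'd) set) \<times> J) = UNIV \<times> J"
    by (rule interior_open) (simp add: assms(2) open_Times)
  then have cl: "UNIV \<times> J \<subseteq> closure (interior ((UNIV :: (real ^ 'd) set) \<times> J))"
    by (simp add: closure_subset)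
  show thesis
  proof (rule Ck_on_3_obtain[OF 3 cl])
    fix U1 U2 U3 assume "C3_function (UNIV \<times> J) (\<lambda>(x, s). F x s) U1 U2 U3"
    then have "C3_product J (\<lambda>(x, s). F x s) U1 U2 U3"
      by (intro C3_product.intro C3_product_axioms.intro assms(2))
    then show thesis by (rule that)
  qed
qed

section \<open>Couplings\<close>

lemma periodic_SUP_attained:
  fixes r :: "real ^ 'd \<Rightarrow> real \<Rightarrow> real"
  assumes cont: "continuous_on (UNIV \<times> {0<..}) (\<lambda>(x, s). r x s)"
    and per: "\<And>s. 0 < s \<Longrightarrow> torus_fun (\<lambda>x. r x s)" and s: "0 < s"
  obtains x where "(SUP y. r y s) = r x s" "\<And>y. r y s \<le> r x s"
proof -
  obtain z where z: "z \<in> UNIV \<times> {s}" "\<And>y. y \<in> UNIV \<times> {s} \<Longrightarrow> (\<lambda>(x, s). r x s) y \<le> (\<lambda>(x, s). r x s) z"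
  proof (rule periodic_attains_max[of "{s}" "\<lambda>(x, s). r x s"])
    show "continuous_on (UNIV \<times> {s}) (\<lambda>(x, s). r x s)"
      by (rule continuous_on_subset[OF cont]) (use s in auto)
  qed (use per s in auto)
  obtain x where x: "z = (x, s)" using z(1) by auto
  have le: "r y s \<le> r x s" for y using z(2)[of "(y, s)"] x by simp
  then have "(SUP y. r y s) = r x s" by (intro cSup_eq_maximum) auto
  then show thesis using le that by blast
qed

text \<open>On a period cell times \<open>[t/2, 2t]\<close> the function is uniformly continuous.
  Its maxima over \<open>x\<close> at nearby times are compared by evaluating each slice at a
  maximizer of the other.\<close>

lemma periodic_SUP_continuous:
  fixes r :: "real ^ 'd \<Rightarrow> real \<Rightarrow> real"
  assumes cont: "continuous_on (UNIV \<times> {0<..}) (\<lambda>(x, s). r x s)"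
    and per: "\<And>s. 0 < s \<Longrightarrow> torus_fun (\<lambda>x. r x s)"
  shows "continuous_on {0<..} (\<lambda>s. SUP x. r x s)"
  unfolding continuous_on_iff
proof (intro ballI allI impI)
  fix t e :: real assume t: "t \<in> {0<..}" and e: "0 < e"
  let ?K = "(cbox 0 One :: (real ^ 'd) set) \<times> {t / 2..2 * t}"
  have "uniformly_continuous_on ?K (\<lambda>(x, s). r x s)"
  proof (rule compact_uniformly_continuous)
    show "continuous_on ?K (\<lambda>(x, s). r x s)" by (rule continuous_on_subset[OF cont]) (use t in auto)
    show "compact ?K" by (intro compact_Times compact_cbox compact_Icc)
  qed
  then obtain d where d: "0 < d"
    "\<And>z z'. z \<in> ?K \<Longrightarrow> z' \<in> ?K \<Longrightarrow> dist z' z < d \<Longrightarrow> dist ((\<lambda>(x, s). r x s) z') ((\<lambda>(x, s). r x s) z) < e"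
    unfolding uniformly_continuous_on_def using e by blast
  have near: "\<bar>r x s - r x t\<bar> < e" if s: "s \<in> {t / 2..2 * t}" "\<bar>s - t\<bar> < d" for x s
  proof -
    obtain v where v: "\<forall>i. v $ i \<in> \<int>" "x + v \<in> cbox 0 One" using torus_fun_representative by blast
    have "0 < s" using s t by auto
    then have "r (x + v) s = r x s" "r (x + v) t = r x t"
      using per[of s] per[of t] t v(1) unfolding torus_fun_def by auto
    moreover have "dist (r (x + v) s) (r (x + v) t) < e"
      using d(2)[of "(x + v, t)" "(x + v, s)"] v(2) s t by (simp add: dist_Pair_Pair dist_real_def)
    ultimately show ?thesis by (simp add: dist_real_def)
  qed
  show "\<exists>d>0. \<forall>s\<in>{0<..}. dist s t < d \<longrightarrow> dist (SUP x. r x s) (SUP x. r x t) < e"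
  proof (intro exI conjI ballI impI)
    show "0 < min d (t / 2)" using d t by auto
    fix s assume s0: "s \<in> {0<..}" and dist: "dist s t < min d (t / 2)"
    then have s: "s \<in> {t / 2..2 * t}" "\<bar>s - t\<bar> < d"
      by (auto simp: dist_real_def abs_if split: if_splits)
    obtain x where x: "(SUP y. r y s) = r x s" "\<And>y. r y s \<le> r x s"
      by (rule periodic_SUP_attained[OF cont per]) (use s0 in auto)
    obtain x' where x': "(SUP y. r y t) = r x' t" "\<And>y. r y t \<le> r x' t"
      by (rule periodic_SUP_attained[OF cont per]) (use t in auto)
    show "dist (SUP x. r x s) (SUP x. r x t) < e"
      unfolding x(1) x'(1) dist_real_def
      using near[OF s, of x] near[OF s, of x'] x(2)[of x'] x'(2)[of x] by linarith
  qed
qed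

lemma pos_inv_eq:
  assumes "inj_on \<phi> {0<..}" "0 < s" "\<phi> s = c"
  shows "pos_inv \<phi> c = s"
  using the_inv_into_f_f[OF assms(1), of s] assms(2,3) by simp

locale coupling_function =
  fixes g :: "real ^ 'd \<Rightarrow> real \<Rightarrow> ereal"
  assumes coupling: "coupling g"
begin

lemma value_eq: "0 < s \<Longrightarrow> g x s = ereal (rv g x s)"
  using coupling unfolding coupling_def rv_def by (cases "g x s") (auto dest: order_less_imp_le)

lemma strict: "0 \<le> s \<Longrightarrow> s < s' \<Longrightarrow> g x s < g x s'"
  using coupling unfolding coupling_def strict_mono_on_def by auto

lemma rv_strict: "0 < s \<Longrightarrow> s < s' \<Longrightarrow> rv g x s < rv g x s'"
  using strict[of s s' x] by (simp add: value_eq)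

lemma rv_mono: "0 < s \<Longrightarrow> s \<le> s' \<Longrightarrow> rv g x s \<le> rv g x s'"
  using rv_strict[of s s' x] by (cases "s = s'") auto

lemma Ck_rv: "Ck_on 4 (UNIV \<times> {0<..}) (\<lambda>(x, s). rv g x s)"
  using coupling unfolding coupling_def by blast

lemma rv_cont: "continuous_on (UNIV \<times> {0<..}) (\<lambda>(x, s). rv g x s)"
  by (rule Ck_on_continuous_on[OF Ck_rv])

lemma rv_periodic: "0 \<le> s \<Longrightarrow> torus_fun (\<lambda>x. rv g x s)"
  using coupling unfolding coupling_def torus_fun_def rv_def by auto

lemma rv_slice_cont: "0 < s \<Longrightarrow> continuous_on UNIV (\<lambda>x. rv g x s)"
proof -
  assume "0 < s"
  then have "continuous_on UNIV (\<lambda>x. (\<lambda>(x, s). rv g x s) (x, s))"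
    by (intro continuous_on_compose2[OF rv_cont]) (auto intro!: continuous_intros)
  then show ?thesis by simp
qed

lemma max_over_attained:
  assumes "0 < s" obtains x where "max_over g s = rv g x s" "\<And>y. rv g y s \<le> max_over g s"
proof (rule periodic_SUP_attained[OF rv_cont rv_periodic assms])
  fix x assume "(SUP y. rv g y s) = rv g x s" "\<And>y. rv g y s \<le> rv g x s"
  then show thesis using that[of x] unfolding max_over_def by simp
qed simp

lemma neg_rv_cont: "continuous_on (UNIV \<times> {0<..}) (\<lambda>(x, s). - rv g x s)"
  using continuous_on_minus[OF rv_cont] by (simp add: case_prod_beta')

lemma neg_rv_periodic: "0 < s \<Longrightarrow> torus_fun (\<lambda>x. - rv g x s)"
  using rv_periodic[of s] by (simp add: torus_fun_def)

lemma min_over_eq: "min_over g s = - (SUP x. - rv g x s)"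
  unfolding min_over_def Inf_real_def by (simp add: image_image)

lemma min_over_attained:
  assumes "0 < s" obtains x where "min_over g s = rv g x s" "\<And>y. min_over g s \<le> rv g y s"
proof (rule periodic_SUP_attained[OF neg_rv_cont neg_rv_periodic assms])
  fix x assume "(SUP y. - rv g y s) = - rv g x s" "\<And>y. - rv g y s \<le> - rv g x s"
  then show thesis using that[of x] unfolding min_over_eq by simp
qed simp

lemma max_over_strict: "0 < s \<Longrightarrow> s < t \<Longrightarrow> max_over g s < max_over g t"
  by (metis max_over_attained rv_strict order_less_le_trans order_less_trans)

lemma min_over_strict: "0 < s \<Longrightarrow> s < t \<Longrightarrow> min_over g s < min_over g t"
  by (metis min_over_attained rv_strict order_le_less_trans order_less_trans)

lemma max_over_cont: "continuous_on {0<..} (max_over g)"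
  using periodic_SUP_continuous[OF rv_cont rv_periodic] unfolding max_over_def[abs_def] by simp

lemma min_over_cont: "continuous_on {0<..} (min_over g)"
  using continuous_on_minus[OF periodic_SUP_continuous[OF neg_rv_cont neg_rv_periodic]]
  unfolding min_over_eq[abs_def] by simp

lemma max_over_inj: "inj_on (max_over g) {0<..}"
  by (rule strict_mono_on_imp_inj_on) (auto intro!: strict_mono_onI max_over_strict)

lemma min_over_inj: "inj_on (min_over g) {0<..}"
  by (rule strict_mono_on_imp_inj_on) (auto intro!: strict_mono_onI min_over_strict)

text \<open>The sets where the value at \<open>n + 1\<close> exceeds \<open>c\<close> are open,
  increase with \<open>n\<close> and cover the period cell, so compactness makes one
  \<open>n\<close> serve all \<open>x\<close>.\<close>

lemma uniformly_above:
  assumes "\<And>x. \<exists>s>0. c < rv g x s"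
  obtains s where "0 < s" "\<And>x. c < rv g x s"
proof -
  let ?A = "\<lambda>n::nat. {x. c < rv g x (real n + 1)}"
  have open_A: "open (?A n)" for n
    by (rule open_Collect_less) (auto intro!: continuous_intros rv_slice_cont)
  have cover: "(cbox 0 One :: (real ^ 'd) set) \<subseteq> (\<Union>n\<in>UNIV. ?A n)"
  proof
    fix x :: "real ^ 'd"
    obtain s where s: "s > 0" "c < rv g x s" using assms by blast
    obtain n :: nat where "s \<le> real n" using real_arch_simple by blast
    then have "rv g x s \<le> rv g x (real n + 1)" using s by (intro rv_mono) auto
    then show "x \<in> (\<Union>n\<in>UNIV. ?A n)" using s by (intro UN_I[of n]) auto
  qed
  obtain D where D: "finite D" "(cbox 0 One :: (real ^ 'd) set) \<subseteq> (\<Union>n\<in>D. ?A n)"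
    by (rule compactE_image[OF compact_cbox open_A cover]) blast
  define N where "N = real (Max (insert 0 D)) + 1"
  have N: "0 < N" unfolding N_def by simp
  have "c < rv g x N" for x
  proof -
    obtain v where v: "\<forall>i. v $ i \<in> \<int>" "x + v \<in> cbox 0 One" using torus_fun_representative by blast
    then obtain n where n: "n \<in> D" "c < rv g (x + v) (real n + 1)" using D by blast
    have "n \<le> Max (insert 0 D)" using n D by simp
    then have "rv g (x + v) (real n + 1) \<le> rv g (x + v) N" unfolding N_def by (intro rv_mono) auto
    moreover have "rv g (x + v) N = rv g x N" using rv_periodic[of N] N v(1) unfolding torus_fun_def by auto
    ultimately show ?thesis using n by simp
  qed
  with N that show thesis by blast
qed

lemma uniformly_below:
  assumes "\<And>x. \<exists>s>0. rv g x s < c"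
  obtains s where "0 < s" "\<And>x. rv g x s < c"
proof -
  let ?A = "\<lambda>n::nat. {x. rv g x (1 / (real n + 1)) < c}"
  have open_A: "open (?A n)" for n
    by (rule open_Collect_less) (auto intro!: continuous_intros rv_slice_cont)
  have cover: "(cbox 0 One :: (real ^ 'd) set) \<subseteq> (\<Union>n\<in>UNIV. ?A n)"
  proof
    fix x :: "real ^ 'd"
    obtain s where s: "s > 0" "rv g x s < c" using assms by blast
    obtain n :: nat where "1 / s \<le> real n" using real_arch_simple by blast
    then have "1 / (real n + 1) \<le> s" using s by (simp add: field_simps)
    then have "rv g x (1 / (real n + 1)) \<le> rv g x s" by (intro rv_mono) auto
    then show "x \<in> (\<Union>n\<in>UNIV. ?A n)" using s by (intro UN_I[of n]) auto
  qed
  obtain D where D: "finite D" "(cbox 0 One :: (real ^ 'd) set) \<subseteq> (\<Union>n\<in>D. ?A n)"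
    by (rule compactE_image[OF compact_cbox open_A cover]) blast
  define N where "N = 1 / (real (Max (insert 0 D)) + 1)"
  have N: "0 < N" unfolding N_def by simp
  have "rv g x N < c" for x
  proof -
    obtain v where v: "\<forall>i. v $ i \<in> \<int>" "x + v \<in> cbox 0 One" using torus_fun_representative by blast
    then obtain n where n: "n \<in> D" "rv g (x + v) (1 / (real n + 1)) < c" using D by blast
    have "n \<le> Max (insert 0 D)" using n D by simp
    then have "N \<le> 1 / (real n + 1)" unfolding N_def by (intro divide_left_mono) auto
    then have "rv g (x + v) N \<le> rv g (x + v) (1 / (real n + 1))" by (rule rv_mono[OF N])
    moreover have "rv g (x + v) N = rv g x N" using rv_periodic[of N] N v(1) unfolding torus_fun_def by auto
    ultimately show ?thesis using n by simp
  qed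
  with N that show thesis by blast
qed

lemma below_near_zero:
  assumes "g x 0 < ereal c"
  shows "\<exists>s>0. rv g x s < c"
proof -
  have "continuous_on (UNIV \<times> {0..}) (\<lambda>(x, s). g x s)" using coupling unfolding coupling_def by blast
  then have "continuous_on {0..} (\<lambda>s. (\<lambda>(x, s). g x s) (x, s))"
    by (rule continuous_on_compose2) (auto intro!: continuous_intros)
  then have "((\<lambda>s. g x s) \<longlongrightarrow> g x 0) (at 0 within {0..})"
    unfolding continuous_on_def by simp
  then have "eventually (\<lambda>s. g x s < ereal c) (at 0 within {0..})"
    using order_tendstoD(2)[of "g x" "g x 0" "at 0 within {0..}" "ereal c"] assms by simp
  then obtain d where d: "0 < d" "\<And>s. s \<in> {0..} \<Longrightarrow> s \<noteq> 0 \<Longrightarrow> dist s 0 < d \<Longrightarrow> g x s < ereal c"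
    unfolding eventually_at by auto
  have "g x (d / 2) < ereal c" using d by (intro d(2)) (auto simp: dist_real_def)
  then have "rv g x (d / 2) < c" using value_eq[of "d / 2" x] d by simp
  then show ?thesis using d by (intro exI[of _ "d / 2"]) auto
qed

text \<open>\<open>pos_inv\<close> has a meaning only at values that are attained; the intermediate
  value theorem supplies one between \<open>t\<close> and a uniform upper point. The last claim
  turns an upper bound for the coupling at a single point into an upper bound for the
  density.\<close>

lemma min_over_pos_inv:
  assumes above: "\<And>x. \<exists>s>0. c < rv g x s" and below: "0 < t" "rv g y t \<le> c"
  shows "0 < pos_inv (min_over g) c" "min_over g (pos_inv (min_over g) c) = c"
    "\<And>x s. 0 < s \<Longrightarrow> rv g x s \<le> c \<Longrightarrow> s \<le> pos_inv (min_over g) c"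
proof -
  obtain b where b: "0 < b" "\<And>x. c < rv g x b" using uniformly_above[OF above] by metis
  have 1: "min_over g t \<le> c" using min_over_attained[OF below(1)] below(2) by (metis order_trans)
  have 2: "c \<le> min_over g b" using min_over_attained[OF b(1)] b(2) by (metis less_imp_le)
  have tb: "t \<le> b"
    using rv_mono[OF b(1), of t y] b(2)[of y] below(2) by (cases "t \<le> b") auto
  have "continuous_on {t..b} (min_over g)" by (rule continuous_on_subset[OF min_over_cont]) (use below in auto)
  from IVT'[OF 1 2 tb this] obtain M where M: "t \<le> M" "min_over g M = c" by blast
  have M0: "0 < M" using M below by simp
  have eq: "pos_inv (min_over g) c = M" by (rule pos_inv_eq[OF min_over_inj M0 M(2)])
  show "0 < pos_inv (min_over g) c" "min_over g (pos_inv (min_over g) c) = c" unfolding eq by (fact M0, fact M(2))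
  show "s \<le> pos_inv (min_over g) c" if s: "0 < s" "rv g x s \<le> c" for x s
  proof (rule ccontr)
    assume "\<not> s \<le> pos_inv (min_over g) c"
    then have "c < min_over g s" using min_over_strict[OF M0, of s] M(2) unfolding eq by simp
    also have "\<dots> \<le> rv g x s" using min_over_attained[OF s(1)] by metis
    finally show False using s by simp
  qed
qed

lemma max_over_pos_inv:
  assumes below: "\<And>x. \<exists>s>0. rv g x s < c" and above: "0 < t" "c \<le> rv g y t"
  shows "0 < pos_inv (max_over g) c" "max_over g (pos_inv (max_over g) c) = c"
    "\<And>x s. 0 < s \<Longrightarrow> c \<le> rv g x s \<Longrightarrow> pos_inv (max_over g) c \<le> s"
proof -
  obtain b where b: "0 < b" "\<And>x. rv g x b < c" using uniformly_below[OF below] by metis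
  have 1: "max_over g b \<le> c" using max_over_attained[OF b(1)] b(2) by (metis less_imp_le)
  have 2: "c \<le> max_over g t" using max_over_attained[OF above(1)] above(2) by (metis order_trans)
  have tb: "b \<le> t"
    using rv_mono[OF above(1), of b y] b(2)[of y] above(2) by (cases "b \<le> t") auto
  have "continuous_on {b..t} (max_over g)" by (rule continuous_on_subset[OF max_over_cont]) (use b in auto)
  from IVT'[OF 1 2 tb this] obtain M where M: "b \<le> M" "max_over g M = c" by blast
  have M0: "0 < M" using M b by simp
  have eq: "pos_inv (max_over g) c = M" by (rule pos_inv_eq[OF max_over_inj M0 M(2)])
  show "0 < pos_inv (max_over g) c" "max_over g (pos_inv (max_over g) c) = c" unfolding eq by (fact M0, fact M(2))
  show "pos_inv (max_over g) c \<le> s" if s: "0 < s" "c \<le> rv g x s" for x s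
  proof (rule ccontr)
    assume "\<not> pos_inv (max_over g) c \<le> s"
    then have "max_over g s < c" using max_over_strict[OF s(1), of M] M(2) unfolding eq by simp
    moreover have "rv g x s \<le> max_over g s" using max_over_attained[OF s(1)] by metis
    ultimately show False using s by simp
  qed
qed

end

section \<open>Sup norms and their finiteness\<close>

lemma C0_norm_le: "(\<And>z. z \<in> S \<Longrightarrow> norm (F z) \<le> c) \<Longrightarrow> C0_norm S F \<le> ennreal c"
  unfolding C0_norm_def by (intro SUP_least ennreal_leI)

lemma norm_le_C0_norm: "z \<in> S \<Longrightarrow> ennreal (norm (F z)) \<le> C0_norm S F"
  unfolding C0_norm_def by (rule SUP_upper)

lemma le_enn2real:
  assumes "ennreal a \<le> b" "b < \<infinity>" "0 \<le> a"
  shows "a \<le> enn2real b"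
  using enn2real_mono[OF assms(1)] assms(2,3) by simp

lemma C0_norm_periodic_finite:
  fixes F :: "(real ^ 'd) \<times> real \<Rightarrow> 'b::real_normed_vector"
  assumes cont: "continuous_on (UNIV \<times> {a..b}) F" and per: "\<And>s. s \<in> {a..b} \<Longrightarrow> torus_fun (\<lambda>x. F (x, s))"
  shows "C0_norm (UNIV \<times> {a..b}) F < \<infinity>"
proof (cases "a \<le> b")
  case True
  obtain z where "\<And>y. y \<in> UNIV \<times> {a..b} \<Longrightarrow> norm (F y) \<le> norm (F z)"
  proof (rule periodic_attains_max[of "{a..b}" "\<lambda>z. norm (F z)"])
    show "continuous_on (UNIV \<times> {a..b}) (\<lambda>z. norm (F z))" by (rule continuous_on_norm[OF cont])
    show "torus_fun (\<lambda>x. norm (F (x, t)))" if "t \<in> {a..b}" for t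
      using per[OF that] by (simp add: torus_fun_def)
  qed (use True in auto)
  then have "C0_norm (UNIV \<times> {a..b}) F \<le> ennreal (norm (F z))" by (rule C0_norm_le)
  then show ?thesis by (rule order.strict_trans1) simp
next
  case False
  then show ?thesis by (simp add: C0_norm_def bot_ennreal)
qed

context C3_product
begin

lemma cont_on_J:
  shows "continuous_on (UNIV \<times> J) u" "continuous_on (UNIV \<times> J) (\<lambda>z. U1 z a)" "continuous_on (UNIV \<times> J) (\<lambda>z. U2 z a b)"
  by (fact cont0, fact cont1, fact cont2)

end

lemma (in C3_product) slice_second:
  assumes "s \<in> J"
  shows "((\<lambda>t. u (x, t)) has_derivative (\<lambda>h. U1 (x, s) (0, h))) (at s)"
    "((\<lambda>t. U1 (x, t) a) has_derivative (\<lambda>h. U2 (x, s) a (0, h))) (at s)"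
proof -
  have P: "((\<lambda>t. (x, t)) has_derivative (\<lambda>h. (0, h))) (at s)"
    by (intro has_derivative_Pair has_derivative_ident has_derivative_const)
  show "((\<lambda>t. u (x, t)) has_derivative (\<lambda>h. U1 (x, s) (0, h))) (at s)"
    by (rule has_derivative_compose[OF P]) (rule interior_derivs(1), simp add: product_interior assms)
  show "((\<lambda>t. U1 (x, t) a) has_derivative (\<lambda>h. U2 (x, s) a (0, h))) (at s)"
    by (rule has_derivative_compose[OF P]) (rule interior_derivs(2), simp add: product_interior assms)
qed

lemma linear_snd:
  fixes L :: "'a::real_vector \<times> real \<Rightarrow> 'b::real_vector"
  assumes "linear L" shows "L (0, h) = h *\<^sub>R L (0, 1)"
  using linear_scale[OF assms, of h "(0, 1)"] by simp

locale smooth_coupling = coupling_function g + C3_product "{0<..}" "\<lambda>(x, s). rv g x s" G1 G2 G3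
  for g :: "real ^ 'd \<Rightarrow> real \<Rightarrow> ereal" and G1 G2 G3
begin

lemma rv_deriv:
  assumes "0 < s"
  shows "(rv g x has_real_derivative G1 (x, s) (0, 1)) (at s)"
    "((\<lambda>t. G1 (x, t) a) has_real_derivative G2 (x, s) a (0, 1)) (at s)"
proof -
  have s: "s \<in> {0<..}" using assms by simp
  have 1: "G1 (x, s) (0, h) = G1 (x, s) (0, 1) * h" and 2: "G2 (x, s) a (0, h) = G2 (x, s) a (0, 1) * h" for h
    using linear_snd[OF lin1, of "(x, s)" h] linear_snd[OF lin2(2), of "(x, s)" a h] by (simp_all add: mult.commute)
  have "(\<lambda>h. G1 (x, s) (0, h)) = (*) (G1 (x, s) (0, 1))" by (rule ext) (rule 1)
  moreover have "(\<lambda>h. G2 (x, s) a (0, h)) = (*) (G2 (x, s) a (0, 1))" by (rule ext) (rule 2)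
  ultimately show "(rv g x has_real_derivative G1 (x, s) (0, 1)) (at s)"
    "((\<lambda>t. G1 (x, t) a) has_real_derivative G2 (x, s) a (0, 1)) (at s)"
    using slice_second(1)[OF s, of x] slice_second(2)[OF s, of x a] unfolding has_field_derivative_def by simp_all
qed

lemma D_m_rv: "0 < s \<Longrightarrow> D_m (rv g) x s = G1 (x, s) (0, 1)"
  unfolding D_m_def by (intro vector_derivative_at) (simp add: rv_deriv(1) has_real_derivative_iff_has_vector_derivative[symmetric])

lemma D_m_rv_pos:
  assumes "0 < s" shows "0 < G1 (x, s) (0, 1)"
proof -
  have "0 < D_m (rv g) x s" using coupling assms unfolding coupling_def by blast
  then show ?thesis by (simp add: D_m_rv assms)
qed

lemma D_x_rv: "0 < s \<Longrightarrow> D_x (rv g) x s = (\<chi> i. G1 (x, s) (axis i 1, 0))"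
  unfolding D_x_def using slice_grad[of s x] by simp

lemma D_m_D_x_rv: 
  assumes s: "0 < s"
  shows "D_m (D_x (rv g)) x s = (\<chi> i. G2 (x, s) (axis i 1, 0) (0, 1))"
proof -
  have "((\<lambda>t. \<chi> i. G1 (x, t) (axis i 1, 0)) has_derivative (\<lambda>h. h *\<^sub>R (\<chi> i. G2 (x, s) (axis i 1, 0) (0, 1)))) (at s)"
  proof (rule has_derivative_vec_nth)
    fix i
    show "((\<lambda>t. (\<chi> i. G1 (x, t) (axis i 1, 0)) $ i) has_derivative (\<lambda>h. (h *\<^sub>R (\<chi> i. G2 (x, s) (axis i 1, 0) (0, 1))) $ i)) (at s)"
      using rv_deriv(2)[OF s, of x "(axis i 1, 0)"] unfolding has_field_derivative_def by (simp add: mult_commute_abs)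
  qed
  then have "(D_x (rv g) x has_derivative (\<lambda>h. h *\<^sub>R (\<chi> i. G2 (x, s) (axis i 1, 0) (0, 1)))) (at s)"
    by (rule has_derivative_transform_within_open[where s = "{0<..}"]) (use s in \<open>auto simp: D_x_rv\<close>)
  then show ?thesis unfolding D_m_def by (intro vector_derivative_at) (simp add: has_vector_derivative_def)
qed

lemma D_x_D_x_rv: "0 < s \<Longrightarrow> D_x (D_x (rv g)) x s = (\<chi> i j. G2 (x, s) (axis i 1, 0) (axis j 1, 0))"
  unfolding D_x_def using slice_hessian[of s x] by simp

lemma G_periodic: "0 < s \<Longrightarrow> torus_fun (\<lambda>x. G1 (x, s) a)" "0 < s \<Longrightarrow> torus_fun (\<lambda>x. G2 (x, s) a b)"
proof -
  have 1: "C3_function (UNIV \<times> {0<..}) (\<lambda>(x, s). rv g x s) G1 G2 G3" by unfold_locales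
  have 2: "torus_fun (\<lambda>x. (\<lambda>(x, s). rv g x s) (x, s))" if "s \<in> {0<..}" for s
    using rv_periodic[of s] that by simp
  show "torus_fun (\<lambda>x. G1 (x, s) a)" "torus_fun (\<lambda>x. G2 (x, s) a b)" if "0 < s"
    using C3_function_torus[OF 1 2, of s] that by simp_all
qed

text \<open>Finiteness matters because \<open>enn2real\<close> sends infinity to 0: without it, a
  bound by \<open>enn2real (beta f g K)\<close> could not be extracted from the norms.\<close>

lemma C1_norms_finite:
  assumes a: "0 < a"
  shows "C1_norm (UNIV \<times> {a..b}) (rv g) < \<infinity>" "C1_norm (UNIV \<times> {a..b}) (D_x (rv g)) < \<infinity>"
proof -
  let ?S = "(UNIV :: (real ^ 'd) set) \<times> {a..b}"
  have sub: "?S \<subseteq> UNIV \<times> {0<..}" using a by auto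
  note c = continuous_on_subset[OF cont_on_J(1) sub] continuous_on_subset[OF cont_on_J(2) sub]
    continuous_on_subset[OF cont_on_J(3) sub]
  have 0: "C0_norm ?S (\<lambda>(x, s). rv g x s) < \<infinity>"
    by (rule C0_norm_periodic_finite[OF c(1)]) (use a rv_periodic in auto)
  have "C0_norm ?S (\<lambda>(x, s). D_xm (rv g) x s) = C0_norm ?S (\<lambda>z. ((\<chi> i. G1 z (axis i 1, 0)) :: real ^ 'd, G1 z (0, 1)))"
    unfolding C0_norm_def by (rule SUP_cong) (use a in \<open>auto simp: D_xm_def D_x_rv D_m_rv\<close>)
  also have "\<dots> < \<infinity>"
  proof (rule C0_norm_periodic_finite)
    show "continuous_on ?S (\<lambda>z. ((\<chi> i. G1 z (axis i 1, 0)) :: real ^ 'd, G1 z (0, 1)))"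
      by (intro continuous_on_Pair continuous_on_vec_lambda c)
    show "torus_fun (\<lambda>x. ((\<chi> i. G1 (x, s) (axis i 1, 0)) :: real ^ 'd, G1 (x, s) (0, 1)))" if "s \<in> {a..b}" for s
      using G_periodic(1)[of s] that a by (simp add: torus_fun_def)
  qed
  finally have 1: "C0_norm ?S (\<lambda>(x, s). D_xm (rv g) x s) < \<infinity>" .
  show "C1_norm ?S (rv g) < \<infinity>" unfolding C1_norm_def using 0 1 by (simp add: ennreal_add_eq_top less_top[symmetric])
  have "C0_norm ?S (\<lambda>(x, s). D_x (rv g) x s) = C0_norm ?S (\<lambda>z. (\<chi> i. G1 z (axis i 1, 0)) :: real ^ 'd)"
    unfolding C0_norm_def by (rule SUP_cong) (use a in \<open>auto simp: D_x_rv\<close>)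
  also have "\<dots> < \<infinity>"
  proof (rule C0_norm_periodic_finite)
    show "continuous_on ?S (\<lambda>z. (\<chi> i. G1 z (axis i 1, 0)) :: real ^ 'd)"
      by (intro continuous_on_vec_lambda c)
    show "torus_fun (\<lambda>x. (\<chi> i. G1 (x, s) (axis i 1, 0)) :: real ^ 'd)" if "s \<in> {a..b}" for s
      using G_periodic(1)[of s] that a by (simp add: torus_fun_def)
  qed
  finally have 2: "C0_norm ?S (\<lambda>(x, s). D_x (rv g) x s) < \<infinity>" .
  let ?D = "\<lambda>z. ((\<chi> i j. G2 z (axis i 1, 0) (axis j 1, 0)) :: real ^ 'd ^ 'd, (\<chi> i. G2 z (axis i 1, 0) (0, 1)) :: real ^ 'd)"
  have "C0_norm ?S (\<lambda>(x, s). D_xm (D_x (rv g)) x s) = C0_norm ?S ?D"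
    unfolding C0_norm_def by (rule SUP_cong) (use a in \<open>auto simp: D_xm_def D_x_D_x_rv D_m_D_x_rv\<close>)
  also have "\<dots> < \<infinity>"
  proof (rule C0_norm_periodic_finite)
    show "continuous_on ?S ?D" by (intro continuous_on_Pair continuous_on_vec_lambda c)
    show "torus_fun (\<lambda>x. ?D (x, s))" if "s \<in> {a..b}" for s
      using G_periodic(2)[of s] that a by (simp add: torus_fun_def)
  qed
  finally have 3: "C0_norm ?S (\<lambda>(x, s). D_xm (D_x (rv g)) x s) < \<infinity>" .
  show "C1_norm ?S (D_x (rv g)) < \<infinity>" unfolding C1_norm_def using 2 3 by (simp add: ennreal_add_eq_top less_top[symmetric])
qed

end

lemma smooth_coupling_obtain:
  assumes "coupling g"
  obtains G1 G2 G3 where "smooth_coupling g G1 G2 G3"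
proof -
  have "Ck_on 4 (UNIV \<times> {0<..}) (\<lambda>(x, s). rv g x s)" using assms unfolding coupling_def by blast
  then show thesis
  proof (rule C3_product_obtain)
    fix G1 G2 G3 assume "C3_product {0<..} (\<lambda>(x, s). rv g x s) G1 G2 G3"
    then have "smooth_coupling g G1 G2 G3"
      by (intro smooth_coupling.intro coupling_function.intro assms)
    then show thesis by (rule that)
  qed simp
qed

section \<open>Separable couplings\<close>

text \<open>The factor \<open>top\<close> imposes nothing on \<open>x\<close>, so limits along this
  filter are uniform in \<open>x\<close>.\<close>

lemma eventually_top_prod_at_top:
  fixes P :: "'a \<Rightarrow> real \<Rightarrow> bool"
  assumes "eventually (\<lambda>(x, s). P x s) (top \<times>\<^sub>F at_top)"
  obtains s0 where "\<And>x s. s0 \<le> s \<Longrightarrow> P x s"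
proof -
  from assms obtain Pf Pg where "eventually Pf (top :: 'a filter)" "eventually Pg (at_top :: real filter)"
    and *: "\<And>x s. Pf x \<Longrightarrow> Pg s \<Longrightarrow> P x s" unfolding eventually_prod_filter by auto
  then have "\<And>x. Pf x" "\<exists>s0. \<forall>s\<ge>s0. Pg s" by (auto simp: eventually_top eventually_at_top_linorder)
  then show thesis using * that by blast
qed

text \<open>\<open>\<phi>\<close> is the profile at the base point \<open>x = 0\<close>, and
  \<open>pot\<close> is the function \<open>B\<close> of the overview, read off at
  \<open>s = 1\<close>.\<close>

locale separable_coupling = smooth_coupling f F1 F2 F3
  for f :: "real ^ 'd \<Rightarrow> real \<Rightarrow> ereal" and F1 F2 F3 +
  fixes \<phi> \<phi>1 \<phi>2 :: "real \<Rightarrow> real" and pot :: "real ^ 'd \<Rightarrow> real"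
  defines "\<phi> \<equiv> rv f 0" and "\<phi>1 \<equiv> \<lambda>s. F1 (0, s) (0, 1)" and "\<phi>2 \<equiv> \<lambda>s. F2 (0, s) (0, 1) (0, 1)"
    and "pot \<equiv> \<lambda>x. rv f x 1 - rv f 0 1"
  assumes liminf: "Liminf (top \<times>\<^sub>F at_top) (\<lambda>(x, s). ereal (s * D_m (rv f) x s)) > 0"
    and SE: "\<And>x. f x 0 = - \<infinity>"
    and separable: "\<And>x s. 0 < s \<Longrightarrow> D_m (D_x (rv f)) x s = 0"
    and limsup: "Limsup (top \<times>\<^sub>F at_top) (\<lambda>(x, w). ereal \<bar>D_m (h_f f) x w\<bar>) < \<infinity>"
begin

lemma \<phi>_deriv: "0 < s \<Longrightarrow> (\<phi> has_real_derivative \<phi>1 s) (at s)" "0 < s \<Longrightarrow> (\<phi>1 has_real_derivative \<phi>2 s) (at s)"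
  unfolding \<phi>_def \<phi>1_def \<phi>2_def by (rule rv_deriv, assumption)+

lemma \<phi>1_pos: "0 < s \<Longrightarrow> 0 < \<phi>1 s"
  unfolding \<phi>1_def by (rule D_m_rv_pos)

text \<open>By symmetry of \<open>F2\<close> the vanishing of the mixed derivative says that the
  derivative in \<open>m\<close> has zero gradient in \<open>x\<close>.\<close>

lemma F1_eq:
  assumes s: "0 < s"
  shows "F1 (x, s) (0, 1) = \<phi>1 s"
proof -
  have sJ: "s \<in> {0<..}" using s by simp
  have "F2 (y, s) (0, 1) (v, 0) = 0" for y v
  proof -
    have "F2 (y, s) (axis i 1, 0) (0, 1) = 0" for i
      using separable[OF s, of y] unfolding D_m_D_x_rv[OF s] by (simp add: vec_eq_iff)
    then have "F2 (y, s) (0, 1) (axis i 1, 0) = 0" for i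
      using sym2[of "(y, s)" "(0, 1)" "(axis i 1, 0)"] s by simp
    then show ?thesis using linear_axis_sum[OF lin2(2)[of "(y, s)" "(0, 1)"], of v] by simp
  qed
  then have "((\<lambda>y. F1 (y, s) (0, 1)) has_derivative (\<lambda>v. 0)) (at y)" for y
    using slice_deriv(2)[OF sJ, where a = "(0, 1)" and x = y] by simp
  then obtain k where "\<And>y. F1 (y, s) (0, 1) = k"
    using has_derivative_zero_constant[of UNIV "\<lambda>y. F1 (y, s) (0, 1)"] by auto
  then show ?thesis unfolding \<phi>1_def by simp
qed

lemma rv_split:
  assumes s: "0 < s"
  shows "rv f x s = \<phi> s + pot x"
proof -
  have "((\<lambda>s. rv f x s - \<phi> s) has_derivative (\<lambda>h. 0)) (at s within {0<..})" if "s \<in> {0<..}" for s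
  proof -
    have "((\<lambda>s. rv f x s - \<phi> s) has_real_derivative F1 (x, s) (0, 1) - \<phi>1 s) (at s)"
      using that by (intro DERIV_diff rv_deriv \<phi>_deriv) auto
    then have "((\<lambda>s. rv f x s - \<phi> s) has_derivative (\<lambda>h. 0)) (at s)"
      using that by (simp add: F1_eq has_field_derivative_def lambda_zero)
    then show ?thesis by (rule has_derivative_at_withinI)
  qed
  then obtain k where k: "\<And>s. s \<in> {0<..} \<Longrightarrow> rv f x s - \<phi> s = k"
    using has_derivative_zero_constant[of "{0<..}" "\<lambda>s. rv f x s - \<phi> s"] by auto
  show ?thesis using k[of s] k[of 1] s unfolding pot_def \<phi>_def by simp
qed

lemma eventually_large_slope:
  obtains \<delta> s0 where "0 < \<delta>" "0 < s0" "\<And>s. s0 \<le> s \<Longrightarrow> \<delta> < s * \<phi>1 s"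
proof -
  obtain \<delta> where \<delta>: "0 < ereal \<delta>" "ereal \<delta> < Liminf (top \<times>\<^sub>F at_top) (\<lambda>(x, s). ereal (s * D_m (rv f) x s))"
    using ereal_dense2[OF liminf] by auto
  from less_LiminfD[OF \<delta>(2)] have "eventually (\<lambda>(x, s). \<delta> < s * D_m (rv f) x s) (top \<times>\<^sub>F at_top)"
    by (rule eventually_mono) auto
  then obtain s0 where s0: "\<And>x s. s0 \<le> s \<Longrightarrow> \<delta> < s * D_m (rv f) x s"
    by (rule eventually_top_prod_at_top) blast
  show thesis
  proof (rule that[of \<delta> "max s0 1"])
    show "\<delta> < s * \<phi>1 s" if "max s0 1 \<le> s" for s
      using s0[of s 0] that D_m_rv[of s 0] unfolding \<phi>1_def by simp
  qed (use \<delta> in auto)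
qed

text \<open>Since \<open>s * \<phi>1 s\<close> stays above some \<open>\<delta> > 0\<close>, the
  coupling grows at least like \<open>\<delta> * ln s\<close> and so exceeds every level.\<close>

lemma above: "\<exists>s>0. c < rv f x s"
proof -
  obtain \<delta> s0 where \<delta>: "0 < \<delta>" "0 < s0" "\<And>s. s0 \<le> s \<Longrightarrow> \<delta> < s * \<phi>1 s" by (rule eventually_large_slope) blast
  \<comment> \<open>Increasing \<open>ln s\<close> by \<open>d\<close> raises the coupling by at
    least the missing amount plus \<open>\<delta>\<close>.\<close>
  define d where "d = \<bar>c - rv f x s0\<bar> / \<delta> + 1"
  have d: "0 < d" using \<delta> unfolding d_def by (intro add_nonneg_pos) auto
  define s1 where "s1 = s0 * exp d"
  have s1: "s0 < s1" using d \<delta> by (simp add: s1_def)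
  define k where "k s = rv f x s - \<delta> * ln s" for s
  have "k s0 \<le> k s1"
  proof (rule DERIV_nonneg_imp_nondecreasing[of s0 s1 k])
    fix s assume s: "s0 \<le> s" "s \<le> s1"
    then have s0': "0 < s" using \<delta> by simp
    have "(k has_real_derivative F1 (x, s) (0, 1) - \<delta> * (1 / s)) (at s)"
      unfolding k_def using s0' by (auto intro!: derivative_eq_intros rv_deriv)
    moreover have "0 \<le> F1 (x, s) (0, 1) - \<delta> * (1 / s)"
      using \<delta>(3)[OF s(1)] s0' by (simp add: F1_eq field_simps)
    ultimately show "\<exists>y. (k has_real_derivative y) (at s) \<and> 0 \<le> y" by blast
  qed (use s1 in simp)
  moreover have "ln s1 = ln s0 + d" unfolding s1_def using \<delta> by (simp add: ln_mult)
  ultimately have "rv f x s0 + \<delta> * d \<le> rv f x s1" unfolding k_def by (simp add: algebra_simps)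
  moreover have "\<delta> * d = \<bar>c - rv f x s0\<bar> + \<delta>" unfolding d_def using \<delta> by (simp add: field_simps)
  ultimately have "c < rv f x s1" using \<delta> by linarith
  then show ?thesis using s1 \<delta> by (intro exI[of _ s1]) auto
qed

lemma below: "\<exists>s>0. rv f x s < c"
  by (rule below_near_zero) (simp add: SE)

lemma rv_value:
  obtains s where "0 < s" "rv f x s = w"
proof -
  obtain b where b: "0 < b" "w < rv f x b" using above by blast
  obtain a where a: "0 < a" "rv f x a < w" using below by blast
  have ab: "a \<le> b" using rv_mono[of b a x] a b by (cases "a \<le> b") auto
  have "continuous_on {a..b} (rv f x)"
    by (intro continuous_at_imp_continuous_on ballI DERIV_isCont[OF rv_deriv(1)]) (use a in auto)
  then obtain s where "a \<le> s" "rv f x s = w" using IVT'[of "rv f x" a w b] a b ab by auto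
  with a that[of s] show thesis by simp
qed

lemma f_inv_eq: "0 < s \<Longrightarrow> f_inv f x (rv f x s) = s"
proof -
  assume s: "0 < s"
  have "strict_mono_on {0..} (f x)" using coupling unfolding coupling_def by blast
  then have "inj_on (f x) {0..}" by (rule strict_mono_on_imp_inj_on)
  from the_inv_into_f_f[OF this, of s] show ?thesis
    using s value_eq[OF s, of x] by (simp add: f_inv_def)
qed

lemma f_inv_pos: "0 < f_inv f x w" and rv_f_inv: "rv f x (f_inv f x w) = w"
proof -
  obtain s where s: "0 < s" "rv f x s = w" by (rule rv_value)
  then have "f_inv f x w = s" using f_inv_eq by blast
  with s show "0 < f_inv f x w" "rv f x (f_inv f x w) = w" by simp_all
qed

lemma chi_eq: "0 < s \<Longrightarrow> chi_f f x (rv f x s) = s * \<phi>1 s"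
  unfolding chi_f_def by (simp add: f_inv_eq D_m_rv F1_eq)

lemma f_inv_deriv:
  assumes s: "0 < s"
  shows "(f_inv f x has_real_derivative 1 / \<phi>1 s) (at (rv f x s))"
proof -
  have c: "isCont (rv f x) y" if "0 < y" for y using rv_deriv(1)[OF that] DERIV_isCont by blast
  have "isCont (f_inv f x) (rv f x s)"
    by (rule isCont_inverse_function2[of "s / 2" s "2 * s"]) (use s c f_inv_eq in auto)
  moreover have "(rv f x has_real_derivative \<phi>1 s) (at (f_inv f x (rv f x s)))"
    using rv_deriv(1)[OF s, of x] by (simp add: f_inv_eq[OF s] F1_eq[OF s])
  ultimately have "(f_inv f x has_real_derivative inverse (\<phi>1 s)) (at (rv f x s))"
    using DERIV_inverse_function[where f = "rv f x" and g = "f_inv f x" and x = "rv f x s" and D = "\<phi>1 s"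
        and a = "rv f x s - 1" and b = "rv f x s + 1"]
      \<phi>1_pos[OF s] rv_f_inv by auto
  then show ?thesis by (simp add: inverse_eq_divide)
qed

text \<open>Expressed in the density, the derivative of \<open>h\<close> no longer depends on
  \<open>x\<close>. Multiplied by \<open>2 * sqrt (s * \<phi>1 s)\<close> it is the derivative of
  \<open>\<chi>\<close> in \<open>w\<close>, the coefficient \<open>X'\<close> of the elliptic
  equation.\<close>

lemma h_deriv:
  assumes s: "0 < s"
  shows "D_m (h_f f) x (rv f x s) = (\<phi>1 s + s * \<phi>2 s) / \<phi>1 s / (2 * sqrt (s * \<phi>1 s))"
proof -
  let ?w = "rv f x s"
  have h: "h_f f x w = sqrt (f_inv f x w * \<phi>1 (f_inv f x w))" for w
    unfolding h_f_def chi_f_def using D_m_rv[OF f_inv_pos] F1_eq[OF f_inv_pos] by simp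
  have d1: "((\<lambda>w. \<phi>1 (f_inv f x w)) has_real_derivative \<phi>2 s * (1 / \<phi>1 s)) (at ?w)"
    by (rule DERIV_chain2[OF _ f_inv_deriv[OF s]]) (simp add: f_inv_eq[OF s] \<phi>_deriv(2)[OF s])
  have d2: "((\<lambda>w. f_inv f x w * \<phi>1 (f_inv f x w)) has_real_derivative
      1 / \<phi>1 s * \<phi>1 s + \<phi>2 s * (1 / \<phi>1 s) * s) (at ?w)"
    using DERIV_mult[OF f_inv_deriv[OF s] d1] by (simp add: f_inv_eq[OF s])
  have "0 < s * \<phi>1 s" using s \<phi>1_pos[OF s] by simp
  then have d3: "(sqrt has_real_derivative inverse (sqrt (s * \<phi>1 s)) / 2) (at (f_inv f x ?w * \<phi>1 (f_inv f x ?w)))"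
    by (simp add: f_inv_eq[OF s] DERIV_real_sqrt)
  have "((\<lambda>w. sqrt (f_inv f x w * \<phi>1 (f_inv f x w))) has_real_derivative
      inverse (sqrt (s * \<phi>1 s)) / 2 * (1 / \<phi>1 s * \<phi>1 s + \<phi>2 s * (1 / \<phi>1 s) * s)) (at ?w)"
    by (rule DERIV_chain2[OF d3 d2])
  then have "(h_f f x has_real_derivative
      inverse (sqrt (s * \<phi>1 s)) / 2 * (1 / \<phi>1 s * \<phi>1 s + \<phi>2 s * (1 / \<phi>1 s) * s)) (at ?w)"
    unfolding h[abs_def] .
  then have "D_m (h_f f) x ?w = inverse (sqrt (s * \<phi>1 s)) / 2 * (1 / \<phi>1 s * \<phi>1 s + \<phi>2 s * (1 / \<phi>1 s) * s)"
    unfolding D_m_def by (intro vector_derivative_at) (simp add: has_real_derivative_iff_has_vector_derivative)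
  also have "\<dots> = (\<phi>1 s + s * \<phi>2 s) / \<phi>1 s / (2 * sqrt (s * \<phi>1 s))"
    using \<phi>1_pos[OF s] by (simp add: field_simps)
  finally show ?thesis .
qed

lemma \<phi>1_cont: "continuous_on {0<..} \<phi>1"
  by (intro continuous_at_imp_continuous_on ballI DERIV_isCont[OF \<phi>_deriv(2)]) auto

lemma \<phi>2_cont: "continuous_on {0<..} \<phi>2"
proof -
  have "continuous_on {0<..} (\<lambda>s. (\<lambda>z. F2 z (0, 1) (0, 1)) (0, s))"
    by (rule continuous_on_compose2[OF cont_on_J(3)]) (auto intro!: continuous_intros)
  then show ?thesis unfolding \<phi>2_def .
qed

text \<open>In the density variable the half line becomes \<open>s \<ge> a\<close> for a single
  \<open>a > 0\<close>. There \<open>G\<close> is bounded by continuity on a compact interval up to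
  \<open>start\<close>, and by assumption beyond it.\<close>

lemma C0_norm_half_line_finite:
  assumes eq: "\<And>x s. 0 < s \<Longrightarrow> \<bar>G x (rv f x s)\<bar> = H s"
    and cont: "continuous_on {0<..} H"
    and bound: "\<And>x s. start \<le> s \<Longrightarrow> 0 < s \<Longrightarrow> \<bar>G x (rv f x s)\<bar> \<le> b"
  shows "C0_norm (UNIV \<times> {- K..}) (\<lambda>(x, w). G x w :: real) < \<infinity>"
proof -
  obtain a where a: "0 < a" "\<And>x. rv f x a < - K"
    by (rule uniformly_below[where c = "- K", OF below]; blast)
  define c where "c = max a start"
  have "compact {a..c}" "{a..c} \<noteq> {}" "continuous_on {a..c} H"
    using a by (auto simp: c_def intro: continuous_on_subset[OF cont])
  from continuous_attains_sup[OF this] obtain s1 where "\<forall>s\<in>{a..c}. H s \<le> H s1" ..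
  then have s1: "\<And>s. s \<in> {a..c} \<Longrightarrow> H s \<le> H s1" ..
  have "C0_norm (UNIV \<times> {- K..}) (\<lambda>(x, w). G x w) \<le> ennreal (max b (H s1))"
  proof (rule C0_norm_le)
    fix z :: "(real ^ 'd) \<times> real" assume z: "z \<in> UNIV \<times> {- K..}"
    obtain x w where xw: "z = (x, w)" by (cases z)
    have w: "- K \<le> w" using z xw by simp
    obtain s where s: "0 < s" "rv f x s = w" by (rule rv_value)
    have as: "a \<le> s" using rv_mono[OF s(1), of a x] a(2)[of x] s w by (cases "a \<le> s") auto
    have "\<bar>G x w\<bar> \<le> b \<or> \<bar>G x w\<bar> \<le> H s1"
    proof (cases "start \<le> s")
      case True
      then show ?thesis using bound[OF True s(1), of x] s by simp
    next
      case False
      then have "H s \<le> H s1" using as by (intro s1) (auto simp: c_def)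
      then show ?thesis using eq[OF s(1), of x] s by simp
    qed
    then show "norm ((\<lambda>(x, w). G x w) z) \<le> max b (H s1)" by (auto simp: xw)
  qed
  then show ?thesis by (rule order.strict_trans1) simp
qed

lemma inverse_chi_finite: "C0_norm (UNIV \<times> {- K..}) (\<lambda>(x, w). 1 / chi_f f x w) < \<infinity>"
proof -
  obtain \<delta> s0 where \<delta>: "0 < \<delta>" "0 < s0" "\<And>s. s0 \<le> s \<Longrightarrow> \<delta> < s * \<phi>1 s" by (rule eventually_large_slope) blast
  show ?thesis
  proof (rule C0_norm_half_line_finite[where H = "\<lambda>s. 1 / (s * \<phi>1 s)" and b = "1 / \<delta>" and start = s0])
    show "\<bar>1 / chi_f f x (rv f x s)\<bar> = 1 / (s * \<phi>1 s)" if "0 < s" for x s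
      using that \<phi>1_pos[OF that] by (simp add: chi_eq)
    have "s * \<phi>1 s \<noteq> 0" if "s \<in> {0<..}" for s using \<phi>1_pos[of s] that by auto
    then show "continuous_on {0<..} (\<lambda>s. 1 / (s * \<phi>1 s))"
      by (intro continuous_intros \<phi>1_cont) blast
    show "\<bar>1 / chi_f f x (rv f x s)\<bar> \<le> 1 / \<delta>" if "s0 \<le> s" "0 < s" for x s
    proof -
      have "1 / (s * \<phi>1 s) \<le> 1 / \<delta>" using \<delta>(1) \<delta>(3)[OF that(1)] by (intro divide_left_mono) auto
      then show ?thesis using that \<phi>1_pos[OF that(2)] by (simp add: chi_eq)
    qed
  qed
qed

lemma h_deriv_finite: "C0_norm (UNIV \<times> {- K..}) (\<lambda>(x, w). D_m (h_f f) x w) < \<infinity>"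
proof -
  obtain b where b: "Limsup (top \<times>\<^sub>F at_top) (\<lambda>(x, w). ereal \<bar>D_m (h_f f) x w\<bar>) < ereal b"
    using ereal_dense2[OF limsup] by auto
  from Limsup_lessD[OF b] have "eventually (\<lambda>(x, w). \<bar>D_m (h_f f) x w\<bar> \<le> b) (top \<times>\<^sub>F at_top)"
    by (rule eventually_mono) auto
  then obtain w0 where w0: "\<And>x w. w0 \<le> w \<Longrightarrow> \<bar>D_m (h_f f) x w\<bar> \<le> b"
    by (rule eventually_top_prod_at_top) blast
  obtain s0 where s0: "0 < s0" "\<And>x. w0 < rv f x s0"
    by (rule uniformly_above[where c = w0, OF above]; blast)
  let ?H = "\<lambda>s. \<bar>(\<phi>1 s + s * \<phi>2 s) / \<phi>1 s / (2 * sqrt (s * \<phi>1 s))\<bar>"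
  show ?thesis
  proof (rule C0_norm_half_line_finite[where H = ?H and b = b and start = s0])
    show "\<bar>D_m (h_f f) x (rv f x s)\<bar> = ?H s" if "0 < s" for x s by (simp only: h_deriv[OF that])
    have "2 * sqrt (s * \<phi>1 s) \<noteq> 0" "\<phi>1 s \<noteq> 0" if "s \<in> {0<..}" for s using \<phi>1_pos[of s] that by auto
    then show "continuous_on {0<..} ?H"
      by (intro continuous_intros \<phi>1_cont \<phi>2_cont) blast+
    show "\<bar>D_m (h_f f) x (rv f x s)\<bar> \<le> b" if "s0 \<le> s" "0 < s" for x s
      using w0[of "rv f x s" x] s0(2)[of x] rv_mono[OF s0(1) that(1), of x] by simp
  qed
qed

text \<open>The last claim is the identity \<open>\<chi>\<^sub>w = 2 h h\<^sub>w\<close>, with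
  \<open>h\<^sub>w\<close> bounded by \<open>beta\<close> on the half line.\<close>

lemma beta_bounds:
  assumes "coupling g" and K: "0 < K"
  shows "0 \<le> enn2real (beta f g K)"
    "\<And>x s. s \<in> {1 / K..K} \<Longrightarrow> \<bar>rv f x s\<bar> \<le> enn2real (beta f g K)"
    "\<And>x s. s \<in> {1 / K..K} \<Longrightarrow> norm (D_x (rv g) x s) \<le> enn2real (beta f g K)"
    "\<And>x s. 0 < s \<Longrightarrow> - K \<le> rv f x s \<Longrightarrow>
       \<bar>(\<phi>1 s + s * \<phi>2 s) / \<phi>1 s\<bar> \<le> 2 * enn2real (beta f g K) * sqrt (s * \<phi>1 s)"
proof -
  define A B C D where "A = C1_norm (UNIV \<times> {1 / K..K}) (rv f)"
    and "B = C1_norm (UNIV \<times> {1 / K..K}) (D_x (rv g))"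
    and "C = C0_norm (UNIV \<times> {- K..}) (\<lambda>(x, w). 1 / chi_f f x w)"
    and "D = C0_norm (UNIV \<times> {- K..}) (\<lambda>(x, w). D_m (h_f f) x w)"
  obtain G1 G2 G3 where "smooth_coupling g G1 G2 G3" by (rule smooth_coupling_obtain[OF assms(1)])
  then have B: "B < \<infinity>" unfolding B_def by (rule smooth_coupling.C1_norms_finite(2)) (use K in simp)
  have A: "A < \<infinity>" unfolding A_def by (rule C1_norms_finite(1)) (use K in simp)
  have CD: "C < \<infinity>" "D < \<infinity>" unfolding C_def D_def by (rule inverse_chi_finite, rule h_deriv_finite)
  have beta: "beta f g K = A + B + C + D" unfolding beta_def A_def B_def C_def D_def ..
  have fin: "beta f g K < \<infinity>" unfolding beta using A B CD by (simp add: less_top[symmetric] ennreal_add_eq_top)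
  show "0 \<le> enn2real (beta f g K)" by simp
  have le: "A \<le> beta f g K" "B \<le> beta f g K" "D \<le> beta f g K"
    unfolding beta by (auto intro: add_increasing add_increasing2)
  show "\<bar>rv f x s\<bar> \<le> enn2real (beta f g K)" if "s \<in> {1 / K..K}" for x s
  proof (rule le_enn2real[OF order_trans[OF _ le(1)] fin])
    have "ennreal (norm ((\<lambda>(x, s). rv f x s) (x, s))) \<le> C0_norm (UNIV \<times> {1 / K..K}) (\<lambda>(x, s). rv f x s)"
      by (rule norm_le_C0_norm) (use that in simp)
    also have "\<dots> \<le> A" unfolding A_def C1_norm_def by (simp add: add_increasing2)
    finally show "ennreal \<bar>rv f x s\<bar> \<le> A" by simp
  qed simp
  show "norm (D_x (rv g) x s) \<le> enn2real (beta f g K)" if "s \<in> {1 / K..K}" for x s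
  proof (rule le_enn2real[OF order_trans[OF _ le(2)] fin])
    have "ennreal (norm ((\<lambda>(x, s). D_x (rv g) x s) (x, s))) \<le> C0_norm (UNIV \<times> {1 / K..K}) (\<lambda>(x, s). D_x (rv g) x s)"
      by (rule norm_le_C0_norm) (use that in simp)
    also have "\<dots> \<le> B" unfolding B_def C1_norm_def by (simp add: add_increasing2)
    finally show "ennreal (norm (D_x (rv g) x s)) \<le> B" by simp
  qed simp
  show "\<bar>(\<phi>1 s + s * \<phi>2 s) / \<phi>1 s\<bar> \<le> 2 * enn2real (beta f g K) * sqrt (s * \<phi>1 s)"
    if s: "0 < s" and w: "- K \<le> rv f x s" for x s
  proof -
    have "\<bar>D_m (h_f f) x (rv f x s)\<bar> \<le> enn2real (beta f g K)"
    proof (rule le_enn2real[OF order_trans[OF _ le(3)] fin])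
      have "ennreal (norm ((\<lambda>(x, w). D_m (h_f f) x w) (x, rv f x s))) \<le> D"
        unfolding D_def by (rule norm_le_C0_norm) (use w in simp)
      then show "ennreal \<bar>D_m (h_f f) x (rv f x s)\<bar> \<le> D" by simp
    qed simp
    then have le: "\<bar>(\<phi>1 s + s * \<phi>2 s) / \<phi>1 s / (2 * sqrt (s * \<phi>1 s))\<bar> \<le> enn2real (beta f g K)"
      unfolding h_deriv[OF s] .
    have r: "0 < 2 * sqrt (s * \<phi>1 s)" using s \<phi>1_pos[OF s] by simp
    have "\<bar>y\<bar> = \<bar>y / r\<bar> * r" if "0 < r" for y r :: real using that by (simp add: abs_divide)
    from this[OF r] have "\<bar>(\<phi>1 s + s * \<phi>2 s) / \<phi>1 s\<bar>
        = \<bar>(\<phi>1 s + s * \<phi>2 s) / \<phi>1 s / (2 * sqrt (s * \<phi>1 s))\<bar> * (2 * sqrt (s * \<phi>1 s))"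
      .
    also have "\<dots> \<le> enn2real (beta f g K) * (2 * sqrt (s * \<phi>1 s))"
      by (rule mult_right_mono[OF le]) (use r in simp)
    finally show ?thesis by (simp add: mult_ac)
  qed
qed

end

section \<open>Separable Hamiltonians\<close>

lemma Ck_on_UNIV_slices:
  fixes G :: "'a::euclidean_space \<Rightarrow> 'c::euclidean_space \<Rightarrow> 'b::real_normed_vector"
  assumes "Ck_on (Suc k) UNIV (\<lambda>(x, p). G x p)"
  shows "(\<lambda>p. G x p) differentiable (at p)" "(\<lambda>x. G x p) differentiable (at x)"
proof -
  obtain G' where G': "\<And>z. z \<in> UNIV \<Longrightarrow> ((\<lambda>(x, p). G x p) has_derivative G' z) (at z within UNIV)"
    by (rule Ck_on_Suc_obtain[OF assms]; blast)
  have "((\<lambda>p. (x, p)) has_derivative (\<lambda>v. (0, v))) (at p)"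
    by (intro has_derivative_Pair has_derivative_ident has_derivative_const)
  from has_derivative_compose[OF this G'[OF UNIV_I]]
  have "((\<lambda>p. G x p) has_derivative (\<lambda>v. G' (x, p) (0, v))) (at p)" by simp
  then show "(\<lambda>p. G x p) differentiable (at p)" by (rule differentiableI)
  have "((\<lambda>x. (x, p)) has_derivative (\<lambda>v. (v, 0))) (at x)"
    by (intro has_derivative_Pair has_derivative_ident has_derivative_const)
  from has_derivative_compose[OF this G'[OF UNIV_I]]
  have "((\<lambda>x. G x p) has_derivative (\<lambda>v. G' (x, p) (v, 0))) (at x)" by simp
  then show "(\<lambda>x. G x p) differentiable (at x)" by (rule differentiableI)
qed

lemma grad_zero_constant:
  fixes F :: "real ^ 'd \<Rightarrow> 'b::real_normed_vector"
  assumes "\<And>x. F differentiable (at x)" "\<And>x. grad F x = 0"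
  shows "F x = F y"
proof -
  have "(F has_derivative (\<lambda>v. 0)) (at x)" for x
    using has_derivative_grad[OF assms(1)[of x]] assms(2)[of x] by simp
  then obtain k where "\<And>x. F x = k"
    using has_derivative_zero_constant[of UNIV F] by auto
  then show ?thesis by simp
qed

text \<open>\<open>H 0\<close> and \<open>hpot\<close> are the functions \<open>h\<close> and
  \<open>A\<close> of the overview. Freezing \<open>x = 0\<close> in \<open>V\<close>,
  \<open>P\<close> and \<open>Q\<close> loses nothing, because \<open>D_p H\<close> turns out to be
  independent of \<open>x\<close>.\<close>

locale separable_hamiltonian =
  fixes c \<tau> :: real and H :: "real ^ 'd \<Rightarrow> real ^ 'd \<Rightarrow> real"
    and V :: "real ^ 'd \<Rightarrow> real ^ 'd" and P :: "real ^ 'd \<Rightarrow> real ^ 'd ^ 'd"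
    and Q :: "real ^ 'd \<Rightarrow> real ^ 'd \<Rightarrow> real ^ 'd ^ 'd" and hpot :: "real ^ 'd \<Rightarrow> real"
  defines "V \<equiv> D_p H 0" and "P \<equiv> D_p (D_p H) 0"
    and "Q \<equiv> \<lambda>p v. \<Sum>i\<in>UNIV. v $ i *\<^sub>R D_p (D_p (D_p H)) 0 p $ i"
    and "hpot \<equiv> \<lambda>x. H x 0 - H 0 0"
  assumes H: "assumption_H c \<tau> H" and separable: "\<And>x p. D_x (D_p H) x p = 0" and c_pos: "0 < c"
begin

lemma Ck_H: "Ck_on (Suc 3) UNIV (\<lambda>(x, p). H x p)"
  and Ck_DH: "Ck_on (Suc 3) UNIV (\<lambda>(x, p). D_p H x p)"
  and Ck_DDH: "Ck_on (Suc 3) UNIV (\<lambda>(x, p). D_p (D_p H) x p)"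
  using H unfolding assumption_H_def by simp_all

lemma D_p_const: "D_p H x p = V p"
proof -
  have "D_p H x p = D_p H 0 p"
  proof (rule grad_zero_constant[of "\<lambda>x. D_p H x p" x 0])
    show "(\<lambda>x. D_p H x p) differentiable (at x)" for x by (rule Ck_on_UNIV_slices(2)[OF Ck_DH])
    show "grad (\<lambda>x. D_p H x p) x = 0" for x using separable[of x p] unfolding D_x_def .
  qed
  then show ?thesis unfolding V_def .
qed

lemma H_deriv: "(H x has_derivative (\<lambda>v. V p \<bullet> v)) (at p)"
proof -
  have "(\<lambda>p. H x p) differentiable (at p)" by (rule Ck_on_UNIV_slices(1)[OF Ck_H])
  then have "((\<lambda>p. H x p) has_derivative (\<lambda>v. grad (\<lambda>p. H x p) p \<bullet> v)) (at p)" by (rule has_derivative_grad_real)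
  then show ?thesis using D_p_const[of x p] unfolding D_p_def by simp
qed

lemma H_split: "H x p = H 0 p + hpot x"
proof -
  have "((\<lambda>p. H x p - H 0 p) has_derivative (\<lambda>v. V p \<bullet> v - V p \<bullet> v)) (at p)" for p
    by (intro has_derivative_diff H_deriv)
  then have "((\<lambda>p. H x p - H 0 p) has_derivative (\<lambda>v. 0)) (at p)" for p by simp
  then obtain k where k: "\<And>p. H x p - H 0 p = k"
    using has_derivative_zero_constant[of UNIV "\<lambda>p. H x p - H 0 p"] by auto
  show ?thesis using k[of p] k[of 0] unfolding hpot_def by simp
qed

lemma P_cont: "continuous_on UNIV P"
proof -
  have "(\<lambda>p. D_p (D_p H) 0 p) differentiable (at p)" for p by (rule Ck_on_UNIV_slices(1)[OF Ck_DDH])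
  then show ?thesis unfolding P_def by (intro continuous_at_imp_continuous_on ballI differentiable_imp_continuous_within)
qed

lemma V_deriv_rows: "(V has_derivative (\<lambda>v. \<Sum>i\<in>UNIV. v $ i *\<^sub>R P p $ i)) (at p)"
proof -
  have "(\<lambda>p. D_p H 0 p) differentiable (at p)" by (rule Ck_on_UNIV_slices(1)[OF Ck_DH])
  from has_derivative_grad[OF this] show ?thesis unfolding V_def P_def D_p_def[of "D_p H"] by simp
qed

text \<open>Schwarz's theorem for \<open>H 0\<close>. It also reconciles two conventions:
  \<open>grad\<close> of a vector field lists the partial derivatives as rows, while the locale for
  the equation expects \<open>P\<close> to act as a matrix on directions.\<close>

lemma P_sym: "P p $ i $ j = P p $ j $ i"
proof -
  have "(\<Sum>k\<in>UNIV. (axis i 1 :: real ^ 'd) $ k *\<^sub>R P p $ k) \<bullet> axis j 1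
      = (\<Sum>k\<in>UNIV. (axis j 1 :: real ^ 'd) $ k *\<^sub>R P p $ k) \<bullet> axis i 1"
  proof (rule second_derivative_symmetric[OF open_UNIV UNIV_I, of "H 0" "\<lambda>p v. V p \<bullet> v"
      "\<lambda>p v e. (\<Sum>k\<in>UNIV. e $ k *\<^sub>R P p $ k) \<bullet> v"])
    show "(H 0 has_derivative (\<bullet>) (V y)) (at y)" for y using H_deriv by simp
    show "((\<lambda>y. V y \<bullet> v) has_derivative (\<lambda>e. (\<Sum>k\<in>UNIV. e $ k *\<^sub>R P y $ k) \<bullet> v)) (at y)" for y v
      by (rule has_derivative_inner_left[OF V_deriv_rows])
    show "continuous_on UNIV (\<lambda>y. (\<Sum>k\<in>UNIV. e $ k *\<^sub>R P y $ k) \<bullet> v)" for v e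
      by (intro continuous_intros P_cont)
  qed
  moreover have "(\<Sum>k\<in>UNIV. (axis i 1 :: real ^ 'd) $ k *\<^sub>R P p $ k) = P p $ i" for i
    by (simp add: axis_def if_distrib if_distribR cong: if_cong)
  ultimately show ?thesis by (simp add: inner_axis)
qed

lemma V_deriv: "(V has_derivative (\<lambda>v. P p *v v)) (at p)"
proof -
  have "(\<Sum>i\<in>UNIV. v $ i *\<^sub>R P p $ i) = P p *v v" for v
    unfolding matrix_vector_mult_def vec_eq_iff by (simp add: P_sym[of p] mult.commute)
  then show ?thesis using V_deriv_rows[of p] by simp
qed

lemma P_deriv: "(P has_derivative Q p) (at p)"
proof -
  have "(\<lambda>p. D_p (D_p H) 0 p) differentiable (at p)" by (rule Ck_on_UNIV_slices(1)[OF Ck_DDH])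
  from has_derivative_grad[OF this] show ?thesis
    unfolding Q_def P_def D_p_def[of "D_p (D_p H)"] by simp
qed

lemma P_lower: "1 / c * (norm v)\<^sup>2 \<le> v \<bullet> (P p *v v)"
  and P_upper: "v \<bullet> (P p *v v) \<le> c * (norm v)\<^sup>2"
  using H unfolding assumption_H_def P_def by blast+

text \<open>On a unit vector the two ellipticity bounds give \<open>1 / c \<le> c\<close>.\<close>

lemma c_ge_1: "1 \<le> c"
proof -
  have "1 / c * (norm (axis undefined 1 :: real ^ 'd))\<^sup>2 \<le> c * (norm (axis undefined 1 :: real ^ 'd))\<^sup>2"
    by (rule order_trans[OF P_lower P_upper])
  then have "1 \<le> c * c" using c_pos by (simp add: field_simps)
  then show ?thesis using c_pos by (metis mult_less_cancel_left2 not_less order_less_trans mult.right_neutral mult_strict_mono zero_less_one less_eq_real_def)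
qed

lemma Q_bound: "norm (Q p v) \<le> c / (1 + norm p) * norm v"
proof -
  have "norm (Q p v) \<le> norm (D_p (D_p (D_p H)) 0 p) * norm v" unfolding Q_def by (rule norm_sum_scaleR_le)
  also have "\<dots> \<le> c / (1 + norm p) * norm v"
  proof (rule mult_right_mono)
    show "norm (D_p (D_p (D_p H)) 0 p) \<le> c / (1 + norm p)" using H unfolding assumption_H_def by blast
  qed simp
  finally show ?thesis .
qed

lemma V_inner: "2 * H 0 p - c \<le> V p \<bullet> p"
  using H unfolding assumption_H_def V_def by blast

lemma hpot_periodic: "torus_fun hpot"
proof -
  have "torus_fun H" using H unfolding assumption_H_def by blast
  then show ?thesis unfolding torus_fun_def hpot_def by simp
qed

lemma hpot_derivs:
  shows "(hpot has_derivative (\<lambda>v. grad (\<lambda>y. H y 0) x \<bullet> v)) (at x)"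
    "(grad (\<lambda>y. H y 0) has_derivative (\<lambda>v. grad (grad (\<lambda>y. H y 0)) x *v v)) (at x)"
proof -
  have Ck: "Ck_on 4 (UNIV \<times> UNIV) (\<lambda>(x, p). H x p)"
    using H unfolding assumption_H_def UNIV_Times_UNIV by blast
  have both: "(hpot has_derivative (\<lambda>v. grad (\<lambda>y. H y 0) x \<bullet> v)) (at x) \<and>
    (grad (\<lambda>y. H y 0) has_derivative (\<lambda>v. grad (grad (\<lambda>y. H y 0)) x *v v)) (at x)"
  proof (rule C3_product_obtain[OF Ck open_UNIV])
    fix U1 U2 U3 assume "C3_product UNIV (\<lambda>(x, p). H x p) U1 U2 U3"
    then interpret C3_product UNIV "\<lambda>(x, p). H x p" U1 U2 U3 .
    have 1: "((\<lambda>y. H y 0) has_derivative (\<lambda>v. grad (\<lambda>y. H y 0) x \<bullet> v)) (at x)"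
      by (rule has_derivative_grad_real, rule slice_differentiable[OF UNIV_I, of 0 x, unfolded prod.case])
    have "((\<lambda>y. H y 0 - H 0 0) has_derivative (\<lambda>v. grad (\<lambda>y. H y 0) x \<bullet> v - 0)) (at x)"
      by (intro has_derivative_diff has_derivative_const 1)
    then have 2: "(hpot has_derivative (\<lambda>v. grad (\<lambda>y. H y 0) x \<bullet> v)) (at x)"
      unfolding hpot_def diff_0_right .
    show ?thesis
      by (rule conjI[OF 2]) (rule slice_grad_deriv_hessian[OF UNIV_I, of 0 x, unfolded prod.case])
  qed
  show "(hpot has_derivative (\<lambda>v. grad (\<lambda>y. H y 0) x \<bullet> v)) (at x)"
    by (rule conjunct1[OF both])
  show "(grad (\<lambda>y. H y 0) has_derivative (\<lambda>v. grad (grad (\<lambda>y. H y 0)) x *v v)) (at x)"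
    by (rule conjunct2[OF both])
qed

end

section \<open>Slices of derivatives on the closed slab\<close>

lemma slab_slice_derivs:
  fixes F :: "'a::real_normed_vector \<times> real \<Rightarrow> 'b::real_normed_vector"
  assumes F: "(F has_derivative F') (at (x, t) within UNIV \<times> {0..T})" and t: "t \<in> {0..T}"
  shows "((\<lambda>y. F (y, t)) has_derivative (\<lambda>v. F' (v, 0))) (at x)"
    "((\<lambda>s. F (x, s)) has_derivative (\<lambda>h. F' (0, h))) (at t within {0..T})"
proof -
  have "((\<lambda>y. F (y, t)) has_derivative (\<lambda>v. F' (v, 0))) (at x within UNIV)"
  proof (rule has_derivative_in_compose[where f = "\<lambda>y. (y, t)" and f' = "\<lambda>v. (v, 0)"])
    show "((\<lambda>y. (y, t)) has_derivative (\<lambda>v. (v, 0))) (at x within UNIV)"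
      by (intro has_derivative_Pair has_derivative_ident has_derivative_const)
    show "(F has_derivative F') (at (x, t) within range (\<lambda>y. (y, t)))"
      by (rule has_derivative_subset[OF F]) (use t in auto)
  qed
  then show "((\<lambda>y. F (y, t)) has_derivative (\<lambda>v. F' (v, 0))) (at x)" by simp
  show "((\<lambda>s. F (x, s)) has_derivative (\<lambda>h. F' (0, h))) (at t within {0..T})"
  proof (rule has_derivative_in_compose[where f = "\<lambda>s. (x, s)" and f' = "\<lambda>h. (0, h)"])
    show "((\<lambda>s. (x, s)) has_derivative (\<lambda>h. (0, h))) (at t within {0..T})"
      by (intro has_derivative_Pair has_derivative_ident has_derivative_const)
    show "(F has_derivative F') (at (x, t) within (\<lambda>s. (x, s)) ` {0..T})"
      by (rule has_derivative_subset[OF F]) (use t in auto)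
  qed
qed

lemma D_t_eq:
  assumes F: "((\<lambda>(x, t). v x t) has_derivative F') (at (x, t) within UNIV \<times> {0..T})"
    and t: "t \<in> {0..T}" and T: "0 < T"
  shows "D_t T v x t = F' (0, 1)"
proof -
  have "((\<lambda>s. v x s) has_derivative (\<lambda>h. F' (0, h))) (at t within {0..T})"
    using slab_slice_derivs(2)[OF F t] by simp
  moreover have "(\<lambda>h. F' (0, h)) = (\<lambda>h. h *\<^sub>R F' (0, 1))"
    by (rule ext) (rule linear_snd[OF has_derivative_linear[OF F]])
  ultimately have "(v x has_vector_derivative F' (0, 1)) (at t within {0..T})"
    unfolding has_vector_derivative_def by simp
  then show ?thesis unfolding D_t_def
    by (intro vector_derivative_within_closed_interval) (use t T in auto)
qed

section \<open>Reduction to a quasilinear elliptic equation\<close>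

lemma norm_le_of_C0_norm:
  assumes "C0_norm S F \<le> ennreal c" "z \<in> S" "0 \<le> c"
  shows "norm (F z) \<le> c"
  using order_trans[OF norm_le_C0_norm[OF assms(2)] assms(1)] assms(3) by simp

text \<open>The derived quantities are fixed here by \<open>defines\<close>, so that all the
  sublocales below speak of the same terms. \<open>Y\<close> and \<open>Z\<close> are computed from
  \<open>f\<close> at density \<open>m0 0\<close>, not 1: the convention on \<open>c\<close> bounds
  the derivatives of \<open>f\<close> only for densities in the range of \<open>m0\<close>.
  Separability makes the choice immaterial for the potential up to a constant.\<close>

locale mfg_problem =
  fixes c \<tau> T :: real
    and H :: "real ^ 'd \<Rightarrow> real ^ 'd \<Rightarrow> real" and f g :: "real ^ 'd \<Rightarrow> real \<Rightarrow> ereal"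
    and m0 :: "real ^ 'd \<Rightarrow> real" and u m :: "real ^ 'd \<Rightarrow> real \<Rightarrow> real"
    and U1 U2 U3 F1 F2 F3 G1 G2 G3 M1
    and V :: "real ^ 'd \<Rightarrow> real ^ 'd" and P :: "real ^ 'd \<Rightarrow> real ^ 'd ^ 'd"
    and Q :: "real ^ 'd \<Rightarrow> real ^ 'd \<Rightarrow> real ^ 'd ^ 'd" and hpot fpot :: "real ^ 'd \<Rightarrow> real"
    and \<phi> \<phi>1 \<phi>2 :: "real \<Rightarrow> real"
    and W :: "real ^ 'd \<Rightarrow> real" and Y :: "real ^ 'd \<Rightarrow> real ^ 'd" and Z :: "real ^ 'd \<Rightarrow> real ^ 'd ^ 'd"
    and p dp a w dw tr
  defines "V \<equiv> D_p H 0" and "P \<equiv> D_p (D_p H) 0"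
    and "Q \<equiv> \<lambda>p v. \<Sum>i\<in>UNIV. v $ i *\<^sub>R D_p (D_p (D_p H)) 0 p $ i"
    and "hpot \<equiv> \<lambda>x. H x 0 - H 0 0" and "fpot \<equiv> \<lambda>x. rv f x 1 - rv f 0 1"
    and "\<phi> \<equiv> rv f 0" and "\<phi>1 \<equiv> \<lambda>s. F1 (0, s) (0, 1)" and "\<phi>2 \<equiv> \<lambda>s. F2 (0, s) (0, 1) (0, 1)"
    and "W \<equiv> \<lambda>x. hpot x - fpot x"
    and "Y \<equiv> \<lambda>x. grad (\<lambda>y. H y 0) x - grad (\<lambda>y. rv f y (m0 0)) x"
    and "Z \<equiv> \<lambda>x. grad (grad (\<lambda>y. H y 0)) x - grad (grad (\<lambda>y. rv f y (m0 0))) x"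
    and "p \<equiv> \<lambda>z. \<chi> i. U1 z (axis i 1, 0)"
    and "dp \<equiv> \<lambda>z b. \<chi> i. U2 z (axis i 1, 0) b"
    and "a \<equiv> \<lambda>z. (- V (p z), 1)"
    and "w \<equiv> \<lambda>z. - U1 z (0, 1) + H 0 (p z) + W (fst z)"
    and "dw \<equiv> \<lambda>z b. - U2 z (a z) b + Y (fst z) \<bullet> fst b"
    and "tr \<equiv> \<lambda>z. \<Sum>i\<in>UNIV. \<Sum>j\<in>UNIV. P (p z) $ i $ j * U2 z (axis i 1, 0) (axis j 1, 0)"
  assumes c_pos: "0 < c" and T_pos: "0 < T"
    and M: "assumption_M m0" and H: "assumption_H c \<tau> H" and F: "assumption_F c \<tau> f"
    and G: "assumption_G g" and SE: "assumption_SE f" and convention: "C0_convention c \<tau> H f m0"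
    and separable_H: "\<And>x p. D_x (D_p H) x p = 0"
    and separable_f: "\<And>x s. 0 < s \<Longrightarrow> D_m (D_x (rv f)) x s = 0"
    and limsup: "Limsup (top \<times>\<^sub>F at_top) (\<lambda>(x, w). ereal \<bar>D_m (h_f f) x w\<bar>) < \<infinity>"
    and solution: "mfg_classical_solution T H f g m0 u m"
    and U: "C3_function (UNIV \<times> {0..T}) (\<lambda>(x, t). u x t) U1 U2 U3"
    and f_smooth: "smooth_coupling f F1 F2 F3" and g_smooth: "smooth_coupling g G1 G2 G3"
    and M1: "\<And>z. z \<in> UNIV \<times> {0..T} \<Longrightarrow> ((\<lambda>(x, t). m x t) has_derivative M1 z) (at z within UNIV \<times> {0..T})"
begin

sublocale h: separable_hamiltonian c \<tau> H V P Q hpot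
  by unfold_locales (rule H separable_H c_pos V_def P_def Q_def hpot_def)+

sublocale f: separable_coupling f F1 F2 F3 \<phi> \<phi>1 \<phi>2 fpot
proof (rule separable_coupling.intro[OF f_smooth])
  show "separable_coupling_axioms f"
    unfolding separable_coupling_axioms_def
    using F SE separable_f limsup unfolding assumption_F_def assumption_SE_def by blast
qed (rule \<phi>_def \<phi>1_def \<phi>2_def fpot_def)+

sublocale g: smooth_coupling g G1 G2 G3
  by (rule g_smooth)

lemma Ck_m0: "continuous_on UNIV m0" and m0_pos: "0 < m0 x" and m0_periodic: "torus_fun m0"
  and m0_differentiable: "m0 differentiable (at x)"
proof -
  have Ck: "Ck_on 4 UNIV m0" using M unfolding assumption_M_def by blast
  then show "continuous_on UNIV m0" by (rule Ck_on_continuous_on)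
  show "0 < m0 x" "torus_fun m0" using M unfolding assumption_M_def by blast+
  have "Ck_on (Suc 3) UNIV m0" using Ck by simp
  then obtain F' where "\<And>z. z \<in> UNIV \<Longrightarrow> (m0 has_derivative F' z) (at z within UNIV)"
    by (rule Ck_on_Suc_obtain; blast)
  from this[OF UNIV_I] show "m0 differentiable (at x)" by (rule differentiableI)
qed

lemma m0_range: "m0 x \<in> {(INF x. m0 x)..(SUP x. m0 x)}"
proof -
  have cont: "continuous_on (UNIV \<times> {0 <..}) (\<lambda>z. m0 (fst z))"
    by (rule continuous_on_compose2[OF Ck_m0]) (auto intro: continuous_intros)
  have "bdd_above (range m0)"
  proof (rule periodic_SUP_attained[of "\<lambda>x _. m0 x" 1])
    fix x assume "\<And>y. m0 y \<le> m0 x"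
    then show "bdd_above (range m0)" by (auto intro!: bdd_aboveI)
  qed (use cont m0_periodic in \<open>simp_all add: case_prod_beta'\<close>)
  moreover have "bdd_below (range m0)"
  proof (rule periodic_SUP_attained[of "\<lambda>x _. - m0 x" 1])
    fix x assume "\<And>y. - m0 y \<le> - m0 x"
    then show "bdd_below (range m0)" by (auto intro!: bdd_belowI)
  qed (use continuous_on_minus[OF cont] m0_periodic in \<open>simp_all add: case_prod_beta' torus_fun_def\<close>)
  ultimately show ?thesis by (auto intro: cINF_lower cSUP_upper)
qed

lemma c1: "1 \<le> c" by (rule h.c_ge_1)

lemma convention_H:
  shows "1 / c * (norm q)\<^sup>2 - c \<le> H x q" "H x q \<le> c * (norm q)\<^sup>2 + c" "norm (D_p H x q) \<le> c * (1 + norm q)"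
    and "norm (grad (\<lambda>y. H y 0) x) \<le> c" "norm (grad (grad (\<lambda>y. H y 0)) x) \<le> c"
proof -
  note conv = conjunct1[OF convention[unfolded C0_convention_def], rule_format]
  show "1 / c * (norm q)\<^sup>2 - c \<le> H x q" "H x q \<le> c * (norm q)\<^sup>2 + c" "norm (D_p H x q) \<le> c * (1 + norm q)"
    using conv[of q x] by blast+
  have "norm (D_x H x 0) \<le> c * (1 + norm (0 :: real ^ 'd) powr (1 + \<tau>))"
    "norm (D_x (D_x H) x 0) \<le> c * (1 + norm (0 :: real ^ 'd) powr (1 + \<tau>))"
    using conv[of 0 x] by blast+
  then show "norm (grad (\<lambda>y. H y 0) x) \<le> c" "norm (grad (grad (\<lambda>y. H y 0)) x) \<le> c"
    by (simp_all add: D_x_def)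
qed

lemma convention_norms:
  shows "norm (grad m0 x) \<le> c" "\<bar>rv f x (m0 y)\<bar> \<le> c" "\<phi>1 (m0 y) \<le> c"
    and "norm (grad (\<lambda>x. rv f x (m0 y)) x) \<le> c" "norm (grad (grad (\<lambda>x. rv f x (m0 y))) x) \<le> c"
proof -
  let ?S = "(UNIV :: (real ^ 'd) set) \<times> {(INF x. m0 x)..(SUP x. m0 x)}"
  have sum: "C0_norm UNIV (\<lambda>x. chi_f f x 0) + (C0_norm UNIV m0 + C0_norm UNIV (grad m0)) + C2_norm ?S (rv f) \<le> ennreal c"
    using convention unfolding C0_convention_def by blast
  have "C0_norm UNIV (grad m0) \<le> ennreal c"
    by (rule order_trans[OF _ sum]) (auto intro!: add_increasing add_increasing2)
  from norm_le_of_C0_norm[OF this UNIV_I, of x] show "norm (grad m0 x) \<le> c" using c1 by simp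
  have C2: "C2_norm ?S (rv f) \<le> ennreal c"
    by (rule order_trans[OF _ sum]) (auto intro!: add_increasing)
  have A: "C0_norm ?S (\<lambda>(x, s). rv f x s) \<le> ennreal c" "C0_norm ?S (\<lambda>(x, s). D_xm (rv f) x s) \<le> ennreal c"
    "C0_norm ?S (\<lambda>(x, s). D_xm (D_xm (rv f)) x s) \<le> ennreal c"
    by (rule order_trans[OF _ C2], unfold C2_norm_def C1_norm_def, simp add: add_increasing add_increasing2)+
  have mem: "(x, m0 y) \<in> ?S" using m0_range[of y] by simp
  have c0: "0 \<le> c" using c1 by simp
  have "norm ((\<lambda>(x, s). rv f x s) (x, m0 y)) \<le> c" "norm ((\<lambda>(x, s). D_xm (rv f) x s) (x, m0 y)) \<le> c"
    "norm ((\<lambda>(x, s). D_xm (D_xm (rv f)) x s) (x, m0 y)) \<le> c"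
    by (rule norm_le_of_C0_norm[OF A(1) mem c0], rule norm_le_of_C0_norm[OF A(2) mem c0],
        rule norm_le_of_C0_norm[OF A(3) mem c0])
  then have n: "\<bar>rv f x (m0 y)\<bar> \<le> c" "norm (D_x (rv f) x (m0 y), D_m (rv f) x (m0 y)) \<le> c"
    "norm (D_x (D_xm (rv f)) x (m0 y), D_m (D_xm (rv f)) x (m0 y)) \<le> c"
    unfolding D_xm_def[of "rv f"] D_xm_def[of "\<lambda>x s. (D_x (rv f) x s, D_m (rv f) x s)"] by (simp_all add: D_xm_def[abs_def])
  note s = m0_pos[of y]
  show "\<bar>rv f x (m0 y)\<bar> \<le> c" by (rule n(1))
  have "\<bar>D_m (rv f) x (m0 y)\<bar> \<le> c" using order_trans[OF norm_snd_le n(2)] by simp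
  then show "\<phi>1 (m0 y) \<le> c" unfolding f.D_m_rv[OF s] f.F1_eq[OF s] by simp
  have "norm (D_x (rv f) x (m0 y)) \<le> c" by (rule order_trans[OF norm_fst_le n(2)])
  then show "norm (grad (\<lambda>x. rv f x (m0 y)) x) \<le> c" unfolding D_x_def .
  have "norm (D_x (D_xm (rv f)) x (m0 y)) \<le> c" by (rule order_trans[OF norm_fst_le n(3)])
  \<comment> \<open>The second component of \<open>D_xm (rv f)\<close> is constant in
    \<open>x\<close>, so the norm reduces to that of the spatial Hessian.\<close>
  moreover have "norm (D_x (D_xm (rv f)) x (m0 y)) = norm (grad (grad (\<lambda>x. rv f x (m0 y))) x)"
  proof -
    let ?g = "grad (\<lambda>x. rv f x (m0 y))"
    have "(\<lambda>z. D_xm (rv f) z (m0 y)) = (\<lambda>z. (?g z, \<phi>1 (m0 y)))"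
      by (simp add: D_xm_def D_x_def f.D_m_rv[OF s] f.F1_eq[OF s] fun_eq_iff)
    moreover have "((\<lambda>z. (?g z, \<phi>1 (m0 y))) has_derivative (\<lambda>v. (grad ?g x *v v, 0))) (at x)"
      using f.slice_grad_deriv_hessian[of "m0 y" x] s by (intro has_derivative_Pair has_derivative_const) simp
    ultimately have "D_x (D_xm (rv f)) x (m0 y) $ i = (grad ?g x *v axis i 1, 0)" for i
      unfolding D_x_def using grad_nth by fastforce
    moreover have "grad ?g x *v axis i 1 = grad ?g x $ i" for i
      using grad_nth[OF f.slice_grad_deriv_hessian[of "m0 y" x], of i] s by simp
    ultimately have "norm (D_x (D_xm (rv f)) x (m0 y) $ i) = norm (grad ?g x $ i)" for i by simp
    then show ?thesis unfolding norm_vec_def by simp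
  qed
  ultimately show "norm (grad (grad (\<lambda>x. rv f x (m0 y))) x) \<le> c" by simp
qed

lemma fpot_eq: "fpot x = rv f x (m0 y) - \<phi> (m0 y)"
  using f.rv_split[OF m0_pos[of y], of x] by simp

lemma fpot_bound: "\<bar>fpot x\<bar> \<le> 2 * c"
  using convention_norms(2)[of x 0] convention_norms(2)[of 0 0] unfolding fpot_eq[of x 0] \<phi>_def by linarith

lemma hpot_bound: "\<bar>hpot x\<bar> \<le> 2 * c"
  using convention_H(1)[where q = 0 and x = x] convention_H(2)[where q = 0 and x = x]
    convention_H(1)[where q = 0 and x = 0] convention_H(2)[where q = 0 and x = 0] unfolding hpot_def by simp

lemma fpot_periodic: "torus_fun fpot"
  using f.rv_periodic[of 1] unfolding torus_fun_def fpot_def by simp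

lemma u_periodic: "t \<in> {0..T} \<Longrightarrow> torus_fun (\<lambda>x. (\<lambda>(x, t). u x t) (x, t))"
  and m_periodic: "t \<in> {0..T} \<Longrightarrow> torus_fun (\<lambda>x. m x t)"
  using solution unfolding mfg_classical_solution_def by auto

sublocale U: hamilton_jacobi where T = T and u = "\<lambda>(x, t). u x t" and U1 = U1 and U2 = U2 and U3 = U3
  and c = c and Hh = "H 0" and V = V and P = P and Q = Q and W = W and Y = Y and Z = Z
  and p = p and dp = dp and a = a and w = w and dw = dw and tr = tr
proof (rule hamilton_jacobi.intro[OF U])
  show "hamilton_jacobi_axioms T (\<lambda>(x, t). u x t) U1 U2 c (H 0) V P Q W Y Z"
  proof
    show "(W has_derivative (\<lambda>v. Y x \<bullet> v)) (at x)" for x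
    proof -
      have "((\<lambda>x. rv f x (m0 0)) has_derivative (\<lambda>v. grad (\<lambda>y. rv f y (m0 0)) x \<bullet> v)) (at x)"
        using f.slice_differentiable[of "m0 0" x] m0_pos[of 0] by (intro has_derivative_grad_real) simp
      then have "((\<lambda>x. hpot x - (rv f x (m0 0) - \<phi> (m0 0))) has_derivative
          (\<lambda>v. grad (\<lambda>y. H y 0) x \<bullet> v - (grad (\<lambda>y. rv f y (m0 0)) x \<bullet> v - 0))) (at x)"
        by (intro has_derivative_diff h.hpot_derivs has_derivative_const)
      then show ?thesis unfolding W_def Y_def fpot_eq[of _ 0] by (simp add: inner_diff_left)
    qed
    show "(Y has_derivative (\<lambda>v. Z x *v v)) (at x)" for x
    proof -
      have "(grad (\<lambda>y. rv f y (m0 0)) has_derivative (\<lambda>v. grad (grad (\<lambda>y. rv f y (m0 0))) x *v v)) (at x)"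
        using f.slice_grad_deriv_hessian[of "m0 0" x] m0_pos[of 0] by simp
      from has_derivative_diff[OF h.hpot_derivs(2) this]
      show ?thesis unfolding Y_def Z_def by (simp add: matrix_vector_mult_diff_rdistrib)
    qed
    show "\<bar>W x\<bar> \<le> 4 * c" for x using hpot_bound[of x] fpot_bound[of x] unfolding W_def by linarith
    show "norm (Y x) \<le> 2 * c" for x
      unfolding Y_def using norm_triangle_ineq4 convention_H(4)[of x] convention_norms(4)[of 0 x] by (smt (verit))
    show "norm (Z x) \<le> 2 * c" for x
      unfolding Z_def using norm_triangle_ineq4 convention_H(5)[of x] convention_norms(5)[of 0 x] by (smt (verit))
    show "torus_fun W" using h.hpot_periodic fpot_periodic unfolding torus_fun_def W_def by simp
    show "norm (V y) \<le> c * (1 + norm y)" for y unfolding V_def by (rule convention_H(3))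
    show "torus_fun (\<lambda>x. U1 (x, t) b)" if "t \<in> {0..T}" for t b
      by (rule C3_function_torus(1)[OF U u_periodic that])
    show "torus_fun (\<lambda>x. U2 (x, t) b b')" if "t \<in> {0..T}" for t b b'
      by (rule C3_function_torus(2)[OF U u_periodic that])
  qed (fact T_pos c1 h.H_deriv h.V_deriv h.P_deriv h.P_sym h.P_lower h.P_upper h.Q_bound convention_H(1,2)
      h.V_inner u_periodic)+
qed (rule p_def dp_def a_def w_def dw_def tr_def)+

end

section \<open>From the system to the equation for \<open>u\<close>\<close>

context mfg_problem
begin

abbreviation "mm \<equiv> \<lambda>(x, t). m x t"

lemma slab_mem: "t \<in> {0..T} \<Longrightarrow> (x, t) \<in> UNIV \<times> {0..T}" by simp

lemma D_t_u: "t \<in> {0..T} \<Longrightarrow> D_t T u x t = U1 (x, t) (0, 1)"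
  by (rule D_t_eq[OF U.deriv1[OF slab_mem] _ T_pos])

lemma D_t_m: "t \<in> {0..T} \<Longrightarrow> D_t T m x t = M1 (x, t) (0, 1)"
  by (rule D_t_eq[OF M1[OF slab_mem] _ T_pos])

lemma D_x_u:
  assumes t: "t \<in> {0..T}"
  shows "D_x u x t = p (x, t)"
proof -
  have "((\<lambda>y. u y t) has_derivative (\<lambda>v. U1 (x, t) (v, 0))) (at x)"
    using slab_slice_derivs(1)[OF U.deriv1[OF slab_mem[OF t]] t] by simp
  from grad_nth[OF this] show ?thesis unfolding D_x_def p_def by (simp add: vec_eq_iff)
qed

lemma mm_cont: "continuous_on (UNIV \<times> {0..T}) mm"
  by (rule has_derivative_continuous_on) (rule M1)

lemma m_nonneg: "t \<in> {0..T} \<Longrightarrow> 0 \<le> m x t"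
  using solution unfolding mfg_classical_solution_def by blast

lemma hj_inside:
  assumes "t \<in> {0<..<T}"
  shows "ereal (- U1 (x, t) (0, 1) + H x (p (x, t))) = f x (m x t)"
proof -
  have "ereal (- D_t T u x t + H x (D_x u x t)) = f x (m x t)"
    using solution assms unfolding mfg_classical_solution_def by blast
  then show ?thesis using D_t_u[of t x] D_x_u[of t x] assms by simp
qed

text \<open>The equation is given for \<open>0 < t < T\<close> only. Both sides are continuous in
  \<open>t\<close> up to the end points; the limit is taken in \<open>ereal\<close> because
  \<open>m\<close> could still vanish there.\<close>

lemma hamilton_jacobi_closed:
  assumes t: "t \<in> {0..T}"
  shows "ereal (- U1 (x, t) (0, 1) + H x (p (x, t))) = f x (m x t)"
proof (cases "t \<in> {0<..<T}")
  case True
  then show ?thesis by (rule hj_inside)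
next
  case False
  let ?F = "at t within {0<..<T}"
  have slice: "continuous_on {0..T} (\<lambda>s. (x, s))" by (intro continuous_intros)
  have "continuous_on UNIV (H x)"
    by (rule has_derivative_continuous_on) (rule has_derivative_at_withinI[OF h.H_deriv])
  then have "continuous_on {0..T} (\<lambda>s. H x (p (x, s)))"
    by (rule continuous_on_compose2[OF _ continuous_on_compose2[OF U.p_cont slice]]) auto
  moreover have "continuous_on {0..T} (\<lambda>s. U1 (x, s) (0, 1))"
    by (rule continuous_on_compose2[OF U.cont1 slice]) auto
  ultimately have c1: "continuous_on {0..T} (\<lambda>s. - U1 (x, s) (0, 1) + H x (p (x, s)))"
    by (intro continuous_on_add continuous_on_minus)
  have "((\<lambda>s. - U1 (x, s) (0, 1) + H x (p (x, s))) \<longlongrightarrow> - U1 (x, t) (0, 1) + H x (p (x, t))) (at t within {0..T})"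
    using c1[unfolded continuous_on_def] t by (rule bspec)
  then have "((\<lambda>s. ereal (- U1 (x, s) (0, 1) + H x (p (x, s)))) \<longlongrightarrow> ereal (- U1 (x, t) (0, 1) + H x (p (x, t)))) (at t within {0..T})"
    by (rule tendsto_ereal)
  then have L: "((\<lambda>s. ereal (- U1 (x, s) (0, 1) + H x (p (x, s)))) \<longlongrightarrow> ereal (- U1 (x, t) (0, 1) + H x (p (x, t)))) ?F"
    by (rule tendsto_within_subset) auto
  have "continuous_on {0..T} (\<lambda>s. mm (x, s))"
    by (rule continuous_on_compose2[OF mm_cont slice]) auto
  then have pc: "continuous_on {0..T} (\<lambda>s. (x, m x s))" by (intro continuous_on_Pair continuous_on_const) simp
  have fc: "continuous_on (UNIV \<times> {0..}) (\<lambda>(x, s). f x s)" using f.coupling unfolding coupling_def by blast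
  have c2: "continuous_on {0..T} (\<lambda>s. (\<lambda>(x, s). f x s) (x, m x s))"
    by (rule continuous_on_compose2[OF fc pc]) (auto intro: m_nonneg)
  have "((\<lambda>s. f x (m x s)) \<longlongrightarrow> f x (m x t)) (at t within {0..T})"
    using bspec[OF c2[unfolded continuous_on_def] t] by simp
  then have lim: "((\<lambda>s. f x (m x s)) \<longlongrightarrow> f x (m x t)) ?F" by (rule tendsto_within_subset) auto
  have "eventually (\<lambda>s. f x (m x s) = ereal (- U1 (x, s) (0, 1) + H x (p (x, s)))) ?F"
    unfolding eventually_at_filter
    by (intro always_eventually allI impI) (rule hj_inside[symmetric], assumption)
  from iffD1[OF tendsto_cong[OF this] lim] have R: "((\<lambda>s. ereal (- U1 (x, s) (0, 1) + H x (p (x, s)))) \<longlongrightarrow> f x (m x t)) ?F" .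
  have "t \<in> closure {0<..<T}" using t T_pos by (simp add: closure_greaterThanLessThan)
  then have "?F \<noteq> bot" using False by (auto simp: closure_def trivial_limit_within)
  from tendsto_unique[OF this L R] show ?thesis .
qed

text \<open>The left side of the equation is finite, whereas \<open>f\<close> is minus infinity at
  density 0.\<close>

lemma m_pos:
  assumes "t \<in> {0..T}"
  shows "0 < m x t"
proof (rule ccontr)
  assume "\<not> 0 < m x t"
  then have "m x t = 0" using m_nonneg[OF assms, of x] by simp
  then show False using hamilton_jacobi_closed[OF assms, of x] f.SE[of x] by simp
qed

lemma w_f: "t \<in> {0..T} \<Longrightarrow> w (x, t) = rv f x (m x t) - fpot x"
  using hamilton_jacobi_closed[of t x] f.value_eq[OF m_pos, of t x x] h.H_split[of x "p (x, t)"]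
  unfolding w_def W_def by simp

lemma w_eq: "t \<in> {0..T} \<Longrightarrow> w (x, t) = \<phi> (m x t)"
  using w_f[of t x] f.rv_split[OF m_pos, of t x x] by simp

lemma \<phi>_m_deriv:
  assumes "z \<in> UNIV \<times> {0..T}"
  shows "((\<lambda>z. \<phi> (mm z)) has_derivative (\<lambda>b. \<phi>1 (mm z) * M1 z b)) (at z within UNIV \<times> {0..T})"
proof -
  have "0 < mm z" using assms m_pos by auto
  from has_derivative_compose[OF M1[OF assms] f.\<phi>_deriv(1)[OF this, unfolded has_field_derivative_def]]
  show ?thesis by simp
qed

text \<open>Holds up to the boundary, where the spatial slices are still whole spaces and their
  derivatives unique.\<close>

lemma dw_space:
  assumes t: "t \<in> {0..T}"
  shows "dw (x, t) (y, 0) = \<phi>1 (m x t) * M1 (x, t) (y, 0)"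
proof -
  have 1: "((\<lambda>y. w (y, t)) has_derivative (\<lambda>v. dw (x, t) (v, 0))) (at x)"
    by (rule slab_slice_derivs(1)[OF U.w_deriv[OF slab_mem[OF t]] t])
  have 2: "((\<lambda>y. \<phi> (mm (y, t))) has_derivative (\<lambda>v. \<phi>1 (mm (x, t)) * M1 (x, t) (v, 0))) (at x)"
    by (rule slab_slice_derivs(1)[OF \<phi>_m_deriv[OF slab_mem[OF t]] t])
  have "(\<lambda>y. w (y, t)) = (\<lambda>y. \<phi> (mm (y, t)))" by (rule ext) (simp add: w_eq[OF t])
  with 1 2 have "(\<lambda>v. dw (x, t) (v, 0)) = (\<lambda>v. \<phi>1 (mm (x, t)) * M1 (x, t) (v, 0))"
    using has_derivative_unique by simp
  from fun_cong[OF this, of y] show ?thesis by simp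
qed

lemma at_inside:
  fixes z :: "(real ^ 'd) \<times> real"
  assumes "z \<in> UNIV \<times> {0<..<T}"
  shows "at z within UNIV \<times> {0..T} = at z"
  by (rule at_within_interior) (simp only: U.interior_slab assms)

lemma dw_inside:
  assumes z: "z \<in> UNIV \<times> {0<..<T}"
  shows "dw z b = \<phi>1 (mm z) * M1 z b"
proof -
  have zs: "z \<in> UNIV \<times> {0..T}" by (rule U.open_slab_slab[OF z])
  have 1: "(w has_derivative dw z) (at z)" using U.w_deriv[OF zs] unfolding at_inside[OF z] .
  have 2: "((\<lambda>z. \<phi> (mm z)) has_derivative (\<lambda>b. \<phi>1 (mm z) * M1 z b)) (at z)"
    using \<phi>_m_deriv[OF zs] unfolding at_inside[OF z] .
  have "(w has_derivative (\<lambda>b. \<phi>1 (mm z) * M1 z b)) (at z)"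
    by (rule has_derivative_transform_within_open[OF 2 U.is_open_slab z]) (use w_eq in auto)
  from fun_cong[OF has_derivative_unique[OF 1 this]] show ?thesis .
qed

text \<open>The divergence is expanded by the product rule: the first-order part is the derivative
  of \<open>m\<close> in direction \<open>V\<close>, and the rest is \<open>m\<close> times the
  trace of \<open>P\<close> against the Hessian.\<close>

lemma transport:
  assumes z: "z \<in> UNIV \<times> {0<..<T}"
  shows "M1 z (0, 1) - M1 z (V (p z), 0) = mm z * tr z"
proof -
  obtain x t where xt: "z = (x, t)" by (cases z)
  have t: "t \<in> {0..T}" "t \<in> {0<..<T}" using z xt by auto
  have zs: "z \<in> UNIV \<times> {0..T}" by (rule U.open_slab_slab[OF z])
  let ?G = "\<lambda>y. m y t *\<^sub>R V (p (y, t))"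
  have p': "((\<lambda>y. p (y, t)) has_derivative (\<lambda>v. dp z (v, 0))) (at x)"
    using slab_slice_derivs(1)[OF U.p_deriv[OF zs, unfolded xt] t(1)] unfolding xt .
  have "((\<lambda>y. mm (y, t)) has_derivative (\<lambda>v. M1 z (v, 0))) (at x)"
    using slab_slice_derivs(1)[OF M1[OF zs, unfolded xt] t(1)] unfolding xt .
  then have m': "((\<lambda>y. m y t) has_derivative (\<lambda>v. M1 z (v, 0))) (at x)" by simp
  have G: "(?G has_derivative (\<lambda>v. m x t *\<^sub>R (P (p z) *v dp z (v, 0)) + M1 z (v, 0) *\<^sub>R V (p z))) (at x)"
    using has_derivative_scaleR[OF m' has_derivative_compose[OF p' h.V_deriv]] unfolding xt .
  have "D_t T m x t - divergence (\<lambda>y. m y t *\<^sub>R D_p H y (D_x u y t)) x = 0"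
    using solution t(2) unfolding mfg_classical_solution_def by blast
  then have eq: "M1 z (0, 1) = divergence ?G x"
    using D_t_m[OF t(1), of x] D_x_u[OF t(1)] by (simp add: h.D_p_const xt)
  have "divergence ?G x = (\<Sum>i\<in>UNIV. m x t * (P (p z) *v dp z (axis i 1, 0)) $ i + M1 z (axis i 1, 0) * V (p z) $ i)"
    unfolding divergence_def grad_nth[OF G] by simp
  also have "\<dots> = m x t * (\<Sum>i\<in>UNIV. (P (p z) *v dp z (axis i 1, 0)) $ i) + (\<Sum>i\<in>UNIV. V (p z) $ i * M1 z (axis i 1, 0))"
    by (simp add: sum.distrib sum_distrib_left mult.commute)
  also have "(\<Sum>i\<in>UNIV. V (p z) $ i * M1 z (axis i 1, 0)) = M1 z (V (p z), 0)"
    by (rule linear_axis_sum[OF has_derivative_linear[OF M1[OF zs]], symmetric])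
  also have "(\<Sum>i\<in>UNIV. (P (p z) *v dp z (axis i 1, 0)) $ i) = tr z"
    unfolding tr_def
  proof (rule sum.cong[OF refl])
    fix i
    have "(P (p z) *v dp z (axis i 1, 0)) $ i = (\<Sum>j\<in>UNIV. P (p z) $ i $ j * U2 z (axis j 1, 0) (axis i 1, 0))"
      by (simp add: matrix_vector_mult_def dp_def)
    also have "\<dots> = (\<Sum>j\<in>UNIV. P (p z) $ i $ j * U2 z (axis i 1, 0) (axis j 1, 0))"
      by (intro sum.cong refl arg_cong2[where f = "(*)"] U.sym2[OF zs])
    finally show "(P (p z) *v dp z (axis i 1, 0)) $ i = (\<Sum>j\<in>UNIV. P (p z) $ i $ j * U2 z (axis i 1, 0) (axis j 1, 0))" .
  qed
  finally show ?thesis unfolding eq by (simp add: xt)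
qed

lemma chi_deriv:
  assumes z: "z \<in> UNIV \<times> {0<..<T}"
  shows "((\<lambda>z. mm z * \<phi>1 (mm z)) has_derivative
     (\<lambda>b. (\<phi>1 (mm z) + mm z * \<phi>2 (mm z)) / \<phi>1 (mm z) * dw z b)) (at z)"
proof -
  have zs: "z \<in> UNIV \<times> {0..T}" by (rule U.open_slab_slab[OF z])
  have pos: "0 < mm z" using zs m_pos by auto
  have M: "(mm has_derivative M1 z) (at z)" using M1[OF zs] unfolding at_inside[OF z] .
  have "((\<lambda>z. \<phi>1 (mm z)) has_derivative (\<lambda>b. \<phi>2 (mm z) * M1 z b)) (at z)"
    by (rule has_derivative_compose[OF M f.\<phi>_deriv(2)[OF pos, unfolded has_field_derivative_def]])
  from has_derivative_mult[OF M this]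
  have "((\<lambda>z. mm z * \<phi>1 (mm z)) has_derivative (\<lambda>b. mm z * (\<phi>2 (mm z) * M1 z b) + M1 z b * \<phi>1 (mm z))) (at z)" .
  moreover have "(\<lambda>b. mm z * (\<phi>2 (mm z) * M1 z b) + M1 z b * \<phi>1 (mm z))
      = (\<lambda>b. (\<phi>1 (mm z) + mm z * \<phi>2 (mm z)) / \<phi>1 (mm z) * dw z b)"
  proof (rule ext)
    fix b
    have "\<phi>1 (mm z) \<noteq> 0" using f.\<phi>1_pos[OF pos] by simp
    then show "mm z * (\<phi>2 (mm z) * M1 z b) + M1 z b * \<phi>1 (mm z)
        = (\<phi>1 (mm z) + mm z * \<phi>2 (mm z)) / \<phi>1 (mm z) * dw z b"
      unfolding dw_inside[OF z] by (simp add: field_simps)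
  qed
  ultimately show ?thesis by simp
qed

text \<open>\<open>dw z (a z)\<close> is evaluated through the definition of \<open>dw\<close> and
  through \<open>w = \<phi>(m)\<close> with the transport equation; equating the two eliminates the
  derivatives of \<open>m\<close>.\<close>

lemma quasilinear_equation:
  assumes z: "z \<in> UNIV \<times> {0<..<T}"
  shows "U2 z (a z) (a z) + mm z * \<phi>1 (mm z) * tr z + Y (fst z) \<bullet> V (p z) = 0"
proof -
  have zs: "z \<in> UNIV \<times> {0..T}" by (rule U.open_slab_slab[OF z])
  have az: "a z = (0, 1) - (V (p z), 0)" by (simp add: a_def)
  have "dw z (a z) = \<phi>1 (mm z) * (M1 z (0, 1) - M1 z (V (p z), 0))"
    unfolding dw_inside[OF z] az by (simp only: linear_diff[OF has_derivative_linear[OF M1[OF zs]]])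
  also have "\<dots> = mm z * \<phi>1 (mm z) * tr z" unfolding transport[OF z] by simp
  finally show ?thesis unfolding dw_def by (simp add: a_def)
qed

sublocale S: separable_mfg where c = c and Hh = "H 0" and V = V and P = P and Q = Q and W = W and Y = Y and Z = Z
  and p = p and dp = dp and a = a and w = w and dw = dw and tr = tr
  and T = T and u = "\<lambda>(x, t). u x t" and U1 = U1 and U2 = U2 and U3 = U3
  and X = "\<lambda>z. mm z * \<phi>1 (mm z)" and X' = "\<lambda>z. (\<phi>1 (mm z) + mm z * \<phi>2 (mm z)) / \<phi>1 (mm z)"
proof (rule separable_mfg.intro)
  show "hamilton_jacobi T (\<lambda>(x, t). u x t) U1 U2 U3 c (H 0) V P Q W Y Z"
    using U.hamilton_jacobi_axioms .
  have pos: "mm z \<in> {0<..}" if "z \<in> UNIV \<times> {0..T}" for z using that m_pos by auto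
  show "separable_mfg_axioms V P Y T U1 U2 (\<lambda>z. mm z * \<phi>1 (mm z))
      (\<lambda>z. (\<phi>1 (mm z) + mm z * \<phi>2 (mm z)) / \<phi>1 (mm z))"
  proof
    show "0 < mm z * \<phi>1 (mm z)" if "z \<in> UNIV \<times> {0<..<T}" for z
      using pos[OF U.open_slab_slab[OF that]] f.\<phi>1_pos[of "mm z"] by simp
    have c: "continuous_on (UNIV \<times> {0..T}) (\<lambda>z. \<phi>1 (mm z))" "continuous_on (UNIV \<times> {0..T}) (\<lambda>z. \<phi>2 (mm z))"
      by (rule continuous_on_compose2[OF f.\<phi>1_cont mm_cont], use pos in blast,
          rule continuous_on_compose2[OF f.\<phi>2_cont mm_cont], use pos in blast)
    have "\<phi>1 (mm z) \<noteq> 0" if "z \<in> UNIV \<times> {0..T}" for z using f.\<phi>1_pos[of "mm z"] pos[OF that] by simp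
    then show "continuous_on (UNIV \<times> {0..T}) (\<lambda>z. (\<phi>1 (mm z) + mm z * \<phi>2 (mm z)) / \<phi>1 (mm z))"
      by (intro continuous_on_divide continuous_on_add continuous_on_mult c mm_cont ballI)
    show "torus_fun (\<lambda>x. (\<phi>1 (mm (x, t)) + mm (x, t) * \<phi>2 (mm (x, t))) / \<phi>1 (mm (x, t)))" if "t \<in> {0..T}" for t
      using m_periodic[OF that] unfolding torus_fun_def by simp
  qed (rule chi_deriv[unfolded dw_def a_def p_def] quasilinear_equation[unfolded tr_def a_def p_def], assumption)+
qed (rule p_def dp_def a_def w_def dw_def tr_def)+

end

section \<open>Bounds for the solution\<close>

context mfg_problem
begin

lemma coupling_g: "coupling g"
  using G unfolding assumption_G_def by blast

text \<open>The limit of \<open>g x\<close> at infinity is the supremum over all points, and strict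
  monotonicity puts this supremum strictly above every value attained at a positive density.\<close>

lemma g_above:
  assumes "0 < s"
  shows "\<exists>t>0. max_over g s < rv g x t"
proof -
  let ?S = "SUP (y, s)\<in>UNIV \<times> {0..}. g y s"
  obtain y where y: "max_over g s = rv g y s" by (rule g.max_over_attained[OF assms])
  have "ereal (rv g y s) < ereal (rv g y (s + 1))" using g.rv_strict[of s "s + 1" y] assms by simp
  also have "\<dots> = (\<lambda>(y, s). g y s) (y, s + 1)" using g.value_eq[of "s + 1" y] assms by simp
  also have "\<dots> \<le> ?S" by (rule SUP_upper) (use assms in simp)
  finally have "ereal (rv g y s) < ?S" .
  moreover have "(g x \<longlongrightarrow> ?S) at_top" using G unfolding assumption_G_def by blast
  ultimately have "eventually (\<lambda>t. ereal (rv g y s) < g x t) at_top" by (intro order_tendstoD(1))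
  then have "eventually (\<lambda>t. ereal (rv g y s) < g x t \<and> 0 < t) at_top"
    using eventually_gt_at_top[of 0] by (rule eventually_conj)
  then obtain t where t: "ereal (rv g y s) < g x t" "0 < t"
    using eventually_happens'[OF trivial_limit_at_top_linorder] by blast
  then have "rv g y s < rv g x t" using g.value_eq[of t x] by simp
  with t y show ?thesis by auto
qed

lemma g_below:
  assumes "0 < s"
  shows "\<exists>t>0. rv g x t < min_over g s"
proof (rule g.below_near_zero)
  obtain y where y: "min_over g s = rv g y s" by (rule g.min_over_attained[OF assms])
  have "g x 0 = (INF (y, s)\<in>UNIV \<times> {0..}. g y s)" using G unfolding assumption_G_def by blast
  also have "\<dots> \<le> (\<lambda>(y, s). g y s) (y, 0)" by (rule INF_lower) simp
  also have "\<dots> < g y s" using g.strict[of 0 s y] assms by simp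
  finally show "g x 0 < ereal (min_over g s)" unfolding y using g.value_eq[OF assms, of y] by simp
qed

lemma w_initial: "\<bar>w (x, 0)\<bar> \<le> 3 * c"
proof -
  have "w (x, 0) = rv f x (m0 x) - fpot x"
    using w_f[of 0 x] T_pos solution unfolding mfg_classical_solution_def by auto
  then show ?thesis using convention_norms(2)[of x x] fpot_bound[of x] by linarith
qed

lemma m_initial: "m x 0 = m0 x"
  and u_terminal: "u x T = rv g x (m x T)"
proof -
  show "m x 0 = m0 x" using solution unfolding mfg_classical_solution_def by blast
  have "ereal (u x T) = g x (m x T)" using solution unfolding mfg_classical_solution_def by blast
  then show "u x T = rv g x (m x T)" using g.value_eq[OF m_pos, of T x x] T_pos by simp
qed

text \<open>Dominates the bound for \<open>f\<close> at the terminal comparison point, namely the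
  slope of the comparison function at \<open>T\<close> plus \<open>c\<close> for
  \<open>H x 0\<close>; its square dominates the comparison function itself on
  \<open>[0, T]\<close>.\<close>

definition L1 where "L1 = 20 * (1 + c)\<^sup>2 * (1 + T)"

lemma L1_bounds:
  shows "c \<le> L1" "T \<le> L1" "9 * c + 1 + (2 * c\<^sup>2 + 1) * T \<le> L1"
    and "0 \<le> t \<Longrightarrow> t \<le> T \<Longrightarrow> (8 * c + 1) * t + (2 * c\<^sup>2 + 1) * t\<^sup>2 / 2 \<le> L1\<^sup>2"
proof -
  define e where "e = (1 + c)\<^sup>2"
  have e: "1 + c \<le> e" "2 * c\<^sup>2 + 1 \<le> 2 * e" unfolding e_def using c1 by (simp_all add: power2_eq_square algebra_simps)
  have L1: "L1 = 20 * e + 20 * (e * T)" unfolding L1_def e_def[symmetric] by (simp add: algebra_simps)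
  have "1 * T \<le> e * T" using e c1 T_pos by (intro mult_right_mono) auto
  then have eT: "T \<le> e * T" by simp
  show cL: "c \<le> L1" unfolding L1 using e(1) eT c1 T_pos by linarith
  show TL: "T \<le> L1" unfolding L1 using e(1) eT c1 T_pos by linarith
  have "(2 * c\<^sup>2 + 1) * T \<le> 2 * e * T" using e T_pos by (intro mult_right_mono) auto
  then show b: "9 * c + 1 + (2 * c\<^sup>2 + 1) * T \<le> L1"
    unfolding L1 using e(1) eT c1 T_pos by linarith
  show "(8 * c + 1) * t + (2 * c\<^sup>2 + 1) * t\<^sup>2 / 2 \<le> L1\<^sup>2" if t: "0 \<le> t" "t \<le> T"
  proof -
    have "t\<^sup>2 \<le> T * t" using t by (simp add: power2_eq_square mult_right_mono)
    then have "(2 * c\<^sup>2 + 1) * t\<^sup>2 \<le> (2 * c\<^sup>2 + 1) * (T * t)" by (intro mult_left_mono) auto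
    moreover have "0 \<le> (2 * c\<^sup>2 + 1) * (T * t)" using t T_pos by simp
    moreover have "0 \<le> c * t" using t c1 by simp
    ultimately have "(8 * c + 1) * t + (2 * c\<^sup>2 + 1) * t\<^sup>2 / 2 \<le> (9 * c + 1 + (2 * c\<^sup>2 + 1) * T) * t"
      by (simp add: algebra_simps)
    also have "\<dots> \<le> L1 * L1"
      using b t TL c1 T_pos cL by (intro mult_mono) auto
    finally show ?thesis by (simp add: power2_eq_square)
  qed
qed

text \<open>At the comparison point \<open>x1\<close> the gradient vanishes, so the equation gives
  \<open>f \<le> L1\<close> there. Inverting \<open>min_over f\<close> bounds \<open>m x1 T\<close>,
  applying \<open>max_over g\<close> bounds \<open>u x1 T\<close>, and the comparison function
  spreads this over the slab. At \<open>t = T\<close> its values cancel, so \<open>u\<close> is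
  bounded there without \<open>L1\<^sup>2\<close>, and inverting \<open>min_over g\<close> bounds
  \<open>m\<close> at \<open>T\<close>.\<close>

lemma solution_upper:
  shows "0 < pos_inv (min_over g) (max_over g (pos_inv (min_over f) L1))"
    and "t \<in> {0..T} \<Longrightarrow> u x t \<le> max_over g (pos_inv (min_over f) L1) + L1\<^sup>2"
    and "m x T \<le> pos_inv (min_over g) (max_over g (pos_inv (min_over f) L1))"
proof -
  define s where "s = pos_inv (min_over f) L1"
  obtain t0 where t0: "0 < t0" "rv f 0 t0 < L1" using f.below by blast
  have s: "0 < s" "\<And>x t. 0 < t \<Longrightarrow> rv f x t \<le> L1 \<Longrightarrow> t \<le> s"
    unfolding s_def using f.min_over_pos_inv[OF f.above t0(1) less_imp_le[OF t0(2)]] by blast+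
  define A where "A = max_over g s"
  have A: "rv g x s \<le> A" for x unfolding A_def by (rule g.max_over_attained[OF s(1)]) 
  note inv = g.min_over_pos_inv[OF g_above[OF s(1), folded A_def] s(1) A]
  obtain x1 where x1: "p (x1, T) = 0" "0 \<le> 1 * U1 (x1, T) (0, 1) + (8 * c + 1) + (2 * c\<^sup>2 + 1) * T"
    and max: "\<And>y t. t \<in> {0..T} \<Longrightarrow>
      1 * (case (y, t) of (x, t) \<Rightarrow> u x t) + (8 * c + 1) * t + (2 * c\<^sup>2 + 1) * t\<^sup>2 / 2
        \<le> 1 * (case (x1, T) of (x, t) \<Rightarrow> u x t) + (8 * c + 1) * T + (2 * c\<^sup>2 + 1) * T\<^sup>2 / 2"
    by (rule S.u_max_at_terminal_time[OF disjI1[OF refl] w_initial]; blast)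
  have T: "T \<in> {0..T}" using T_pos by simp
  have "rv f x1 (m x1 T) = - U1 (x1, T) (0, 1) + H x1 0"
    using hamilton_jacobi_closed[OF T, of x1] f.value_eq[OF m_pos[OF T], of x1 x1] x1(1) by simp
  also have "\<dots> \<le> 9 * c + 1 + (2 * c\<^sup>2 + 1) * T" using x1(2) convention_H(2)[where q = 0 and x = x1] by simp
  also have "\<dots> \<le> L1" by (rule L1_bounds)
  finally have "m x1 T \<le> s" by (rule s(2)[OF m_pos[OF T]])
  then have "rv g x1 (m x1 T) \<le> rv g x1 s" by (rule g.rv_mono[OF m_pos[OF T]])
  then have u1: "u x1 T \<le> A" using A[of x1] unfolding u_terminal by simp
  have up: "u y t \<le> A + L1\<^sup>2" if "t \<in> {0..T}" for y t
  proof -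
    have "0 \<le> (8 * c + 1) * t + (2 * c\<^sup>2 + 1) * t\<^sup>2 / 2" using that c1 by simp
    then show ?thesis using max[OF that, of y] u1 L1_bounds(4)[of T] T_pos by simp
  qed
  show "0 < pos_inv (min_over g) (max_over g (pos_inv (min_over f) L1))" using inv(1) unfolding A_def s_def .
  show "t \<in> {0..T} \<Longrightarrow> u x t \<le> max_over g (pos_inv (min_over f) L1) + L1\<^sup>2" using up unfolding A_def s_def .
  have "u x T \<le> A" using max[OF T, of x] u1 by simp
  then show "m x T \<le> pos_inv (min_over g) (max_over g (pos_inv (min_over f) L1))"
    using inv(3)[OF m_pos[OF T], of x x] unfolding u_terminal A_def s_def by simp
qed

text \<open>The mirror image with \<open>\<sigma> = -1\<close>: the roles of \<open>min_over\<close>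
  and \<open>max_over\<close> are exchanged.\<close>

lemma solution_lower:
  shows "0 < pos_inv (max_over g) (min_over g (pos_inv (max_over f) (- L1)))"
    and "t \<in> {0..T} \<Longrightarrow> min_over g (pos_inv (max_over f) (- L1)) - L1\<^sup>2 \<le> u x t"
    and "pos_inv (max_over g) (min_over g (pos_inv (max_over f) (- L1))) \<le> m x T"
proof -
  define s where "s = pos_inv (max_over f) (- L1)"
  obtain t0 where t0: "0 < t0" "- L1 < rv f 0 t0" using f.above by blast
  have s: "0 < s" "\<And>x t. 0 < t \<Longrightarrow> - L1 \<le> rv f x t \<Longrightarrow> s \<le> t"
    unfolding s_def using f.max_over_pos_inv[OF f.below t0(1) less_imp_le[OF t0(2)]] by blast+
  define A where "A = min_over g s"
  have A: "A \<le> rv g x s" for x unfolding A_def by (rule g.min_over_attained[OF s(1)]) 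
  note inv = g.max_over_pos_inv[OF g_below[OF s(1), folded A_def] s(1) A]
  obtain x1 where x1: "p (x1, T) = 0" "0 \<le> - 1 * U1 (x1, T) (0, 1) + (8 * c + 1) + (2 * c\<^sup>2 + 1) * T"
    and max: "\<And>y t. t \<in> {0..T} \<Longrightarrow>
      - 1 * (case (y, t) of (x, t) \<Rightarrow> u x t) + (8 * c + 1) * t + (2 * c\<^sup>2 + 1) * t\<^sup>2 / 2
        \<le> - 1 * (case (x1, T) of (x, t) \<Rightarrow> u x t) + (8 * c + 1) * T + (2 * c\<^sup>2 + 1) * T\<^sup>2 / 2"
    by (rule S.u_max_at_terminal_time[OF disjI2[OF refl] w_initial]; blast)
  have T: "T \<in> {0..T}" using T_pos by simp
  have "rv f x1 (m x1 T) = - U1 (x1, T) (0, 1) + H x1 0"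
    using hamilton_jacobi_closed[OF T, of x1] f.value_eq[OF m_pos[OF T], of x1 x1] x1(1) by simp
  moreover have "- (9 * c + 1 + (2 * c\<^sup>2 + 1) * T) \<le> - U1 (x1, T) (0, 1) + H x1 0"
    using x1(2) convention_H(1)[where q = 0 and x = x1] by simp
  ultimately have "- L1 \<le> rv f x1 (m x1 T)" using L1_bounds(3) by linarith
  then have "s \<le> m x1 T" by (rule s(2)[OF m_pos[OF T]])
  then have "rv g x1 s \<le> rv g x1 (m x1 T)" by (rule g.rv_mono[OF s(1)])
  then have u1: "A \<le> u x1 T" using A[of x1] unfolding u_terminal by simp
  have up: "A - L1\<^sup>2 \<le> u y t" if "t \<in> {0..T}" for y t
  proof -
    have "0 \<le> (8 * c + 1) * t + (2 * c\<^sup>2 + 1) * t\<^sup>2 / 2" using that c1 by simp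
    then show ?thesis using max[OF that, of y] u1 L1_bounds(4)[of T] T_pos by simp
  qed
  show "0 < pos_inv (max_over g) (min_over g (pos_inv (max_over f) (- L1)))" using inv(1) unfolding A_def s_def .
  show "t \<in> {0..T} \<Longrightarrow> min_over g (pos_inv (max_over f) (- L1)) - L1\<^sup>2 \<le> u x t" using up unfolding A_def s_def .
  have "A \<le> u x T" using max[OF T, of x] u1 by simp
  then show "pos_inv (max_over g) (min_over g (pos_inv (max_over f) (- L1))) \<le> m x T"
    using inv(3)[OF m_pos[OF T], of x x] unfolding u_terminal A_def s_def by simp
qed

text \<open>At \<open>t = 0\<close> the gradient of \<open>w\<close> is \<open>\<phi>1\<close> at
  \<open>m0\<close> times the gradient of \<open>m0\<close>, and each factor is at most
  \<open>c\<close>.\<close>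

lemma dw_initial: "\<bar>dw (x, 0) (y, 0)\<bar> \<le> c\<^sup>2 * norm y"
proof -
  have t: "0 \<in> {0..T}" using T_pos by simp
  have "((\<lambda>y. m y 0) has_derivative (\<lambda>v. M1 (x, 0) (v, 0))) (at x)"
    using slab_slice_derivs(1)[OF M1[OF slab_mem[OF t]] t] by simp
  then have "(m0 has_derivative (\<lambda>v. M1 (x, 0) (v, 0))) (at x)" by (simp add: m_initial)
  from has_derivative_unique[OF this has_derivative_grad_real[OF m0_differentiable]]
  have M: "M1 (x, 0) (y, 0) = grad m0 x \<bullet> y" by (rule fun_cong)
  have "\<bar>grad m0 x \<bullet> y\<bar> \<le> norm (grad m0 x) * norm y" by (rule Cauchy_Schwarz_ineq2)
  also have "\<dots> \<le> c * norm y" by (intro mult_right_mono convention_norms) simp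
  finally have "\<phi>1 (m0 x) * \<bar>grad m0 x \<bullet> y\<bar> \<le> c * (c * norm y)"
    using convention_norms(3)[of x] c1 by (intro mult_mono) auto
  then show ?thesis
    using f.\<phi>1_pos[OF m0_pos, of x] unfolding dw_space[OF t] m_initial M by (simp add: abs_mult power2_eq_square mult.assoc)
qed

text \<open>Differentiating \<open>u = g(x,m)\<close> in \<open>x\<close> at \<open>t = T\<close>
  gives the gradient of \<open>m\<close> as \<open>Du\<close> minus the spatial gradient of
  \<open>g\<close>, divided by the slope of \<open>g\<close>.\<close>

lemma dw_terminal:
  "dw (x, T) (y, 0) = \<phi>1 (m x T) / G1 (x, m x T) (0, 1) * ((p (x, T) - D_x (rv g) x (m x T)) \<bullet> y)"
proof -
  have t: "T \<in> {0..T}" using T_pos by simp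
  have pos: "0 < m x T" by (rule m_pos[OF t])
  have m': "((\<lambda>y. m y T) has_derivative (\<lambda>v. M1 (x, T) (v, 0))) (at x)"
    using slab_slice_derivs(1)[OF M1[OF slab_mem[OF t]] t] by simp
  have u': "((\<lambda>y. u y T) has_derivative (\<lambda>v. U1 (x, T) (v, 0))) (at x)"
    using slab_slice_derivs(1)[OF U.deriv1[OF slab_mem[OF t]] t] by simp
  have "((\<lambda>y. (y, m y T)) has_derivative (\<lambda>v. (v, M1 (x, T) (v, 0)))) (at x)"
    by (intro has_derivative_Pair has_derivative_ident m')
  moreover have "((\<lambda>(x, s). rv g x s) has_derivative G1 (x, m x T)) (at (x, m x T))"
    by (rule g.interior_derivs(1)) (simp add: g.product_interior pos)
  ultimately have "((\<lambda>y. (\<lambda>(x, s). rv g x s) (y, m y T)) has_derivative (\<lambda>v. G1 (x, m x T) (v, M1 (x, T) (v, 0)))) (at x)"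
    by (rule has_derivative_compose)
  then have "((\<lambda>y. u y T) has_derivative (\<lambda>v. G1 (x, m x T) (v, M1 (x, T) (v, 0)))) (at x)"
    by (simp add: u_terminal)
  from fun_cong[OF has_derivative_unique[OF u' this], of y]
  have "U1 (x, T) (y, 0) = G1 (x, m x T) ((y, 0) + (0, M1 (x, T) (y, 0)))" by simp
  also have "\<dots> = G1 (x, m x T) (y, 0) + G1 (x, m x T) (0, M1 (x, T) (y, 0))"
    by (rule linear_add[OF g.lin1])
  also have "G1 (x, m x T) (0, M1 (x, T) (y, 0)) = M1 (x, T) (y, 0) * G1 (x, m x T) (0, 1)"
    using linear_snd[OF g.lin1, of "(x, m x T)" "M1 (x, T) (y, 0)"] by simp
  also have "G1 (x, m x T) (y, 0) = D_x (rv g) x (m x T) \<bullet> y"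
    unfolding g.D_x_rv[OF pos] linear_axis_sum[OF g.lin1, of _ y] by (simp add: inner_vec_def mult.commute)
  finally have "(p (x, T) - D_x (rv g) x (m x T)) \<bullet> y = M1 (x, T) (y, 0) * G1 (x, m x T) (0, 1)"
    by (simp add: U.U1_space inner_diff_left)
  then show ?thesis using g.D_m_rv_pos[OF pos, of x] unfolding dw_space[OF t] by (simp add: field_simps)
qed

end

section \<open>The gradient estimate with explicit constants\<close>

context mfg_problem
begin

lemma gradient_estimate:
  fixes L :: real
  defines "K \<equiv> CARD('d) + 12 * (1 + L) * (1 + 1 / T) + max 0 (- min_over f (1 / L))"
  defines "b \<equiv> enn2real (beta f g K)"
  assumes L: "L1 \<le> L" "1 \<le> L" and u: "\<And>x t. t \<in> {0..T} \<Longrightarrow> \<bar>u x t\<bar> \<le> L"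
    and m: "\<And>x. 1 / L \<le> m x T" "\<And>x. m x T \<le> L" and t: "t \<in> {0..T}"
  shows "norm (D_x u x t, D_t T u x t) \<le> 1 + 32 * K ^ 3 * (2000 * (1 + b) ^ 4 * K ^ 24)"
proof -
  define f0 where "f0 = max 0 (- min_over f (1 / L))"
  \<comment> \<open>\<open>K\<close> exceeds \<open>k\<close> by at least \<open>2 * c\<close>, the
    bound for \<open>fpot\<close>. Hence \<open>w z \<ge> - k\<close> implies
    \<open>rv f \<ge> - K\<close>, which is the range where \<open>beta f g K\<close> controls the
    derivative of \<open>h\<close>.\<close>
  define k where "k = CARD('d) + 10 * (1 + L) * (1 + 1 / T) + f0"
  \<comment> \<open>With these coefficients \<open>u + a0 + a1 * t\<close> is at most -1 at
    \<open>t = 0\<close> and at least 1 at \<open>t = T\<close>, because \<open>u\<close> lies in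
    \<open>[-L, L]\<close>.\<close>
  define a0 where "a0 = - L - 1"
  define a1 where "a1 = (2 * L + 2) / T"
  have cL: "c \<le> L" using L1_bounds(1) L by simp
  have f0: "0 \<le> f0" "- f0 \<le> min_over f (1 / L)" unfolding f0_def by auto
  define q where "q = (1 + L) / T"
  have LT: "(1 + L) * (1 + 1 / T) = 1 + L + q" unfolding q_def by (simp add: algebra_simps add_divide_distrib)
  have LT0: "0 < q" unfolding q_def using L T_pos by simp
  have "K = k + 2 * ((1 + L) * (1 + 1 / T))" unfolding K_def k_def f0_def mult.assoc by linarith
  then have kK: "K = k + 2 * (1 + L + q)" unfolding LT .
  have k: "k = CARD('d) + 10 * (1 + L + q) + f0" unfolding k_def mult.assoc LT by simp
  have card: "1 \<le> real CARD('d)" by (simp add: Suc_leI)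
  have kb: "c \<le> k" "CARD('d) \<le> k" "10 + 10 * L + f0 \<le> k" "\<bar>a1\<bar> \<le> k" "k + 2 * c \<le> K" "1 \<le> k"
  proof -
    have "a1 = 2 * q" unfolding a1_def q_def by (simp add: add_divide_distrib algebra_simps)
    then have "\<bar>a1\<bar> = 2 * q" using LT0 by simp
    moreover have "0 \<le> f0" "1 \<le> L" by (fact f0(1), fact L(2))
    ultimately show "\<bar>a1\<bar> \<le> k" "c \<le> k" "CARD('d) \<le> k" "10 + 10 * L + f0 \<le> k" "k + 2 * c \<le> K" "1 \<le> k"
      using LT0 card cL k kK by simp_all
  qed
  have K0: "0 < K" using kb c1 by linarith
  note beta = f.beta_bounds[OF coupling_g K0, folded b_def]
  have T: "T \<in> {0..T}" "0 \<in> {0..T}" using T_pos by auto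
  have LK: "m x T \<in> {1 / K..K}" for x
  proof -
    have "L \<le> K" using kb c1 f0 L by linarith
    then have "1 / K \<le> 1 / L" using L by (intro divide_left_mono) auto
    then show ?thesis using m[of x] \<open>L \<le> K\<close> by auto
  qed
  have w0: "\<bar>w (x, 0)\<bar> \<le> 3 * L" for x using w_initial[of x] cL by linarith
  have wT: "- f0 - 2 * L \<le> w (x, T)" "w (x, T) \<le> b + 2 * L" for x
  proof -
    have "min_over f (1 / L) \<le> rv f x (1 / L)" by (rule f.min_over_attained[of "1 / L"]) (use L in simp)
    also have "\<dots> \<le> rv f x (m x T)" by (rule f.rv_mono) (use L m in auto)
    finally show "- f0 - 2 * L \<le> w (x, T)" using f0 fpot_bound[of x] cL unfolding w_f[OF T(1)] by linarith
    show "w (x, T) \<le> b + 2 * L" using beta(2)[OF LK, of x x] fpot_bound[of x] cL unfolding w_f[OF T(1)] by linarith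
  qed
  have w_lower: "- (k - 1) \<le> w (x, t)" and w_upper: "w (x, t) \<le> k + b" if "t \<in> {0, T}" for x t
    using that w0[of x] wT[of x] kb(3) f0 L beta(1) by auto
  have ut: "\<bar>(\<lambda>(x, t). u x t) z + a0 + a1 * snd z\<bar> \<le> k" if "z \<in> UNIV \<times> {0..T}" for z
  proof -
    obtain x t where z: "z = (x, t)" "t \<in> {0..T}" using \<open>z \<in> _\<close> by (cases z) auto
    have "0 \<le> a1" unfolding a1_def using L T_pos by simp
    then have "0 \<le> a1 * t" "a1 * t \<le> a1 * T" using z by (auto intro: mult_left_mono)
    moreover have "a1 * T = 2 * L + 2" unfolding a1_def using T_pos by simp
    ultimately show ?thesis using u[OF z(2), of x] kb(3) f0 L unfolding z a0_def by auto
  qed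
  have X': "\<bar>(\<phi>1 (mm z) + mm z * \<phi>2 (mm z)) / \<phi>1 (mm z)\<bar> \<le> 2 * b * sqrt (mm z * \<phi>1 (mm z))"
    if z: "z \<in> UNIV \<times> {0<..<T}" and w: "- k \<le> w z" for z
  proof -
    obtain x t where xt: "z = (x, t)" "t \<in> {0..T}" using z by (cases z) auto
    have "- K \<le> rv f x (m x t)"
      using w fpot_bound[of x] kb(5) unfolding xt(1) w_f[OF xt(2)] by linarith
    from beta(4)[OF m_pos[OF xt(2)] this] show ?thesis unfolding xt by simp
  qed
  have dwT: "\<exists>\<alpha> \<gamma>. 0 < \<alpha> \<and> norm \<gamma> \<le> b \<and> (\<forall>y. dw (x, T) (y, 0) = \<alpha> * ((p (x, T) - \<gamma>) \<bullet> y))" for x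
  proof (intro exI conjI allI)
    show "0 < \<phi>1 (m x T) / G1 (x, m x T) (0, 1)"
      using f.\<phi>1_pos g.D_m_rv_pos m_pos[OF T(1)] by simp
    show "norm (D_x (rv g) x (m x T)) \<le> b" by (rule beta(3)[OF LK])
    show "dw (x, T) (y, 0) = \<phi>1 (m x T) / G1 (x, m x T) (0, 1) * ((p (x, T) - D_x (rv g) x (m x T)) \<bullet> y)" for y
      by (rule dw_terminal)
  qed
  have uT: "1 \<le> (\<lambda>(x, t). u x t) (x, T) + a0 + a1 * snd (x, T)" for x
    using u[OF T(1), of x] T_pos unfolding a0_def a1_def by auto
  have u0: "(\<lambda>(x, t). u x t) (x, 0) + a0 + a1 * snd (x, 0 :: real) \<le> - 1" for x
    using u[OF T(2), of x] unfolding a0_def by auto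
  have "bernstein c (H 0) V P Q W Y Z T (\<lambda>(x, t). u x t) U1 U2 U3
      (\<lambda>z. mm z * \<phi>1 (mm z)) (\<lambda>z. (\<phi>1 (mm z) + mm z * \<phi>2 (mm z)) / \<phi>1 (mm z)) k b a0 a1"
    by unfold_locales
      (rule kb(1) kb(2) kb(4) beta(1) ut u0 uT X'[unfolded w_def p_def] w_lower[unfolded w_def p_def]
        w_upper[unfolded w_def p_def] dw_initial[unfolded dw_def a_def p_def] dwT[unfolded dw_def a_def p_def];
        assumption?)+
  note bounds = bernstein.gradient_bound[OF this slab_mem[OF t], of x, folded p_def]
  define R where "R = 2000 * (1 + b) ^ 4 * k ^ 24"
  define R' where "R' = 2000 * (1 + b) ^ 4 * K ^ 24"
  have R: "0 \<le> R" "R \<le> R'" unfolding R_def R'_def using kb beta(1) c1 by (auto intro!: mult_mono power_mono)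
  have "(norm (p (x, t)))\<^sup>2 \<le> 12 * k\<^sup>2 * R" "\<bar>U1 (x, t) (0, 1)\<bar> \<le> 20 * k ^ 3 * R"
    using bounds unfolding p_def R_def by simp_all
  moreover have "k\<^sup>2 * R \<le> K ^ 3 * R'"
  proof (intro mult_mono R)
    have "k\<^sup>2 \<le> K\<^sup>2" using kb c1 by (intro power_mono) auto
    also have "\<dots> \<le> K ^ 3" using kb c1 by (intro power_increasing) auto
    finally show "k\<^sup>2 \<le> K ^ 3" .
  qed (use K0 in auto)
  moreover have "k ^ 3 * R \<le> K ^ 3 * R'" using R kb c1 by (intro mult_mono power_mono) auto
  \<comment> \<open>Avoids a square root in the constant: 12 from the square of the norm and 20 from
    the time derivative add up to the factor 32, and the 1 is the leading summand.\<close>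
  moreover have "norm (p (x, t)) \<le> 1 + (norm (p (x, t)))\<^sup>2"
  proof -
    have "0 \<le> (norm (p (x, t)) - 1)\<^sup>2" by simp
    then have "2 * norm (p (x, t)) \<le> 1 + (norm (p (x, t)))\<^sup>2" by (simp add: power2_diff)
    moreover have "0 \<le> norm (p (x, t))" by simp
    ultimately show ?thesis by linarith
  qed
  moreover have "norm (p (x, t), U1 (x, t) (0, 1)) \<le> norm (p (x, t)) + \<bar>U1 (x, t) (0, 1)\<bar>"
    using norm_Pair_le[of "p (x, t)" "U1 (x, t) (0, 1)"] by simp
  ultimately show ?thesis
    unfolding D_x_u[OF t] D_t_u[OF t] R'_def[symmetric] by simp
qed

end

section \<open>The explicit constants and the theorem\<close>

lemma monotone_constant2:
  assumes "\<And>a b a' b'. 0 \<le> a \<Longrightarrow> a \<le> a' \<Longrightarrow> 0 \<le> b \<Longrightarrow> b \<le> b' \<Longrightarrow> 0 < F a b \<and> F a b \<le> F a' b'"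
  shows "monotone_constant (\<lambda>xs. case xs of [a, b] \<Rightarrow> F a b | _ \<Rightarrow> 1)"
  unfolding monotone_constant_def
  by (auto simp: list_all2_Cons1 assms split: list.splits)

lemma monotone_constant4:
  assumes "\<And>a b c d a' b' c' d'. 0 \<le> a \<Longrightarrow> a \<le> a' \<Longrightarrow> 0 \<le> b \<Longrightarrow> b \<le> b' \<Longrightarrow> 0 \<le> c \<Longrightarrow> c \<le> c' \<Longrightarrow>
    0 \<le> d \<Longrightarrow> d \<le> d' \<Longrightarrow> 0 < F a b c d \<and> F a b c d \<le> F a' b' c' d'"
  shows "monotone_constant (\<lambda>xs. case xs of [a, b, c, d] \<Rightarrow> F a b c d | _ \<Rightarrow> 1)"
  unfolding monotone_constant_def
  by (auto simp: list_all2_Cons1 assms split: list.splits)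

lemma monotone_constant5:
  assumes "\<And>a b c d e a' b' c' d' e'. 0 \<le> a \<Longrightarrow> a \<le> a' \<Longrightarrow> 0 \<le> b \<Longrightarrow> b \<le> b' \<Longrightarrow> 0 \<le> c \<Longrightarrow> c \<le> c' \<Longrightarrow>
    0 \<le> d \<Longrightarrow> d \<le> d' \<Longrightarrow> 0 \<le> e \<Longrightarrow> e \<le> e' \<Longrightarrow> 0 < F a b c d e \<and> F a b c d e \<le> F a' b' c' d' e'"
  shows "monotone_constant (\<lambda>xs. case xs of [a, b, c, d, e] \<Rightarrow> F a b c d e | _ \<Rightarrow> 1)"
  unfolding monotone_constant_def
  by (auto simp: list_all2_Cons1 assms split: list.splits)

lemma mfg_problem_obtain:
  fixes H :: "real ^ 'd \<Rightarrow> real ^ 'd \<Rightarrow> real"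
  assumes "0 < c" "0 < T" "assumption_M m0" "assumption_H c \<tau> H" "assumption_F c \<tau> f" "assumption_G g"
    "assumption_SE f" "C0_convention c \<tau> H f m0" "\<forall>x p. D_x (D_p H) x p = 0" "\<forall>x. \<forall>s>0. D_m (D_x (rv f)) x s = 0"
    "Limsup (top \<times>\<^sub>F at_top) (\<lambda>(x, w). ereal \<bar>D_m (h_f f) x w\<bar>) < \<infinity>"
    and sol: "mfg_classical_solution T H f g m0 u m"
  obtains U1 U2 U3 F1 F2 F3 G1 G2 G3 M1 where "mfg_problem c \<tau> T H f g m0 u m U1 U2 U3 F1 F2 F3 G1 G2 G3 M1"
proof -
  have int: "interior ((UNIV :: (real ^ 'd) set) \<times> {0..T}) = UNIV \<times> {0<..<T}" by (simp add: interior_Times)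
  have cl: "(UNIV :: (real ^ 'd) set) \<times> {0..T} \<subseteq> closure (interior (UNIV \<times> {0..T}))"
    unfolding int closure_Times using assms(2) by (simp add: closure_greaterThanLessThan)
  have "Ck_on 3 (UNIV \<times> {0..T}) (\<lambda>(x, t). u x t)" using sol unfolding mfg_classical_solution_def by blast
  from Ck_on_3_obtain[OF this cl] obtain U1 U2 U3 where U: "C3_function (UNIV \<times> {0..T}) (\<lambda>(x, t). u x t) U1 U2 U3" .
  have "coupling f" using assms(5) unfolding assumption_F_def by blast
  from smooth_coupling_obtain[OF this] obtain F1 F2 F3 where F: "smooth_coupling f F1 F2 F3" .
  have "coupling g" using assms(6) unfolding assumption_G_def by blast
  from smooth_coupling_obtain[OF this] obtain G1 G2 G3 where G: "smooth_coupling g G1 G2 G3" .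
  have "Ck_on 2 (UNIV \<times> {0..T}) (\<lambda>(x, t). m x t)" using sol unfolding mfg_classical_solution_def by blast
  then have "Ck_on (Suc (Suc 0)) (UNIV \<times> {0..T}) (\<lambda>(x, t). m x t)" by (simp only: numeral_2_eq_2)
  then obtain M1 where M1: "\<And>z. z \<in> UNIV \<times> {0..T} \<Longrightarrow>
      ((\<lambda>(x, t). m x t) has_derivative M1 z) (at z within UNIV \<times> {0..T})"
    by (rule Ck_on_Suc_obtain; blast)
  show thesis
    by (rule that[of U1 U2 U3 F1 F2 F3 G1 G2 G3 M1], rule mfg_problem.intro)
      (rule assms assms(9)[rule_format] assms(10)[rule_format] U F G M1; assumption?)+
qed

text \<open>The four constants are quantified before the data and thus depend on the dimension alone
  apart from their arguments. Positivity of \<open>m\<close> at \<open>T\<close> is stated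
  separately because \<open>1 / 0 = 0\<close> would let the norm of \<open>1 / m\<close> miss a zero
  of \<open>m\<close>.\<close>

theorem theorem3p10:
  "\<exists>L\<^sub>1C LC K\<^sub>1C KC :: real list \<Rightarrow> real.
     monotone_constant L\<^sub>1C \<and> monotone_constant LC \<and> monotone_constant K\<^sub>1C \<and> monotone_constant KC \<and>
     (\<forall>(C\<^sub>0 :: real) (\<tau> :: real) (T :: real)
       (H :: real ^ 'd \<Rightarrow> real ^ 'd \<Rightarrow> real)
       (f :: real ^ 'd \<Rightarrow> real \<Rightarrow> ereal) (g :: real ^ 'd \<Rightarrow> real \<Rightarrow> ereal)
       (m\<^sub>0 :: real ^ 'd \<Rightarrow> real)
       (u :: real ^ 'd \<Rightarrow> real \<Rightarrow> real) (m :: real ^ 'd \<Rightarrow> real \<Rightarrow> real).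
        0 < C\<^sub>0 \<longrightarrow> 0 \<le> \<tau> \<longrightarrow> \<tau> < 1 \<longrightarrow> 0 < T \<longrightarrow>
        assumption_M m\<^sub>0 \<longrightarrow> assumption_H C\<^sub>0 \<tau> H \<longrightarrow> assumption_F C\<^sub>0 \<tau> f \<longrightarrow>
        assumption_G g \<longrightarrow> assumption_SE f \<longrightarrow> C0_convention C\<^sub>0 \<tau> H f m\<^sub>0 \<longrightarrow>
        (\<forall>x p. D_x (D_p H) x p = 0) \<longrightarrow>
        (\<forall>x. \<forall>s>0. D_m (D_x (rv f)) x s = 0) \<longrightarrow>
        Limsup (top \<times>\<^sub>F at_top) (\<lambda>(x, w). ereal \<bar>D_m (h_f f) x w\<bar>) < \<infinity> \<longrightarrow>
        mfg_classical_solution T H f g m\<^sub>0 u m \<longrightarrow>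
        (let f\<^sub>0 = min_over f; f\<^sub>1 = max_over f; g\<^sub>0 = min_over g; g\<^sub>1 = max_over g;
             L\<^sub>1 = L\<^sub>1C [C\<^sub>0, T];
             L = LC [L\<^sub>1,
                     \<bar>g\<^sub>1 (pos_inv f\<^sub>0 L\<^sub>1)\<bar>,
                     \<bar>g\<^sub>0 (pos_inv f\<^sub>1 (- L\<^sub>1))\<bar>,
                     pos_inv g\<^sub>0 (g\<^sub>1 (pos_inv f\<^sub>0 L\<^sub>1)),
                     1 / pos_inv g\<^sub>1 (g\<^sub>0 (pos_inv f\<^sub>1 (- L\<^sub>1)))];
             K\<^sub>1 = K\<^sub>1C [L, 1 / T, 1 / (1 - \<tau>), max 0 (- f\<^sub>0 (1 / L))];
             K = KC [K\<^sub>1, enn2real (beta f g K\<^sub>1)]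
         in (\<forall>x. 0 < m x T) \<and>
            C0_norm (UNIV \<times> {0..T}) (\<lambda>(x, t). u x t) +
            C0_norm UNIV (\<lambda>x. m x T) +
            C0_norm UNIV (\<lambda>x. 1 / m x T) \<le> ennreal L \<and>
            C0_norm (UNIV \<times> {0..T}) (\<lambda>(x, t). (D_x u x t, D_t T u x t)) \<le> ennreal K))"
proof -
  \<comment> \<open>Lists of any other length get the value 1, since
    \<open>monotone_constant\<close> ranges over lists of all lengths.\<close>
  define L1C :: "real list \<Rightarrow> real" where
    "L1C = (\<lambda>xs. case xs of [c, T] \<Rightarrow> 20 * (1 + c)\<^sup>2 * (1 + T) | _ \<Rightarrow> 1)"
  \<comment> \<open>The summands bound \<open>u\<close>, \<open>m\<close> at \<open>T\<close> and
    its inverse, in total \<open>a\<^sup>2 + b + c + d + e\<close>; the terms \<open>1 + a\<close>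
    secure \<open>1 \<le> L\<close> and \<open>L1 \<le> L\<close>, as the gradient estimate
    requires.\<close>
  define LC :: "real list \<Rightarrow> real" where
    "LC = (\<lambda>xs. case xs of [a, b, c, d, e] \<Rightarrow> 1 + a + a\<^sup>2 + b + c + d + e | _ \<Rightarrow> 1)"
  define K1C :: "real list \<Rightarrow> real" where
    "K1C = (\<lambda>xs. case xs of [a, b, c, d] \<Rightarrow> real CARD('d) + 12 * (1 + a) * (1 + b) + d | _ \<Rightarrow> 1)"
  define KC :: "real list \<Rightarrow> real" where
    "KC = (\<lambda>xs. case xs of [a, b] \<Rightarrow> 1 + 32 * a ^ 3 * (2000 * (1 + b) ^ 4 * a ^ 24) | _ \<Rightarrow> 1)"
  have "monotone_constant L1C" unfolding L1C_def
  proof (intro monotone_constant2 conjI)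
    fix a b a' b' :: real assume le: "0 \<le> a" "a \<le> a'" "0 \<le> b" "b \<le> b'"
    show "0 < 20 * (1 + a)\<^sup>2 * (1 + b)" using le by (intro mult_pos_pos zero_less_power) linarith+
    show "20 * (1 + a)\<^sup>2 * (1 + b) \<le> 20 * (1 + a')\<^sup>2 * (1 + b')"
      by (intro mult_mono power_mono) (use le in simp_all)
  qed
  moreover have "monotone_constant LC" unfolding LC_def
  proof (intro monotone_constant5 conjI)
    fix a b c d e a' b' c' d' e' :: real
    assume le: "0 \<le> a" "a \<le> a'" "0 \<le> b" "b \<le> b'" "0 \<le> c" "c \<le> c'" "0 \<le> d" "d \<le> d'" "0 \<le> e" "e \<le> e'"
    have "0 \<le> a\<^sup>2" by simp
    then show "0 < 1 + a + a\<^sup>2 + b + c + d + e" using le by linarith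
    have "a\<^sup>2 \<le> a'\<^sup>2" using le by (intro power_mono) auto
    then show "1 + a + a\<^sup>2 + b + c + d + e \<le> 1 + a' + a'\<^sup>2 + b' + c' + d' + e'" using le by linarith
  qed
  moreover have "monotone_constant K1C" unfolding K1C_def
  proof (intro monotone_constant4 conjI)
    fix a b c d a' b' c' d' :: real
    assume le: "0 \<le> a" "a \<le> a'" "0 \<le> b" "b \<le> b'" "0 \<le> c" "c \<le> c'" "0 \<le> d" "d \<le> d'"
    have "0 < 12 * (1 + a) * (1 + b)" using le by (intro mult_pos_pos) linarith+
    then show "0 < real CARD('d) + 12 * (1 + a) * (1 + b) + d" using le by linarith
    have "12 * (1 + a) * (1 + b) \<le> 12 * (1 + a') * (1 + b')" by (intro mult_mono) (use le in simp_all)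
    then show "real CARD('d) + 12 * (1 + a) * (1 + b) + d \<le> real CARD('d) + 12 * (1 + a') * (1 + b') + d'"
      using le by linarith
  qed
  moreover have "monotone_constant KC" unfolding KC_def
  proof (intro monotone_constant2 conjI)
    fix a b a' b' :: real assume le: "0 \<le> a" "a \<le> a'" "0 \<le> b" "b \<le> b'"
    have "0 \<le> 32 * a ^ 3 * (2000 * (1 + b) ^ 4 * a ^ 24)"
      by (intro mult_nonneg_nonneg zero_le_power) (use le in simp_all)
    then show "0 < 1 + 32 * a ^ 3 * (2000 * (1 + b) ^ 4 * a ^ 24)" by linarith
    show "1 + 32 * a ^ 3 * (2000 * (1 + b) ^ 4 * a ^ 24) \<le> 1 + 32 * a' ^ 3 * (2000 * (1 + b') ^ 4 * a' ^ 24)"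
      by (intro add_left_mono mult_mono power_mono mult_nonneg_nonneg zero_le_power) (use le in simp_all)
  qed
  moreover have main: "(let f\<^sub>0 = min_over f; f\<^sub>1 = max_over f; g\<^sub>0 = min_over g; g\<^sub>1 = max_over g;
             L\<^sub>1 = L1C [C\<^sub>0, T];
             L = LC [L\<^sub>1,
                     \<bar>g\<^sub>1 (pos_inv f\<^sub>0 L\<^sub>1)\<bar>,
                     \<bar>g\<^sub>0 (pos_inv f\<^sub>1 (- L\<^sub>1))\<bar>,
                     pos_inv g\<^sub>0 (g\<^sub>1 (pos_inv f\<^sub>0 L\<^sub>1)),
                     1 / pos_inv g\<^sub>1 (g\<^sub>0 (pos_inv f\<^sub>1 (- L\<^sub>1)))];
             K\<^sub>1 = K1C [L, 1 / T, 1 / (1 - \<tau>), max 0 (- f\<^sub>0 (1 / L))];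
             K = KC [K\<^sub>1, enn2real (beta f g K\<^sub>1)]
         in (\<forall>x. 0 < m x T) \<and>
            C0_norm (UNIV \<times> {0..T}) (\<lambda>(x, t). u x t) +
            C0_norm UNIV (\<lambda>x. m x T) +
            C0_norm UNIV (\<lambda>x. 1 / m x T) \<le> ennreal L \<and>
            C0_norm (UNIV \<times> {0..T}) (\<lambda>(x, t). (D_x u x t, D_t T u x t)) \<le> ennreal K)"
    if T: "0 < T" and data: "0 < C\<^sub>0"
      "assumption_M m\<^sub>0" "assumption_H C\<^sub>0 \<tau> H" "assumption_F C\<^sub>0 \<tau> f" "assumption_G g" "assumption_SE f"
      "C0_convention C\<^sub>0 \<tau> H f m\<^sub>0" "\<forall>x p. D_x (D_p H) x p = 0" "\<forall>x. \<forall>s>0. D_m (D_x (rv f)) x s = 0"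
      "Limsup (top \<times>\<^sub>F at_top) (\<lambda>(x, w). ereal \<bar>D_m (h_f f) x w\<bar>) < \<infinity>"
      "mfg_classical_solution T H f g m\<^sub>0 u m"
    for C\<^sub>0 \<tau> T :: real and H :: "real ^ 'd \<Rightarrow> real ^ 'd \<Rightarrow> real" and f g m\<^sub>0 u m
  proof -
    obtain U1 U2 U3 F1 F2 F3 G1 G2 G3 M1 where
      P: "mfg_problem C\<^sub>0 \<tau> T H f g m\<^sub>0 u m U1 U2 U3 F1 F2 F3 G1 G2 G3 M1"
      by (rule mfg_problem_obtain[OF data(1) T data(2-)])
    define L1 where "L1 = L1C [C\<^sub>0, T]"
    define A where "A = max_over g (pos_inv (min_over f) L1)"
    define B where "B = min_over g (pos_inv (max_over f) (- L1))"
    define Mx where "Mx = pos_inv (min_over g) A"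
    define mn where "mn = pos_inv (max_over g) B"
    define L where "L = LC [L1, \<bar>A\<bar>, \<bar>B\<bar>, Mx, 1 / mn]"
    define K1 where "K1 = K1C [L, 1 / T, 1 / (1 - \<tau>), max 0 (- min_over f (1 / L))]"
    have L1: "mfg_problem.L1 C\<^sub>0 T = L1"
      unfolding mfg_problem.L1_def[OF P] L1_def L1C_def by simp
    note up = mfg_problem.solution_upper[OF P, unfolded L1, folded A_def, folded Mx_def]
      and low = mfg_problem.solution_lower[OF P, unfolded L1, folded B_def, folded mn_def]
    note Mx = up(1) and mn = low(1) and u = up(2) low(2) and m = up(3) low(3)
    have L1_pos: "0 \<le> L1" using mfg_problem.L1_bounds(2)[OF P] T unfolding L1 by linarith
    have L: "L = 1 + L1 + L1\<^sup>2 + \<bar>A\<bar> + \<bar>B\<bar> + Mx + 1 / mn" unfolding L_def LC_def by simp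
    have pos: "0 < 1 / mn" "0 \<le> L1\<^sup>2" using mn by simp_all
    have L_ge: "1 \<le> L" "L1 \<le> L" "Mx \<le> L" "1 / mn \<le> L" unfolding L using pos Mx L1_pos by linarith+
    have u_abs: "\<bar>u x t\<bar> \<le> \<bar>A\<bar> + \<bar>B\<bar> + L1\<^sup>2" if "t \<in> {0..T}" for x t
      using u(1)[OF that, of x] u(2)[OF that, of x] pos by linarith
    have uL: "\<bar>u x t\<bar> \<le> L" if "t \<in> {0..T}" for x t
      using u_abs[OF that, of x] pos Mx L1_pos unfolding L by linarith
    have m_pos: "0 < m x T" for x using m(2)[of x] mn by linarith
    have "1 / L \<le> mn" using L_ge mn by (simp add: field_simps)
    then have mL: "1 / L \<le> m x T" "m x T \<le> L" for x
      using m[of x] L_ge by linarith+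
    have K: "K1 = CARD('d) + 12 * (1 + L) * (1 + 1 / T) + max 0 (- min_over f (1 / L))"
      unfolding K1_def K1C_def by simp
    have grad: "norm (D_x u x t, D_t T u x t) \<le> KC [K1, enn2real (beta f g K1)]" if "t \<in> {0..T}" for x t
      using mfg_problem.gradient_estimate[OF P, of L, unfolded L1 K[symmetric], OF L_ge(2,1) uL mL that]
      unfolding KC_def by simp
    have "C0_norm (UNIV \<times> {0..T}) (\<lambda>(x, t). u x t) \<le> ennreal (\<bar>A\<bar> + \<bar>B\<bar> + L1\<^sup>2)"
      by (rule C0_norm_le) (use u_abs in auto)
    moreover have "C0_norm UNIV (\<lambda>x. m x T) \<le> ennreal Mx"
    proof (rule C0_norm_le)
      show "norm (m x T) \<le> Mx" for x using m(1)[of x] m_pos[of x] by simp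
    qed
    moreover have "C0_norm UNIV (\<lambda>x. 1 / m x T) \<le> ennreal (1 / mn)"
    proof (rule C0_norm_le)
      show "norm (1 / m x T) \<le> 1 / mn" for x
        using divide_left_mono[OF m(2)[of x], of 1] mn m_pos[of x] by simp
    qed
    ultimately have "C0_norm (UNIV \<times> {0..T}) (\<lambda>(x, t). u x t) + C0_norm UNIV (\<lambda>x. m x T) + C0_norm UNIV (\<lambda>x. 1 / m x T)
        \<le> ennreal (\<bar>A\<bar> + \<bar>B\<bar> + L1\<^sup>2) + ennreal Mx + ennreal (1 / mn)"
      by (intro add_mono)
    also have "\<dots> = ennreal (\<bar>A\<bar> + \<bar>B\<bar> + L1\<^sup>2 + Mx + 1 / mn)"
      using pos Mx by (simp add: ennreal_plus[symmetric] del: ennreal_plus)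
    also have "\<dots> \<le> ennreal L" by (rule ennreal_leI) (use L1_pos L in linarith)
    finally have 1: "C0_norm (UNIV \<times> {0..T}) (\<lambda>(x, t). u x t) + C0_norm UNIV (\<lambda>x. m x T)
        + C0_norm UNIV (\<lambda>x. 1 / m x T) \<le> ennreal L" .
    have 2: "C0_norm (UNIV \<times> {0..T}) (\<lambda>(x, t). (D_x u x t, D_t T u x t)) \<le> ennreal (KC [K1, enn2real (beta f g K1)])"
    proof (rule C0_norm_le)
      fix z :: "(real ^ 'd) \<times> real" assume "z \<in> UNIV \<times> {0..T}"
      then show "norm ((\<lambda>(x, t). (D_x u x t, D_t T u x t)) z) \<le> KC [K1, enn2real (beta f g K1)]"
        using grad[of "snd z" "fst z"] by (cases z) simp
    qed
    have "(\<forall>x. 0 < m x T) \<and>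
      C0_norm (UNIV \<times> {0..T}) (\<lambda>(x, t). u x t) + C0_norm UNIV (\<lambda>x. m x T) + C0_norm UNIV (\<lambda>x. 1 / m x T) \<le> ennreal L \<and>
      C0_norm (UNIV \<times> {0..T}) (\<lambda>(x, t). (D_x u x t, D_t T u x t)) \<le> ennreal (KC [K1, enn2real (beta f g K1)])"
      by (intro conjI allI m_pos 1 2)
    then show ?thesis
      unfolding Let_def L1_def[symmetric] A_def[symmetric] B_def[symmetric] Mx_def[symmetric] mn_def[symmetric]
        L_def[symmetric] K1_def[symmetric] .
  qed
  ultimately show ?thesis
    by (intro exI[of _ L1C] exI[of _ LC] exI[of _ K1C] exI[of _ KC] conjI allI impI) (assumption | rule main)+
qed

end
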